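(* Let $c'\in\mathbb{Q}$ and $r\in\{1/2,1/3,1/6,1/12\}$, and let $M':=\mathrm{lcd}(1/3,r,c')$ be the least positive common denominator of $1/3$, $r$ and $c'$. Let $f^{\sharp}_{\mathrm{HD}_{\mathbb{K}_5(r)}}$ be the weight two Hecke eigenform attached to $r$, namely (with LMFDB labels) $f_{36.2.a.a}$ if $r\in\{1/2,1/6\}$, $f_{27.2.a.a}$ if $r=1/3$, and $f_{432.2.c.a}$ if $r=1/12$, and let $a_p(f^{\sharp}_{\mathrm{HD}_{\mathbb{K}_5(r)}})$ be its $p$-th Fourier coefficient. Then for every prime $p\equiv1\pmod{M'}$ and every prime ideal $\mathfrak{p}$ of $\mathbb{Z}[\zeta_{M'}]$ lying above $p$, $$\begin{aligned}a_p\left(f^{\sharp}_{\mathrm{HD}_{\mathbb{K}_5(r)}}\right)&=\iota_{\mathfrak{p}}(r)(-27)\,\iota_{\mathfrak{p}}(c')(-1)\,F_2^p\left(1/3;r,1;1,c';1,1;\mathfrak{p}\right)+X\\&\quad+\iota_{\mathfrak{p}}(1-r)(-27)\,\iota_{\mathfrak{p}}(c')(-1)\,F_2^p\left(2/3;1-r,1;1,c';1,1;\mathfrak{p}\right),\end{aligned}$$ where $$\begin{aligned}X:=&-\iota_{\mathfrak{p}}(r)(-27)\,J_{\mathfrak{p}}(c',1/3-c')\,J_{\mathfrak{p}}(r+c'-1/3,1/3-c')\\&-\iota_{\mathfrak{p}}(1-r)(-27)\,J_{\mathfrak{p}}(c',2/3-c')\,J_{\mathfrak{p}}(1/3-r+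c',2/3-c').\end{aligned}$$
   Context: **Characters.** $\zeta_M$ is a primitive $M$-th root of unity. For a prime ideal $\mathfrak{p}$ of $\mathbb{Z}[\zeta_M]$ coprime to $M$ with residue field of size $q$ and an integer $i$, $\iota_{\mathfrak{p}}(i/M)$ is the multiplicative character of $\mathbb{Z}[\zeta_M]/\mathfrak{p}$ given by the $i$-th power of the $M$-th power residue symbol: for $x\notin\mathfrak{p}$, $\iota_{\mathfrak{p}}(i/M)(x)=\left(\frac{x}{\mathfrak{p}}\right)_M^i$ is the $M$-th root of unity congruent to $x^{(q-1)i/M}$ modulo $\mathfrak{p}$. Thus $\iota_{\mathfrak{p}}(1)$ is the trivial character $\varepsilon$. All multiplicative characters (including $\varepsilon$) are extended by $\chi(0)=0$. If $p\equiv1\pmod{M}$ and $\mathfrak{p}\mid p$, the residue field is $\mathbb{F}_p$, so $q=p$. **Jacobi sums.** For multiplicative characters $A,B$ of $\mathbb{F}_q$, $J(A,B)=\sum_{x\in\mathbb{F}_q}A(x)B(1-x)$; for rationals $a,b$, $J_{\mathfrak{p}}(a,b):=J(\iota_{\mathfrak{p}}(a),\iota_{\mathfrak{p}}(b))$. **Finite field Appell series $F_2$.** For multiplicative characters $R_1,\dots,R_5$ of $\mathbb{F}_q$ and $x,y\in\mathbb{F}_q$, $$F_2^q(R_1;R_2,R_3;R_4,R_5;x,y)=\varepsilon(xy)R_2R_3R_4R_5(-1)\sum_{u,v\in\mathbb{F}_q}R_2(u)R_3(v)\,\overline{R_2}R_4(1-u)\,\overline{R_3}R_5(1-v)\,\overline{R_1}(1-ux-vy),$$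 and for rationals $r_1,\dots,r_5$ with common denominator dividing $M$, $F_2^q(r_1;r_2,r_3;r_4,r_5;x,y;\mathfrak{p}):=F_2^q(R_1;R_2,R_3;R_4,R_5;x,y)$ with $R_i=\iota_{\mathfrak{p}}(r_i)$. **Eigenforms.** Let $\eta(\tau)=q^{1/24}\prod_{n\ge1}(1-q^n)$ with $q=e^{2\pi i\tau}$, and for $0<r<2/3$ with $12r\in\mathbb{Z}$ let $$\mathbb{K}_5(r)(\tau):=\eta(3\tau)^{12r-2}\,\eta(\tau)^{-12r+6}.$$ The eigenforms (labels from the L-functions and Modular Forms Database, LMFDB) are: for $r=1/2$, $f_{36.2.a.a}=\mathbb{K}_5(1/2)(2\tau)$; for $r=1/6$, $f_{36.2.a.a}=\mathbb{K}_5(1/6)(6\tau)$; for $r=1/3$, $f_{27.2.a.a}=\mathbb{K}_5(1/3)(3\tau)$; for $r=1/12$, $f_{432.2.c.a}=\mathbb{K}_5(1/12)(12\tau)-3\sqrt{-3}\,\mathbb{K}_5(7/12)(12\tau)$ (level $432$, character $(3/\cdot)$). The subscript $\mathrm{HD}_{\mathbb{K}_5(r)}$ denotes the hypergeometric datum $\{\{1/3,r\},\{1,1\}\}$ and serves only as a name here. For $r=1/b$ and primes $p\equiv1\pmod{M'}$, $a_p(f^{\sharp}_{\mathrm{HD}_{\mathbb{K}_5(r)}})$ is the coefficient of $q^p$ in $\mathbb{K}_5(1/b)(b\tau)$. *)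

theory Defs
  imports
    "HOL-Analysis.Analysis"
    "HOL-Algebra.QuotRing"
    "HOL-Number_Theory.Cong"
begin

section \<open>Least common denominators\<close>

definition lcd :: "rat set \<Rightarrow> nat"
  where "lcd S = (LEAST m. m > 0 \<and> (\<forall>a\<in>S. of_nat m * a \<in> \<int>))"


section \<open>Prime ideals of cyclotomic rings and power residue characters\<close>

definition zeta :: "nat \<Rightarrow> complex"
  where "zeta M = exp (2 * complex_of_real pi * \<i> / of_nat M)"

text \<open>The ring \<open>\<int>[\<zeta>]\<close>, as a subring of the complex numbers. As a subset it does not depend on
  the primitive root of unity that is adjoined.\<close>

definition cyclotomic_ring :: "nat \<Rightarrow> complex ring"
  where "cyclotomic_ring M =
    \<lparr>carrier = range (\<lambda>f :: int poly. poly (map_poly of_int f) (zeta M)),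
     mult = (*), one = 1, zero = 0, add = (+)\<rparr>"

definition prime_ideal_above :: "nat \<Rightarrow> complex set \<Rightarrow> nat \<Rightarrow> bool"
  where "prime_ideal_above M P p \<longleftrightarrow>
    primeideal P (cyclotomic_ring M) \<and> P \<inter> \<int> = {of_int k | k :: int. int p dvd k}"

abbreviation residue_field :: "nat \<Rightarrow> complex set \<Rightarrow> complex set ring"
  where "residue_field M P \<equiv> cyclotomic_ring M Quot P"

abbreviation residue :: "nat \<Rightarrow> complex set \<Rightarrow> complex \<Rightarrow> complex set"
  where "residue M P x \<equiv> P +>\<^bsub>cyclotomic_ring M\<^esub> x"

text \<open>The value at a nonzero residue class; used only for \<open>P\<close> coprime to \<open>M\<close>, where \<open>M\<close> divides
  \<open>q - 1\<close> and distinct \<open>M\<close>-th roots of unity have distinct residues.\<close>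

definition power_residue_symbol :: "nat \<Rightarrow> complex set \<Rightarrow> complex set \<Rightarrow> complex"
  where "power_residue_symbol M P X =
    (THE z. z ^ M = 1 \<and>
      residue M P z = X [^]\<^bsub>residue_field M P\<^esub> ((card (carrier (residue_field M P)) - 1) div M))"

text \<open>The character \<open>iota M P (i/M)\<close>, extended by zero. The rational argument must have a denominator
  dividing \<open>M\<close>, so that the floor below is exact.\<close>

definition iota :: "nat \<Rightarrow> complex set \<Rightarrow> rat \<Rightarrow> complex set \<Rightarrow> complex"
  where "iota M P a X =
    (if X = \<zero>\<^bsub>residue_field M P\<^esub> then 0
     else power_residue_symbol M P X powi \<lfloor>of_nat M * a\<rfloor>)"


section \<open>Jacobi sums and the finite field Appell series\<close>

text \<open>Multiplicative characters of a finite field \<open>F\<close> are functions on its carrier that take the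
  value zero at zero; the inverse of a character is its complex conjugate.\<close>

definition trivial_char :: "('a, 'm) ring_scheme \<Rightarrow> 'a \<Rightarrow> complex"
  where "trivial_char F x = (if x = \<zero>\<^bsub>F\<^esub> then 0 else 1)"

definition Jacobi_sum ::
  "('a, 'm) ring_scheme \<Rightarrow> ('a \<Rightarrow> complex) \<Rightarrow> ('a \<Rightarrow> complex) \<Rightarrow> complex"
  where "Jacobi_sum F A B = (\<Sum>x\<in>carrier F. A x * B (\<one>\<^bsub>F\<^esub> \<ominus>\<^bsub>F\<^esub> x))"

definition Appell_F2 ::
  "('a, 'm) ring_scheme \<Rightarrow> ('a \<Rightarrow> complex) \<Rightarrow> ('a \<Rightarrow> complex) \<Rightarrow> ('a \<Rightarrow> complex) \<Rightarrow>
   ('a \<Rightarrow> complex) \<Rightarrow> ('a \<Rightarrow> complex) \<Rightarrow> 'a \<Rightarrow> 'a \<Rightarrow> complex"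
  where "Appell_F2 F R1 R2 R3 R4 R5 x y =
    trivial_char F (x \<otimes>\<^bsub>F\<^esub> y) *
    (R2 (\<ominus>\<^bsub>F\<^esub> \<one>\<^bsub>F\<^esub>) * R3 (\<ominus>\<^bsub>F\<^esub> \<one>\<^bsub>F\<^esub>) * R4 (\<ominus>\<^bsub>F\<^esub> \<one>\<^bsub>F\<^esub>) * R5 (\<ominus>\<^bsub>F\<^esub> \<one>\<^bsub>F\<^esub>)) *
    (\<Sum>u\<in>carrier F. \<Sum>v\<in>carrier F.
       R2 u * R3 v *
       (cnj (R2 (\<one>\<^bsub>F\<^esub> \<ominus>\<^bsub>F\<^esub> u)) * R4 (\<one>\<^bsub>F\<^esub> \<ominus>\<^bsub>F\<^esub> u)) *
       (cnj (R3 (\<one>\<^bsub>F\<^esub> \<ominus>\<^bsub>F\<^esub> v)) * R5 (\<one>\<^bsub>F\<^esub> \<ominus>\<^bsub>F\<^esub> v)) *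
       cnj (R1 ((\<one>\<^bsub>F\<^esub> \<ominus>\<^bsub>F\<^esub> u \<otimes>\<^bsub>F\<^esub> x) \<ominus>\<^bsub>F\<^esub> v \<otimes>\<^bsub>F\<^esub> y)))"

definition Jacobi_iota :: "nat \<Rightarrow> complex set \<Rightarrow> rat \<Rightarrow> rat \<Rightarrow> complex"
  where "Jacobi_iota M P a b = Jacobi_sum (residue_field M P) (iota M P a) (iota M P b)"

definition F2_iota ::
  "nat \<Rightarrow> complex set \<Rightarrow> rat \<Rightarrow> rat \<Rightarrow> rat \<Rightarrow> rat \<Rightarrow> rat \<Rightarrow> complex set \<Rightarrow> complex set \<Rightarrow> complex"
  where "F2_iota M P r1 r2 r3 r4 r5 x y =
    Appell_F2 (residue_field M P)
      (iota M P r1) (iota M P r2) (iota M P r3) (iota M P r4) (iota M P r5) x y"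


section \<open>Eta quotients and eigenforms\<close>

definition dedekind_eta :: "complex \<Rightarrow> complex"
  where "dedekind_eta \<tau> =
    exp (2 * complex_of_real pi * \<i> * \<tau> / 24) *
    (\<Prod>n. 1 - exp (2 * complex_of_real pi * \<i> * \<tau>) ^ Suc n)"

text \<open>Used only for \<open>12 * r\<close> an integer, so that the floor is exact.\<close>

definition K5 :: "rat \<Rightarrow> complex \<Rightarrow> complex"
  where "K5 r \<tau> =
    dedekind_eta (3 * \<tau>) powi (\<lfloor>12 * r\<rfloor> - 2) * dedekind_eta \<tau> powi (- \<lfloor>12 * r\<rfloor> + 6)"

definition f_36_2_a_a :: "complex \<Rightarrow> complex"
  where "f_36_2_a_a \<tau> = K5 (1/2) (2 * \<tau>)"

definition f_27_2_a_a :: "complex \<Rightarrow> complex"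
  where "f_27_2_a_a \<tau> = K5 (1/3) (3 * \<tau>)"

definition f_432_2_c_a :: "complex \<Rightarrow> complex"
  where "f_432_2_c_a \<tau> =
    K5 (1/12) (12 * \<tau>) - 3 * (\<i> * complex_of_real (sqrt 3)) * K5 (7/12) (12 * \<tau>)"

lemma f_36_2_a_a_eq: "f_36_2_a_a \<tau> = K5 (1/6) (6 * \<tau>)"
  by (simp add: f_36_2_a_a_def K5_def)

text \<open>The value is meaningful only for \<open>r \<in> {1/2, 1/3, 1/6, 1/12}\<close>.\<close>

definition f_sharp :: "rat \<Rightarrow> complex \<Rightarrow> complex"
  where "f_sharp r =
    (if r = 1/2 \<or> r = 1/6 then f_36_2_a_a
     else if r = 1/3 then f_27_2_a_a
     else f_432_2_c_a)"

text \<open>The coefficients of the expansion in powers of \<open>exp (2 \<pi> \<i> \<tau>)\<close>, which are unique when such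
  an expansion exists on the whole upper half-plane.\<close>

definition fourier_coeff :: "(complex \<Rightarrow> complex) \<Rightarrow> nat \<Rightarrow> complex"
  where "fourier_coeff f =
    (THE a. \<forall>\<tau>. Im \<tau> > 0 \<longrightarrow>
       (\<lambda>n. a n * exp (2 * complex_of_real pi * \<i> * \<tau>) ^ n) sums f \<tau>)"

end

theory Submission
  imports "HOL-Complex_Analysis.Complex_Analysis" "HOL-Number_Theory.Number_Theory" Defs
begin


definition qpoch :: "complex \<Rightarrow> complex \<Rightarrow> complex"
  where "qpoch a q = (\<Prod>n. 1 - a * q ^ n)"

lemma qpoch_abs_convergent:
  fixes a q :: complex
  assumes "norm q < 1"
  shows "abs_convergent_prod (\<lambda>n. 1 - a * q ^ n)"
proof -
  have "summable (\<lambda>n. norm a * norm q ^ n)"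
    using assms by (intro summable_mult summable_geometric) auto
  then show ?thesis
    by (auto simp: abs_convergent_prod_conv_summable norm_mult norm_power)
qed

lemma qpoch_convergent:
  fixes a q :: complex
  assumes "norm q < 1"
  shows "convergent_prod (\<lambda>n. 1 - a * q ^ n)"
  using qpoch_abs_convergent[OF assms] by (rule abs_convergent_prod_imp_convergent_prod)

lemma qpoch_tendsto:
  assumes "norm q < 1"
  shows "(\<lambda>n. \<Prod>k<n. 1 - a * q ^ k) \<longlonglongrightarrow> qpoch a q"
  unfolding qpoch_def LIMSEQ_lessThan_iff_atMost
  using convergent_prod_LIMSEQ[OF qpoch_convergent[OF assms]] .

lemma qpoch_eqI:
  assumes "norm q < 1" "(\<lambda>n. \<Prod>k<n. 1 - a * q ^ k) \<longlonglongrightarrow> L"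
  shows "qpoch a q = L"
  using qpoch_tendsto[OF assms(1)] assms(2) by (rule LIMSEQ_unique)

lemma qpoch_rec:
  assumes "norm q < 1"
  shows "qpoch a q = (1 - a) * qpoch (a * q) q"
proof (rule qpoch_eqI[OF assms])
  have "(\<lambda>n. (1 - a) * (\<Prod>k<n. 1 - a * q * q ^ k)) \<longlonglongrightarrow> (1 - a) * qpoch (a * q) q"
    by (intro tendsto_intros qpoch_tendsto assms)
  then have "(\<lambda>n. \<Prod>k<Suc n. 1 - a * q ^ k) \<longlonglongrightarrow> (1 - a) * qpoch (a * q) q"
    unfolding prod.lessThan_Suc_shift by (simp add: mult.assoc)
  then show "(\<lambda>n. \<Prod>k<n. 1 - a * q ^ k) \<longlonglongrightarrow> (1 - a) * qpoch (a * q) q"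
    by (rule LIMSEQ_imp_Suc)
qed

lemma qpoch_nonzero:
  assumes "norm q < 1" "\<And>n. a * q ^ n \<noteq> 1"
  shows "qpoch a q \<noteq> 0"
  unfolding qpoch_def
  using assms by (intro prodinf_nonzero qpoch_convergent) (auto simp: eq_commute[of 1])

lemma qpoch_nonzero':
  assumes "norm q < 1" "norm a \<le> 1" "a \<noteq> 1"
  shows "qpoch a q \<noteq> 0"
proof (rule qpoch_nonzero[OF assms(1)])
  fix n
  show "a * q ^ n \<noteq> 1"
  proof (cases "n = 0")
    case False
    then have "norm q ^ n < 1"
      using assms(1) by (simp add: power_less_one_iff)
    then have "norm (a * q ^ n) < 1"
      using assms(2) mult_left_le_one_le[of "norm q ^ n" "norm a"]
      by (simp add: norm_mult norm_power mult.commute)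
    then show ?thesis by auto
  qed (use assms in auto)
qed

lemma qpoch_nonzero_ball: "norm q < 1 \<Longrightarrow> norm a < 1 \<Longrightarrow> qpoch a q \<noteq> 0"
  by (rule qpoch_nonzero') auto

lemma qpoch_split:
  assumes "norm q < 1" "m > 0"
  shows "qpoch a q = (\<Prod>i<m. qpoch (a * q ^ i) (q ^ m))"
proof (rule LIMSEQ_unique)
  have q: "norm (q ^ m) < 1"
    using assms by (simp add: norm_power power_less_one_iff)
  have eq: "(\<Prod>k<m * n. 1 - a * q ^ k) = (\<Prod>i<m. \<Prod>k<n. 1 - a * q ^ i * (q ^ m) ^ k)" for n
  proof -
    have "(\<Prod>k<m * n. 1 - a * q ^ k) = (\<Prod>k<n. \<Prod>i = k * m..<k * m + m. 1 - a * q ^ i)"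
      using prod.nat_group[of "\<lambda>k. 1 - a * q ^ k" m n] by (simp add: mult.commute)
    also have "\<dots> = (\<Prod>k<n. \<Prod>i<m. 1 - a * q ^ i * (q ^ m) ^ k)"
    proof (rule prod.cong[OF refl])
      fix k
      show "(\<Prod>i = k * m..<k * m + m. 1 - a * q ^ i) = (\<Prod>i<m. 1 - a * q ^ i * (q ^ m) ^ k)"
      using prod.shift_bounds_nat_ivl[of "\<lambda>i. 1 - a * q ^ i" 0 "k * m" m]
      by (simp add: lessThan_atLeast0 add.commute[of "k * m"])
        (simp add: power_add power_mult[symmetric] mult_ac)
    qed
    finally show ?thesis
      by (simp add: prod.swap[of _ "{..<m}"])
  qed
  show "(\<lambda>n. \<Prod>k<m * n. 1 - a * q ^ k) \<longlonglongrightarrow> qpoch a q"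
    using LIMSEQ_subseq_LIMSEQ[OF qpoch_tendsto[OF assms(1)], of "\<lambda>n. m * n"] assms(2)
    by (auto simp: strict_mono_def o_def)
  show "(\<lambda>n. \<Prod>k<m * n. 1 - a * q ^ k) \<longlonglongrightarrow> (\<Prod>i<m. qpoch (a * q ^ i) (q ^ m))"
    unfolding eq by (intro tendsto_prod qpoch_tendsto q)
qed

lemma qpoch_split2:
  assumes "norm q < 1"
  shows "qpoch a q = qpoch a (q ^ 2) * qpoch (a * q) (q ^ 2)"
  using qpoch_split[OF assms, of 2 a] by (simp add: eval_nat_numeral)

lemma qpoch_split3:
  assumes "norm q < 1"
  shows "qpoch a q = qpoch a (q ^ 3) * qpoch (a * q) (q ^ 3) * qpoch (a * q ^ 2) (q ^ 3)"
  using qpoch_split[OF assms, of 3 a] by (simp add: eval_nat_numeral)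

lemma qpoch_mult_uminus:
  assumes "norm q < 1"
  shows "qpoch a q * qpoch (- a) q = qpoch (a ^ 2) (q ^ 2)"
proof (rule LIMSEQ_unique)
  show "(\<lambda>n. (\<Prod>k<n. 1 - a * q ^ k) * (\<Prod>k<n. 1 - - a * q ^ k)) \<longlonglongrightarrow> qpoch a q * qpoch (- a) q"
    by (intro tendsto_intros qpoch_tendsto assms)
  have *: "(1 - a * q ^ k) * (1 - - a * q ^ k) = 1 - a ^ 2 * (q ^ 2) ^ k" for k
    by (simp add: algebra_simps power2_eq_square power_mult_distrib)
  show "(\<lambda>n. (\<Prod>k<n. 1 - a * q ^ k) * (\<Prod>k<n. 1 - - a * q ^ k)) \<longlonglongrightarrow> qpoch (a ^ 2) (q ^ 2)"
    unfolding prod.distrib[symmetric] * using assms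
    by (intro qpoch_tendsto) (simp add: norm_power power_less_one_iff)
qed

definition omega :: complex where "omega = Complex (-1/2) (sqrt 3 / 2)"

lemma omega_sq: "omega ^ 2 = - 1 - omega"
  by (simp add: omega_def complex_eq_iff power2_eq_square)

lemma omega_cube: "omega ^ 3 = 1"
proof -
  have "omega ^ 3 = omega * omega ^ 2" by (simp add: eval_nat_numeral)
  also have "\<dots> = - omega - omega ^ 2"
    by (subst omega_sq) (simp add: algebra_simps power2_eq_square)
  also have "\<dots> = 1" by (simp add: omega_sq)
  finally show ?thesis .
qed

lemma omega_nonzero [simp]: "omega \<noteq> 0"
  by (simp add: omega_def complex_eq_iff)

lemma norm_omega [simp]: "norm omega = 1"
  by (simp add: omega_def cmod_def power2_eq_square)

lemma omega_neq_1 [simp]: "omega \<noteq> 1"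
  by (simp add: omega_def complex_eq_iff)

lemma qpoch_omega:
  assumes "norm q < 1"
  shows "qpoch a q * qpoch (omega * a) q * qpoch (omega ^ 2 * a) q = qpoch (a ^ 3) (q ^ 3)"
proof (rule LIMSEQ_unique)
  show "(\<lambda>n. (\<Prod>k<n. 1 - a * q ^ k) * (\<Prod>k<n. 1 - omega * a * q ^ k) * (\<Prod>k<n. 1 - omega ^ 2 * a * q ^ k))
    \<longlonglongrightarrow> qpoch a q * qpoch (omega * a) q * qpoch (omega ^ 2 * a) q"
    by (intro tendsto_intros qpoch_tendsto assms)
  have "(1 - x) * (1 - omega * x) * (1 - omega ^ 2 * x) = 1 - x ^ 3" for x
  proof -
    have "(1 - x) * (1 - omega * x) * (1 - omega ^ 2 * x) =
      1 - (1 + omega + omega ^ 2) * x + omega * (1 + omega + omega ^ 2) * x ^ 2 - omega ^ 3 * x ^ 3"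
      by (simp add: algebra_simps eval_nat_numeral)
    then show ?thesis by (simp add: omega_sq omega_cube)
  qed
  then have *: "(1 - a * q ^ k) * (1 - omega * a * q ^ k) * (1 - omega ^ 2 * a * q ^ k) = 1 - a ^ 3 * (q ^ 3) ^ k" for k
    by (metis (no_types, lifting) mult.assoc power_mult_distrib power_mult mult.commute)
  show "(\<lambda>n. (\<Prod>k<n. 1 - a * q ^ k) * (\<Prod>k<n. 1 - omega * a * q ^ k) * (\<Prod>k<n. 1 - omega ^ 2 * a * q ^ k))
    \<longlonglongrightarrow> qpoch (a ^ 3) (q ^ 3)"
    unfolding prod.distrib[symmetric] * using assms
    by (intro qpoch_tendsto) (simp add: norm_power power_less_one_iff)
qed

lemma qpoch_uniform_limit:
  assumes "norm q < 1"
  shows "uniform_limit (cball 0 R) (\<lambda>n a. \<Prod>k<n. 1 - a * q ^ k) (\<lambda>a. qpoch a q) sequentially"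
proof -
  have "uniformly_convergent_on (cball 0 R) (\<lambda>N a. \<Sum>n<N. norm ((1 - a * q ^ n) - 1))"
  proof (rule Weierstrass_m_test')
    show "norm (norm ((1 - a * q ^ n) - 1)) \<le> R * norm q ^ n" if "a \<in> cball 0 R" for n a
      using that by (auto simp: norm_mult norm_power intro!: mult_right_mono)
    show "summable (\<lambda>n. R * norm q ^ n)"
      using assms by (intro summable_mult summable_geometric) auto
  qed
  then have "uniformly_convergent_on (cball 0 R) (\<lambda>N a. \<Prod>n<N. 1 - a * q ^ n)"
    by (intro uniformly_convergent_on_prod') (auto intro!: continuous_intros)
  then obtain l where l: "uniform_limit (cball 0 R) (\<lambda>N a. \<Prod>n<N. 1 - a * q ^ n) l sequentially"
    by (auto simp: uniformly_convergent_on_def)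
  have "l a = qpoch a q" if "a \<in> cball 0 R" for a
    using qpoch_eqI[OF assms tendsto_uniform_limitI[OF l that]] by simp
  then show ?thesis using uniform_limit_cong'[of "cball 0 R"] l by (metis (no_types, lifting))
qed

lemma qpoch_holomorphic:
  assumes "norm q < 1"
  shows "(\<lambda>a. qpoch a q) holomorphic_on A"
proof -
  have "(\<lambda>a. qpoch a q) field_differentiable (at a)" for a
  proof -
    have "(\<lambda>a. qpoch a q) holomorphic_on ball 0 (norm a + 1)"
      by (rule holomorphic_uniform_limit[where f = "\<lambda>n a. \<Prod>k<n. 1 - a * q ^ k" and F = sequentially])
        (auto intro!: always_eventually qpoch_uniform_limit[OF assms] continuous_intros holomorphic_intros)
    then show ?thesis
      by (rule holomorphic_on_imp_differentiable_at) auto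
  qed
  then show ?thesis
    using field_differentiable_at_within holomorphic_on_def by blast
qed

lemma qpoch_logderiv:
  assumes "norm q < 1" "qpoch a q \<noteq> 0"
  shows "(\<lambda>n. - (q ^ n) / (1 - a * q ^ n)) sums (deriv (\<lambda>a. qpoch a q) a / qpoch a q)"
proof -
  have "(\<lambda>k. deriv (\<lambda>a. 1 - a * q ^ k) a / (1 - a * q ^ k)) sums (deriv (\<lambda>a. qpoch a q) a / qpoch a q)"
    by (rule logderiv_prodinf_complex_uniform_limit[where A = "ball 0 (norm a + 1)"])
      (auto intro!: uniform_limit_on_subset[OF qpoch_uniform_limit[OF assms(1), of "norm a + 1"]]
         holomorphic_intros assms)
  moreover have "deriv (\<lambda>a. 1 - a * q ^ k) a = - (q ^ k)" for k
    by (rule DERIV_imp_deriv) (auto intro!: derivative_eq_intros)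
  ultimately show ?thesis by simp
qed


definition qfact :: "complex \<Rightarrow> nat \<Rightarrow> complex"
  where "qfact q n = (\<Prod>k<n. 1 - q ^ Suc k)"

definition qbinom :: "complex \<Rightarrow> nat \<Rightarrow> nat \<Rightarrow> complex"
  where "qbinom q m j = (if j \<le> m then qfact q m / (qfact q j * qfact q (m - j)) else 0)"

lemma qfact_Suc: "qfact q (Suc n) = qfact q n * (1 - q ^ Suc n)"
  by (simp add: qfact_def)

lemma qfact_nonzero:
  assumes "norm q < 1"
  shows "qfact q n \<noteq> 0"
proof -
  have "q ^ Suc k \<noteq> 1" for k
  proof
    assume "q ^ Suc k = 1"
    then have "norm q ^ Suc k = 1" by (metis norm_one norm_power)
    then show False using assms power_less_one_iff[of "norm q" "Suc k"] by simp
  qed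
  then show ?thesis by (auto simp: qfact_def simp del: power_Suc)
qed

lemma qbinom_Suc_Suc:
  assumes "norm q < 1" "j \<le> m"
  shows "qbinom q (Suc m) (Suc j) = qbinom q m (Suc j) + q ^ (m - j) * qbinom q m j"
proof (cases "j = m")
  case True
  then show ?thesis
    using qfact_nonzero[OF assms(1), of m] qfact_nonzero[OF assms(1), of "Suc m"]
    by (simp add: qbinom_def qfact_def del: power_Suc prod.lessThan_Suc)
next
  case False
  then obtain d where m: "m = Suc (j + d)"
    using assms(2) by (metis le_neq_implies_less less_iff_Suc_add)
  note nz = qfact_nonzero[OF assms(1)]
  have nz': "1 - q ^ Suc j \<noteq> 0" "1 - q ^ Suc d \<noteq> 0"
    using nz[of "Suc j"] nz[of "Suc d"] by (simp_all add: qfact_Suc)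
  have "qbinom q (Suc m) (Suc j) = qfact q m * (1 - q ^ Suc m) / (qfact q (Suc j) * qfact q (Suc d))"
    by (simp add: qbinom_def m qfact_Suc)
  also have "1 - q ^ Suc m = (1 - q ^ Suc d) + q ^ Suc d * (1 - q ^ Suc j)"
    by (simp add: m power_add algebra_simps)
  also have "qfact q m * ((1 - q ^ Suc d) + q ^ Suc d * (1 - q ^ Suc j)) / (qfact q (Suc j) * qfact q (Suc d))
    = qfact q m / (qfact q (Suc j) * qfact q d) + q ^ Suc d * (qfact q m / (qfact q j * qfact q (Suc d)))"
    using nz[of j] nz[of d] nz' unfolding qfact_Suc
    by (simp add: divide_simps del: power_Suc) (simp add: algebra_simps del: power_Suc)
  also have "\<dots> = qbinom q m (Suc j) + q ^ (m - j) * qbinom q m j"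
    by (simp add: qbinom_def m)
  finally show ?thesis .
qed

lemma triangle_Suc: "Suc j * j div 2 = j * (j - 1) div 2 + j"
  by (cases j) (auto simp: algebra_simps)

text \<open>The \<open>q\<close>-binomial theorem.\<close>

lemma gauss_qbinomial:
  assumes "norm q < 1"
  shows "(\<Prod>k<m. 1 + x * q ^ k) = (\<Sum>j\<le>m. qbinom q m j * q ^ (j * (j - 1) div 2) * x ^ j)"
proof (induction m)
  case 0
  then show ?case by (simp add: qbinom_def qfact_def)
next
  case (Suc m)
  define c where "c m j = qbinom q m j * q ^ (j * (j - 1) div 2) * x ^ j" for m j
  have c0: "c k 0 = 1" for k
    using qfact_nonzero[OF assms] by (simp add: c_def qbinom_def qfact_def)
  have cs: "c (Suc m) (Suc j) = c m (Suc j) + c m j * (x * q ^ m)" if "j \<le> m" for j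
  proof -
    have "q ^ (Suc j * j div 2) = q ^ (j * (j - 1) div 2) * q ^ j"
      unfolding triangle_Suc by (simp add: power_add)
    moreover have "q ^ (m - j) * q ^ j = q ^ m"
      using that by (simp flip: power_add)
    ultimately show ?thesis
      unfolding c_def qbinom_Suc_Suc[OF assms that] by (simp add: algebra_simps)
  qed
  have "(\<Prod>k<Suc m. 1 + x * q ^ k) = (\<Sum>j\<le>m. c m j) * (1 + x * q ^ m)"
    using Suc by (simp add: c_def)
  also have "\<dots> = (\<Sum>j\<le>m. c m j) + (\<Sum>j\<le>m. c m j * (x * q ^ m))"
    by (simp add: algebra_simps sum_distrib_left)
  also have "(\<Sum>j\<le>m. c m j) = (\<Sum>j\<le>Suc m. c m j)"
    by (simp add: c_def qbinom_def)
  also have "\<dots> = c m 0 + (\<Sum>j\<le>m. c m (Suc j))"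
    by (rule sum.atMost_Suc_shift)
  also have "\<dots> + (\<Sum>j\<le>m. c m j * (x * q ^ m)) = c (Suc m) 0 + (\<Sum>j\<le>m. c (Suc m) (Suc j))"
    by (simp add: cs c0 sum.distrib)
  also have "\<dots> = (\<Sum>j\<le>Suc m. c (Suc m) j)"
    by (rule sum.atMost_Suc_shift[symmetric])
  finally show ?case by (simp add: c_def)
qed

lemma two_times_triangle: "2 * (n * (n - 1) div 2) = n * (n - 1)" for n :: int
  by (rule dvd_mult_div_cancel) simp

lemma triangle_of_nat: "int (j * (j - 1) div 2) = int j * (int j - 1) div 2"
  by (cases j) (simp_all add: zdiv_int algebra_simps)

text \<open>The exponents in the finite form of the triple product are centred at the middle term.\<close>

lemma finite_triple_product:
  assumes q: "norm q < 1" "q \<noteq> 0" and z: "z \<noteq> 0"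
  shows "(\<Prod>k<N. 1 - z * q ^ k) * (\<Prod>k<N. 1 - q / z * q ^ k) =
    (\<Sum>j\<le>2 * N. qbinom q (2 * N) j * ((- z) powi (int j - int N) *
       q powi ((int j - int N) * (int j - int N - 1) div 2)))"
proof -
  define x where "x = - z * q powi (- int N)"
  define D where "D = (- z) ^ N * q powi (- (int N * (int N + 1) div 2))"
  have D: "D \<noteq> 0" using q z by (simp add: D_def)
  have "(\<Prod>k<2 * N. 1 + x * q ^ k) = (\<Prod>k<N. 1 + x * q ^ k) * (\<Prod>k<N. 1 + x * q ^ (k + N))"
  proof -
    have "(\<Prod>k<2 * N. 1 + x * q ^ k) = (\<Prod>k<N. 1 + x * q ^ k) * (\<Prod>k=N..<2 * N. 1 + x * q ^ k)"
      using prod.atLeastLessThan_concat[of 0 N "2 * N" "\<lambda>k. 1 + x * q ^ k"]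
      by (simp add: lessThan_atLeast0)
    also have "(\<Prod>k=N..<2 * N. 1 + x * q ^ k) = (\<Prod>k<N. 1 + x * q ^ (k + N))"
      using prod.shift_bounds_nat_ivl[of "\<lambda>k. 1 + x * q ^ k" 0 N N]
      by (simp add: lessThan_atLeast0 mult_2)
    finally show ?thesis .
  qed
  also have "(\<Prod>k<N. 1 + x * q ^ (k + N)) = (\<Prod>k<N. 1 - z * q ^ k)"
    using q by (intro prod.cong refl) (simp add: x_def power_add power_int_minus)
  also have "(\<Prod>k<N. 1 + x * q ^ k) = D * (\<Prod>k<N. 1 - q / z * q ^ k)"
  proof -
    have "(\<Prod>k<N. 1 + x * q ^ k) = (\<Prod>k<N. 1 + x * q ^ (N - Suc k))"
      by (rule prod.nat_diff_reindex[symmetric])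
    also have "\<dots> = (\<Prod>k<N. (- z * q powi (- int (Suc k))) * (1 - q / z * q ^ k))"
    proof (intro prod.cong refl)
      fix k assume "k \<in> {..<N}"
      then have "q powi (- int N) * q ^ (N - Suc k) = q powi (- int (Suc k))"
        using q by (simp add: of_nat_diff flip: power_int_of_nat power_int_add)
      then have "1 + x * q ^ (N - Suc k) = 1 - z * q powi (- int (Suc k))"
        by (simp add: x_def mult.assoc)
      also have "\<dots> = (- z * q powi (- int (Suc k))) * (1 - q / z * q ^ k)"
        using q z by (simp add: power_int_minus field_simps del: of_nat_Suc)
      finally show "1 + x * q ^ (N - Suc k) = \<dots>" .
    qed
    also have "\<dots> = (\<Prod>k<N. - z * q powi (- int (Suc k))) * (\<Prod>k<N. 1 - q / z * q ^ k)"
      by (rule prod.distrib)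
    also have "(\<Prod>k<N. - z * q powi (- int (Suc k))) = D"
      unfolding D_def
    proof (induction N)
      case (Suc N)
      have "- (int (Suc N) * (int (Suc N) + 1) div 2) = - (int N * (int N + 1) div 2) + - int (Suc N)"
        by (simp add: algebra_simps)
      then show ?case
        using Suc q by (simp add: power_int_diff power_int_minus divide_simps del: of_nat_Suc)
    qed simp
    finally show ?thesis .
  qed
  finally have "(\<Prod>k<N. 1 - z * q ^ k) * (\<Prod>k<N. 1 - q / z * q ^ k) = (\<Prod>k<2 * N. 1 + x * q ^ k) / D"
    using D by (simp add: mult_ac)
  also have "\<dots> = (\<Sum>j\<le>2 * N. qbinom q (2 * N) j * (q ^ (j * (j - 1) div 2) * x ^ j / D))"
    unfolding gauss_qbinomial[OF q(1)] by (simp add: sum_divide_distrib mult.assoc)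
  also have "\<dots> = (\<Sum>j\<le>2 * N. qbinom q (2 * N) j * ((- z) powi (int j - int N) *
       q powi ((int j - int N) * (int j - int N - 1) div 2)))"
  proof (intro sum.cong refl arg_cong2[where f = "(*)"])
    fix j
    have e: "int j * (int j - 1) div 2 + - int N * int j + int N * (int N + 1) div 2
      = (int j - int N) * (int j - int N - 1) div 2"
    proof -
      define A B C where "A = int j * (int j - 1) div 2" "B = int N * (int N + 1) div 2"
        "C = (int j - int N) * (int j - int N - 1) div 2"
      have "2 * A = int j * (int j - 1)" "2 * B = int N * (int N + 1)"
        "2 * C = (int j - int N) * (int j - int N - 1)"
        by (simp_all add: A_B_C_def two_times_triangle)
      then have "2 * (A + - int N * int j + B) = 2 * C"
        by (simp add: algebra_simps)
      then have "A + - int N * int j + B = C"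
        by (simp only: mult_cancel_left) auto
      then show ?thesis
        by (simp only: A_B_C_def)
    qed
    have "q ^ (j * (j - 1) div 2) * x ^ j / D =
      ((- z) ^ j / (- z) ^ N) * (q ^ (j * (j - 1) div 2) * (q powi (- int N)) ^ j / q powi (- (int N * (int N + 1) div 2)))"
      unfolding x_def D_def power_mult_distrib by simp
    also have "(- z) ^ j / (- z) ^ N = (- z) powi (int j - int N)"
      using z by (simp add: power_int_diff)
    also have "q ^ (j * (j - 1) div 2) * (q powi (- int N)) ^ j / q powi (- (int N * (int N + 1) div 2))
      = q powi (int j * (int j - 1) div 2 + - int N * int j + int N * (int N + 1) div 2)"
    proof -
      have "(q powi (- int N)) ^ j = q powi (- int N * int j)"
        by (simp only: power_int_mult power_int_of_nat)
      moreover have "q ^ (j * (j - 1) div 2) = q powi (int j * (int j - 1) div 2)"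
        by (simp only: power_int_of_nat triangle_of_nat[symmetric])
      ultimately show ?thesis
        using q(2) by (simp add: power_int_add power_int_diff power_int_minus divide_simps)
    qed
    finally show "q ^ (j * (j - 1) div 2) * x ^ j / D = (- z) powi (int j - int N) *
       q powi ((int j - int N) * (int j - int N - 1) div 2)"
      unfolding e .
  qed
  finally show ?thesis .
qed


lemma has_sum_int_split:
  fixes f :: "int \<Rightarrow> complex"
  assumes "summable (\<lambda>n. norm (f (int n)))" "summable (\<lambda>n. norm (f (- int (Suc n))))"
  shows "(f has_sum ((\<Sum>n. f (int n)) + (\<Sum>n. f (- int (Suc n))))) UNIV"
proof -
  have 1: "(f has_sum (\<Sum>n. f (int n))) (range int)"
  proof (subst has_sum_reindex)
    show "(f \<circ> int has_sum (\<Sum>n. f (int n))) UNIV"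
      using assms(1) summable_norm_cancel[OF assms(1)]
      by (auto intro!: norm_summable_imp_has_sum summable_sums simp: o_def)
  qed auto
  have 2: "(f has_sum (\<Sum>n. f (- int (Suc n)))) (range (\<lambda>n. - int (Suc n)))"
  proof (subst has_sum_reindex)
    show "(f \<circ> (\<lambda>n. - int (Suc n)) has_sum (\<Sum>n. f (- int (Suc n)))) UNIV"
      using assms(2) summable_norm_cancel[OF assms(2)]
      by (auto intro!: norm_summable_imp_has_sum summable_sums simp: o_def simp del: of_nat_Suc)
  qed (auto simp: inj_on_def)
  have "range int \<union> range (\<lambda>n. - int (Suc n)) = UNIV"
  proof (intro equalityI subsetI)
    show "k \<in> range int \<union> range (\<lambda>n. - int (Suc n))" for k
      by (cases k rule: int_cases) blast+
  qed simp
  with has_sum_Un_disjoint[OF 1 2] show ?thesis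
    by fastforce
qed

lemma summable_theta_half:
  fixes y q :: complex
  assumes "norm q < 1"
  shows "summable (\<lambda>n. norm (y ^ n * q ^ (n * (n - 1) div 2)))"
proof -
  have "(\<lambda>n. norm y * norm q ^ n) \<longlonglongrightarrow> norm y * 0"
    using assms by (intro tendsto_intros LIMSEQ_power_zero) auto
  then have "eventually (\<lambda>n. norm y * norm q ^ n < 1/2) sequentially"
    by (rule order_tendstoD) auto
  then obtain N where N: "\<And>n. n \<ge> N \<Longrightarrow> norm y * norm q ^ n < 1/2"
    by (auto simp: eventually_at_top_linorder)
  show ?thesis
  proof (rule summable_ratio_test[of "1/2" N])
    fix n assume "n \<ge> N"
    have "norm (y ^ Suc n * q ^ (Suc n * (Suc n - 1) div 2))
        = (norm y * norm q ^ n) * norm (y ^ n * q ^ (n * (n - 1) div 2))"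
      using triangle_Suc[of n] by (simp add: norm_mult norm_power power_add)
    also have "\<dots> \<le> 1/2 * norm (y ^ n * q ^ (n * (n - 1) div 2))"
      using N[OF \<open>n \<ge> N\<close>] by (intro mult_right_mono) auto
    finally show "norm (norm (y ^ Suc n * q ^ (Suc n * (Suc n - 1) div 2)))
      \<le> 1/2 * norm (norm (y ^ n * q ^ (n * (n - 1) div 2)))" by simp
  qed auto
qed

definition theta :: "complex \<Rightarrow> complex \<Rightarrow> complex"
  where "theta z q = qpoch z q * qpoch (q / z) q * qpoch q q"

lemma qfact_tendsto:
  assumes "norm q < 1"
  shows "qfact q \<longlonglongrightarrow> qpoch q q"
  using qpoch_tendsto[OF assms, of q] by (simp add: qfact_def[abs_def])

lemma qpoch_self_nonzero:
  assumes "norm q < 1"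
  shows "qpoch q q \<noteq> 0"
  using assms by (intro qpoch_nonzero') auto

lemma qbinom_central_tendsto:
  assumes "norm q < 1"
  shows "(\<lambda>N. qbinom q (2 * N) (N + n)) \<longlonglongrightarrow> 1 / qpoch q q"
proof -
  have sub: "(\<lambda>N. qfact q (g N)) \<longlonglongrightarrow> qpoch q q" if "filterlim g sequentially sequentially" for g
    by (rule filterlim_compose[OF qfact_tendsto[OF assms] that])
  have "(\<lambda>N. qfact q (2 * N)) \<longlonglongrightarrow> qpoch q q" "(\<lambda>N. qfact q (N + n)) \<longlonglongrightarrow> qpoch q q"
    by (rule sub, rule filterlim_subseq, simp add: strict_mono_def)+
  moreover have "(\<lambda>N. qfact q (N - n)) \<longlonglongrightarrow> qpoch q q"
    by (rule sub[OF filterlim_minus_const_nat_at_top])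
  ultimately have "(\<lambda>N. qfact q (2 * N) / (qfact q (N + n) * qfact q (N - n)))
    \<longlonglongrightarrow> qpoch q q / (qpoch q q * qpoch q q)"
    using qpoch_self_nonzero[OF assms] by (intro tendsto_divide tendsto_mult) auto
  moreover have "eventually (\<lambda>N. qfact q (2 * N) / (qfact q (N + n) * qfact q (N - n))
      = qbinom q (2 * N) (N + n)) sequentially"
    using eventually_ge_at_top[of n] by eventually_elim (simp add: qbinom_def mult_2)
  ultimately have "(\<lambda>N. qbinom q (2 * N) (N + n)) \<longlonglongrightarrow> qpoch q q / (qpoch q q * qpoch q q)"
    by (rule Lim_transform_eventually)
  then show ?thesis
    using qpoch_self_nonzero[OF assms] by simp
qed

lemma qbinom_bounded:
  assumes "norm q < 1"
  obtains K where "K > 0" "\<And>m j. norm (qbinom q m j) \<le> K"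
proof -
  have "Bseq (qfact q)"
    by (intro convergent_imp_Bseq convergentI[OF qfact_tendsto[OF assms]])
  then obtain A where A: "A > 0" "\<And>n. norm (qfact q n) \<le> A"
    by (auto simp: Bseq_def)
  have "(\<lambda>n. inverse (qfact q n)) \<longlonglongrightarrow> inverse (qpoch q q)"
    by (intro tendsto_inverse qfact_tendsto qpoch_self_nonzero assms)
  then have "Bseq (\<lambda>n. inverse (qfact q n))"
    by (intro convergent_imp_Bseq convergentI)
  then obtain B where B: "B > 0" "\<And>n. norm (inverse (qfact q n)) \<le> B"
    by (auto simp: Bseq_def)
  have "norm (qbinom q m j) \<le> A * (B * B)" for m j
  proof (cases "j \<le> m")
    case True
    then have "norm (qbinom q m j) = norm (qfact q m) * (norm (inverse (qfact q j)) * norm (inverse (qfact q (m - j))))"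
      by (simp add: qbinom_def norm_mult norm_divide norm_inverse divide_inverse)
    also have "\<dots> \<le> A * (B * B)"
      using A B by (intro mult_mono) auto
    finally show ?thesis .
  qed (use A B in \<open>auto simp: qbinom_def\<close>)
  then show ?thesis
    using A B by (intro that[of "A * (B * B)"]) auto
qed

lemma qbinom_symmetric: "j \<le> m \<Longrightarrow> qbinom q m (m - j) = qbinom q m j"
  by (simp add: qbinom_def mult.commute)

lemma theta_term_neg:
  fixes z q :: complex
  assumes "q \<noteq> 0" "z \<noteq> 0"
  shows "(- z) powi (- int n) * q powi (- int n * (- int n - 1) div 2)
       = (- (q / z)) ^ n * q ^ (n * (n - 1) div 2)"
proof -
  have "- int n * (- int n - 1) div 2 = int (n * (n - 1) div 2) + int n"
  proof -
    have "2 * (- int n * (- int n - 1) div 2) = 2 * (int n * (int n - 1) div 2 + int n)"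
      by (simp only: two_times_triangle distrib_left) (simp add: algebra_simps)
    then have "- int n * (- int n - 1) div 2 = int n * (int n - 1) div 2 + int n"
      by (simp only: mult_cancel_left) auto
    then show ?thesis by (simp only: triangle_of_nat)
  qed
  then have "q powi (- int n * (- int n - 1) div 2) = q ^ (n * (n - 1) div 2) * q ^ n"
    using assms by (simp add: power_int_add)
  moreover have "(- (q / z)) ^ n = q ^ n / (- z) ^ n"
    by (simp flip: power_divide)
  moreover have "(- z) powi (- int n) = 1 / (- z) ^ n"
    by (simp only: power_int_minus power_int_of_nat inverse_eq_divide)
  ultimately show ?thesis
    by (simp only: times_divide_eq_left mult_1 mult.commute)
qed

lemma theta_term_nonneg:
  fixes z q :: complex
  shows "(- z) powi (int n) * q powi (int n * (int n - 1) div 2) = (- z) ^ n * q ^ (n * (n - 1) div 2)"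
  unfolding triangle_of_nat[symmetric] by (simp only: power_int_of_nat)

text \<open>Jacobi's triple product.\<close>

theorem jacobi_triple_product:
  assumes q: "norm q < 1" "q \<noteq> 0" and z: "z \<noteq> 0"
  shows "((\<lambda>n. (- z) powi n * q powi (n * (n - 1) div 2)) has_sum theta z q) UNIV"
proof -
  define t where "t w n = (- w) ^ n * q ^ (n * (n - 1) div 2)" for w :: complex and n
  define f where "f n = (- z) powi n * q powi (n * (n - 1) div 2)" for n :: int
  have f1: "f (int n) = t z n" and f2: "f (- int n) = t (q / z) n" for n
    using theta_term_nonneg[of z n q] theta_term_neg[OF q(2) z, of n] by (simp_all add: f_def t_def)
  have summ: "summable (\<lambda>n. norm (t z n))" for z
    unfolding t_def by (rule summable_theta_half[OF q(1)])
  have summ': "summable (\<lambda>n. norm (t z (Suc n)))" for z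
    using summ[of z] summable_Suc_iff[of "\<lambda>n. norm (t z n)"] by simp
  obtain K where K: "K > 0" "\<And>m j. norm (qbinom q m j) \<le> K"
    using qbinom_bounded[OF q(1)] by blast
  define b where "b N n = qbinom q (2 * N) (N + n)" for N n
  have b0: "b N n = 0" if "n > N" for N n
    using that by (simp add: b_def qbinom_def)
  have bK: "norm (b N n) \<le> K" for N n
    using K(2) by (simp add: b_def)
  have fin: "(\<Prod>k<N. 1 - z * q ^ k) * (\<Prod>k<N. 1 - q / z * q ^ k) =
    (\<Sum>n. b N n * t z n) + (\<Sum>n. b N (Suc n) * t (q / z) (Suc n))" for N
  proof -
    have "(\<Prod>k<N. 1 - z * q ^ k) * (\<Prod>k<N. 1 - q / z * q ^ k) =
      (\<Sum>j\<le>2 * N. qbinom q (2 * N) j * f (int j - int N))"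
      unfolding finite_triple_product[OF q z] f_def ..
    also have "{..2 * N} = (\<lambda>n. N + n) ` {..N} \<union> (\<lambda>n. N - Suc n) ` {..<N}"
    proof (intro equalityI subsetI)
      fix j assume j: "j \<in> {..2 * N}"
      show "j \<in> (\<lambda>n. N + n) ` {..N} \<union> (\<lambda>n. N - Suc n) ` {..<N}"
      proof (cases "j \<ge> N")
        case True
        then show ?thesis using j by (intro UnI1 image_eqI[of _ _ "j - N"]) auto
      next
        case False
        then show ?thesis using j by (intro UnI2 image_eqI[of _ _ "N - Suc j"]) auto
      qed
    qed auto
    also have "(\<Sum>j\<in>\<dots>. qbinom q (2 * N) j * f (int j - int N)) =
      (\<Sum>j\<in>(\<lambda>n. N + n) ` {..N}. qbinom q (2 * N) j * f (int j - int N)) +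
      (\<Sum>j\<in>(\<lambda>n. N - Suc n) ` {..<N}. qbinom q (2 * N) j * f (int j - int N))"
      by (rule sum.union_disjoint) auto
    also have "(\<Sum>j\<in>(\<lambda>n. N + n) ` {..N}. qbinom q (2 * N) j * f (int j - int N)) = (\<Sum>n\<le>N. b N n * t z n)"
      by (subst sum.reindex) (auto simp: inj_on_def b_def f1)
    also have "\<dots> = (\<Sum>n. b N n * t z n)"
      using b0 by (intro suminf_finite[symmetric]) (auto simp: not_le)
    also have "(\<Sum>j\<in>(\<lambda>n. N - Suc n) ` {..<N}. qbinom q (2 * N) j * f (int j - int N))
       = (\<Sum>n<N. b N (Suc n) * t (q / z) (Suc n))"
    proof (subst sum.reindex, force simp: inj_on_def, intro sum.cong refl)
      fix n assume n: "n \<in> {..<N}"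
      have "2 * N - (N + Suc n) = N - Suc n" by simp
      then have "qbinom q (2 * N) (N - Suc n) = b N (Suc n)"
        using qbinom_symmetric[of "N + Suc n" "2 * N" q] n by (simp add: b_def)
      moreover have "f (int (N - Suc n) - int N) = t (q / z) (Suc n)"
        using f2[of "Suc n"] n by (simp add: of_nat_diff)
      ultimately show "((\<lambda>j. qbinom q (2 * N) j * f (int j - int N)) \<circ> (\<lambda>n. N - Suc n)) n
          = b N (Suc n) * t (q / z) (Suc n)" by simp
    qed
    also have "\<dots> = (\<Sum>n. b N (Suc n) * t (q / z) (Suc n))"
      using b0 by (intro suminf_finite[symmetric]) (auto simp: not_less)
    finally show ?thesis .
  qed
  have lim: "(\<lambda>N. \<Sum>n. c N n * u n) \<longlonglongrightarrow> (\<Sum>n. 1 / qpoch q q * u n)"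
    if "summable (\<lambda>n. norm (u n))" "\<And>n. (\<lambda>N. c N n) \<longlonglongrightarrow> 1 / qpoch q q" "\<And>N n. norm (c N n) \<le> K"
    for c :: "nat \<Rightarrow> nat \<Rightarrow> complex" and u :: "nat \<Rightarrow> complex"
  proof (rule tannerys_theorem[where M = "\<lambda>n. K * norm (u n)", THEN conjunct2, THEN conjunct2])
    show "(\<lambda>N. c N n * u n) \<longlonglongrightarrow> 1 / qpoch q q * u n" for n
      by (rule tendsto_mult_right[OF that(2)])
    have "norm (c N n * u n) \<le> K * norm (u n)" for N n
      using that(3)[of N n] by (simp add: norm_mult mult_right_mono)
    then show "\<forall>\<^sub>F (n, N) in at_top \<times>\<^sub>F sequentially. norm (c N n * u n) \<le> K * norm (u n)"
      by (intro always_eventually) auto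
    show "summable (\<lambda>n. K * norm (u n))"
      by (rule summable_mult[OF that(1)])
  qed simp
  have "(\<lambda>N. (\<Prod>k<N. 1 - z * q ^ k) * (\<Prod>k<N. 1 - q / z * q ^ k)) \<longlonglongrightarrow>
    (\<Sum>n. 1 / qpoch q q * t z n) + (\<Sum>n. 1 / qpoch q q * t (q / z) (Suc n))"
    unfolding fin
    by (intro tendsto_add lim summ summ' bK qbinom_central_tendsto[OF q(1), folded b_def])
  moreover have "(\<lambda>N. (\<Prod>k<N. 1 - z * q ^ k) * (\<Prod>k<N. 1 - q / z * q ^ k)) \<longlonglongrightarrow>
    qpoch z q * qpoch (q / z) q"
    by (intro tendsto_mult qpoch_tendsto q)
  ultimately have "qpoch z q * qpoch (q / z) q =
    (\<Sum>n. 1 / qpoch q q * t z n) + (\<Sum>n. 1 / qpoch q q * t (q / z) (Suc n))"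
    using LIMSEQ_unique by blast
  also have "\<dots> = ((\<Sum>n. t z n) + (\<Sum>n. t (q / z) (Suc n))) / qpoch q q"
    by (simp only: suminf_mult[OF summable_norm_cancel[OF summ]]
          suminf_mult[OF summable_norm_cancel[OF summ']] add_divide_distrib) simp
  finally have "theta z q = (\<Sum>n. t z n) + (\<Sum>n. t (q / z) (Suc n))"
    using qpoch_self_nonzero[OF q(1)] by (simp add: theta_def)
  moreover have "(f has_sum ((\<Sum>n. t z n) + (\<Sum>n. t (q / z) (Suc n)))) UNIV"
    using has_sum_int_split[of f, unfolded f1 f2, OF summ summ'] .
  ultimately show ?thesis
    unfolding f_def[abs_def] by simp
qed


lemma entire_powser_euler_operator:
  fixes a :: "nat \<Rightarrow> complex"
  assumes a: "\<And>w. summable (\<lambda>n. a n * w ^ n)"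
  shows "summable (\<lambda>n. norm (of_nat n * (a n * w ^ n)))" (is ?A)
    and "((\<lambda>w. \<Sum>n. a n * w ^ n) has_field_derivative D) (at w) \<Longrightarrow> (\<Sum>n. of_nat n * (a n * w ^ n)) = w * D"
    and "(\<lambda>w. \<Sum>n. a n * w ^ n) field_differentiable (at w)"
proof -
  have d: "summable (\<lambda>n. diffs a n * w ^ n)" for w
    using termdiff_converges_all[of a, OF a] .
  have s: "(\<lambda>n. of_nat n * (a n * w ^ n)) sums (w * (\<Sum>n. diffs a n * w ^ n))" for w
  proof -
    have "(\<lambda>n. diffs a n * w ^ n) sums (\<Sum>n. diffs a n * w ^ n)"
      using d by (rule summable_sums)
    then have "(\<lambda>n. w * (diffs a n * w ^ n)) sums (w * (\<Sum>n. diffs a n * w ^ n))"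
      by (rule sums_mult)
    moreover have "w * (diffs a n * w ^ n) = of_nat (Suc n) * (a (Suc n) * w ^ Suc n)" for n
      by (simp add: diffs_def)
    ultimately show ?thesis
      using sums_Suc[of "\<lambda>n. of_nat n * (a n * w ^ n)" "w * (\<Sum>n. diffs a n * w ^ n)"]
      by (simp del: of_nat_Suc power_Suc)
  qed
  then have "summable (\<lambda>n. (of_nat n * a n) * w ^ n)" for w
    using sums_summable[OF s[of w]] by (simp add: mult.assoc)
  from powser_insidea[OF this[of "of_real (norm w + 1)"], of w] show ?A
    by (simp add: mult.assoc)
  have der: "((\<lambda>w. \<Sum>n. a n * w ^ n) has_field_derivative (\<Sum>n. diffs a n * w ^ n)) (at w)"
    by (rule termdiffs_strong_converges_everywhere[OF a])
  then show "(\<lambda>w. \<Sum>n. a n * w ^ n) field_differentiable (at w)"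
    by (auto simp: field_differentiable_def)
  assume "((\<lambda>w. \<Sum>n. a n * w ^ n) has_field_derivative D) (at w)"
  with der have "D = (\<Sum>n. diffs a n * w ^ n)"
    using DERIV_unique by blast
  with s[of w] show "(\<Sum>n. of_nat n * (a n * w ^ n)) = w * D"
    by (simp add: sums_iff)
qed

lemma summable_int_imp_summable_nat:
  fixes f :: "int \<Rightarrow> complex"
  assumes "f summable_on UNIV" "inj g"
  shows "summable (\<lambda>n :: nat. f (g n))"
proof -
  have "f summable_on range g"
    using assms(1) by (rule summable_on_subset_banach) auto
  then have "(f \<circ> g) summable_on UNIV"
    using summable_on_reindex[OF assms(2)] by blast
  then have "(\<lambda>n. f (g n)) summable_on UNIV"
    by (simp add: o_def)
  then obtain S where "((\<lambda>n. f (g n)) has_sum S) UNIV"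
    by (auto simp: summable_on_def)
  then show ?thesis
    by (intro sums_summable[OF has_sum_imp_sums])
qed

lemma laurent_euler_operator:
  fixes c :: "int \<Rightarrow> complex"
  assumes F: "\<And>z. z \<noteq> 0 \<Longrightarrow> ((\<lambda>n. c n * z powi n) has_sum F z) UNIV" and z: "z \<noteq> 0"
  shows "F field_differentiable (at z)"
    and "((\<lambda>n. of_int n * (c n * z powi n)) has_sum (z * deriv F z)) UNIV"
proof -
  define a b where "a n = c (int n)" and "b n = (if n = 0 then 0 else c (- int n))" for n :: nat
  have sum_c: "(\<lambda>n. c n * w powi n) summable_on UNIV" if "w \<noteq> 0" for w
    using F[OF that] by (auto simp: summable_on_def)
  have neg: "w powi (- int (Suc n)) = (1 / w) ^ Suc n" for w :: complex and n
    by (simp only: power_int_minus power_int_of_nat power_one_over inverse_eq_divide)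
  have a: "summable (\<lambda>n. a n * w ^ n)" for w
  proof (cases "w = 0")
    case False
    show ?thesis
      using summable_int_imp_summable_nat[OF sum_c[OF False], of int] by (simp add: a_def)
  qed (simp add: summable_0_powser)
  have b: "summable (\<lambda>n. b n * w ^ n)" for w
  proof (cases "w = 0")
    case False
    have "summable (\<lambda>n. b (Suc n) * w ^ Suc n)"
      using summable_int_imp_summable_nat[OF sum_c[of "1 / w"], of "\<lambda>n. - int (Suc n)", unfolded neg] False
      by (simp add: b_def inj_def del: of_nat_Suc power_Suc)
    then show ?thesis
      by (subst (asm) summable_Suc_iff)
  qed (simp add: summable_0_powser)
  define G H where "G w = (\<Sum>n. a n * w ^ n)" and "H w = (\<Sum>n. b n * w ^ n)" for w
  have H': "H w = (\<Sum>n. b (Suc n) * w ^ Suc n)" for w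
    using suminf_split_head[OF b[of w]] by (simp add: H_def b_def)
  have na: "summable (\<lambda>n. norm (a n * w ^ n))" and nb: "summable (\<lambda>n. norm (b n * w ^ n))" for w
    using powser_insidea[OF a[of "of_real (norm w + 1)"], of w]
      powser_insidea[OF b[of "of_real (norm w + 1)"], of w] by auto
  have eq: "F w = G w + H (1 / w)" if w: "w \<noteq> 0" for w
  proof -
    have "((\<lambda>n. c n * w powi n) has_sum ((\<Sum>n. c (int n) * w powi (int n)) +
        (\<Sum>n. c (- int (Suc n)) * w powi (- int (Suc n))))) UNIV"
    proof (rule has_sum_int_split)
      show "summable (\<lambda>n. norm (c (int n) * w powi int n))"
        using na[of w] by (simp add: a_def)
      show "summable (\<lambda>n. norm (c (- int (Suc n)) * w powi (- int (Suc n))))"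
        using nb[of "1 / w"] unfolding neg
        by (subst (asm) summable_Suc_iff[symmetric]) (simp add: b_def del: of_nat_Suc power_Suc)
    qed
    from has_sum_unique[OF F[OF w] this] show ?thesis
      unfolding neg by (simp add: G_def H' a_def b_def del: of_nat_Suc power_Suc)
  qed
  note opa = entire_powser_euler_operator[OF a] and opb = entire_powser_euler_operator[OF b]
  obtain G' where G': "(G has_field_derivative G') (at z)"
    using opa(3)[of z] unfolding G_def[abs_def] field_differentiable_def by blast
  obtain H' where H'': "(H has_field_derivative H') (at (1 / z))"
    using opb(3)[of "1 / z"] unfolding H_def[abs_def] field_differentiable_def by blast
  have "((\<lambda>w. 1 / w) has_field_derivative (- 1 / z ^ 2)) (at z)"
    using z by (auto intro!: derivative_eq_intros simp: power2_eq_square)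
  with H'' have "((\<lambda>w. H (1 / w)) has_field_derivative (H' * (- 1 / z ^ 2))) (at z)"
    by (rule DERIV_chain2[where f = H and g = "\<lambda>w. 1 / w"])
  from DERIV_add[OF G' this]
  have "((\<lambda>w. G w + H (1 / w)) has_field_derivative (G' - 1 / z ^ 2 * H')) (at z)"
    by (simp add: mult.commute)
  moreover have "eventually (\<lambda>w. w \<in> - {0}) (nhds z)"
    using z by (intro eventually_nhds_in_open) auto
  then have "eventually (\<lambda>w. G w + H (1 / w) = F w) (nhds z)"
    by eventually_elim (simp add: eq)
  ultimately have F': "(F has_field_derivative (G' - 1 / z ^ 2 * H')) (at z)"
    using DERIV_cong_ev[OF refl _ refl, of "\<lambda>w. G w + H (1 / w)" F z] by blast
  then show "F field_differentiable (at z)"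
    by (auto simp: field_differentiable_def)
  have "z * deriv F z = z * G' - 1 / z * H'"
    using DERIV_imp_deriv[OF F'] z by (simp add: field_simps power2_eq_square)
  also have "z * G' = (\<Sum>n. of_int (int n) * (c (int n) * z powi (int n)))"
    using opa(2)[OF G'[unfolded G_def[abs_def]]] by (simp add: a_def)
  also have "1 / z * H' = (\<Sum>n. of_nat n * (b n * (1 / z) ^ n))"
    using opb(2)[OF H''[unfolded H_def[abs_def]]] by simp
  also have "\<dots> = (\<Sum>n. of_nat (Suc n) * (b (Suc n) * (1 / z) ^ Suc n))"
    using suminf_split_head[OF summable_norm_cancel[OF opb(1)], of "1 / z"] by simp
  also have "(\<Sum>n. of_int (int n) * (c (int n) * z powi (int n))) - \<dots> =
    (\<Sum>n. of_int (int n) * (c (int n) * z powi (int n))) +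
    (\<Sum>n. of_int (- int (Suc n)) * (c (- int (Suc n)) * z powi (- int (Suc n))))"
    unfolding neg
    using suminf_minus[of "\<lambda>n. of_nat (Suc n) * (b (Suc n) * (1 / z) ^ Suc n)"]
      summable_norm_cancel[OF opb(1), of "1 / z"]
      summable_Suc_iff[of "\<lambda>n. of_nat n * (b n * (1 / z) ^ n)"]
    by (simp add: b_def del: of_nat_Suc power_Suc)
  finally have e: "z * deriv F z = \<dots>" .
  show "((\<lambda>n. of_int n * (c n * z powi n)) has_sum (z * deriv F z)) UNIV"
    unfolding e
  proof (rule has_sum_int_split)
    show "summable (\<lambda>n. norm (of_int (int n) * (c (int n) * z powi int n)))"
      using opa(1)[of z] by (simp add: a_def)
    show "summable (\<lambda>n. norm (of_int (- int (Suc n)) * (c (- int (Suc n)) * z powi (- int (Suc n)))))"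
      using opb(1)[of "1 / z"] unfolding neg
      by (subst (asm) summable_Suc_iff[symmetric]) (simp add: b_def norm_mult del: of_nat_Suc power_Suc)
  qed
qed

definition dtheta :: "complex \<Rightarrow> complex \<Rightarrow> complex"
  where "dtheta z q = z * deriv (\<lambda>z. theta z q) z"

lemma uminus_powi: "(- z) powi n = (- 1) powi n * z powi n" for z :: complex
  using power_int_mult_distrib[of "-1" z n] by simp

lemma theta_expansion:
  assumes "norm q < 1" "q \<noteq> 0" "z \<noteq> 0"
  shows "((\<lambda>n. (- 1) powi n * q powi (n * (n - 1) div 2) * z powi n) has_sum theta z q) UNIV"
  using jacobi_triple_product[OF assms] by (simp only: uminus_powi[of z] mult_ac)

lemma dtheta_expansion:
  assumes "norm q < 1" "q \<noteq> 0" "z \<noteq> 0"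
  shows "((\<lambda>n. of_int n * ((- 1) powi n * q powi (n * (n - 1) div 2) * z powi n)) has_sum dtheta z q) UNIV"
  unfolding dtheta_def using theta_expansion[OF assms(1,2)] assms(3)
  by (rule laurent_euler_operator(2))

lemma theta_quadratic_exponent:
  assumes "norm q < 1" "q \<noteq> 0" "z \<noteq> 0" "a > 0"
  shows "((\<lambda>n. (- z) powi n * q powi (int a * (n * (n - 1) div 2) + b * n)) has_sum theta (z * q powi b) (q ^ a)) UNIV"
    and "((\<lambda>n. of_int n * ((- z) powi n * q powi (int a * (n * (n - 1) div 2) + b * n))) has_sum dtheta (z * q powi b) (q ^ a)) UNIV"
proof -
  have qa: "norm (q ^ a) < 1" "q ^ a \<noteq> 0" "z * q powi b \<noteq> 0"
    using assms by (simp_all add: norm_power power_less_one_iff)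
  have "(- 1) powi n * (q ^ a) powi (n * (n - 1) div 2) * (z * q powi b) powi n
      = (- z) powi n * q powi (int a * (n * (n - 1) div 2) + b * n)" for n
    using assms by (simp add: uminus_powi[of z] power_int_mult_distrib power_int_add power_int_mult)
  with theta_expansion[OF qa] dtheta_expansion[OF qa] show
    "((\<lambda>n. (- z) powi n * q powi (int a * (n * (n - 1) div 2) + b * n)) has_sum theta (z * q powi b) (q ^ a)) UNIV"
    "((\<lambda>n. of_int n * ((- z) powi n * q powi (int a * (n * (n - 1) div 2) + b * n))) has_sum dtheta (z * q powi b) (q ^ a)) UNIV"
    by simp_all
qed

lemma has_sum_product:
  fixes f :: "'a \<Rightarrow> complex" and g :: "'b \<Rightarrow> complex"
  assumes "(f has_sum a) UNIV" "(g has_sum b) UNIV"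
  shows "((\<lambda>(x, y). f x * g y) has_sum (a * b)) UNIV"
proof -
  have abs: "(\<lambda>x. norm (f x)) summable_on UNIV" "(\<lambda>x. norm (g x)) summable_on UNIV"
    using assms summable_on_iff_abs_summable_on_complex by (auto simp: summable_on_def)
  have "(\<lambda>p. norm (case p of (x, y) \<Rightarrow> f x * g y)) summable_on Sigma UNIV (\<lambda>_. UNIV)"
  proof (subst Infinite_Sum.abs_summable_on_Sigma_iff, intro conjI ballI)
    show "(\<lambda>y. norm (case (x, y) of (x, y) \<Rightarrow> f x * g y)) summable_on UNIV" for x
      using abs(2) by (auto simp: norm_mult intro: summable_on_cmult_right)
    have "(\<lambda>x. norm (f x) * (\<Sum>\<^sub>\<infinity>y. norm (g y))) summable_on UNIV"
      using abs(1) by (intro summable_on_cmult_left)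
    then have "(\<lambda>x. norm (norm (f x) * (\<Sum>\<^sub>\<infinity>y. norm (g y)))) summable_on UNIV"
      by (simp add: infsum_nonneg)
    then show "(\<lambda>x. norm (\<Sum>\<^sub>\<infinity>y. norm (case (x, y) of (x, y) \<Rightarrow> f x * g y))) summable_on UNIV"
      by (simp add: norm_mult infsum_cmult_right')
  qed
  then have "(\<lambda>(x, y). f x * g y) summable_on Sigma UNIV (\<lambda>_. UNIV)"
    by (rule Infinite_Sum.abs_summable_summable)
  then obtain S where S: "((\<lambda>(x, y). f x * g y) has_sum S) (Sigma UNIV (\<lambda>_. UNIV))"
    by (auto simp: summable_on_def)
  have "((\<lambda>x. f x * b) has_sum S) UNIV"
    by (rule has_sum_SigmaD[OF S]) (auto intro: has_sum_cmult_right assms)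
  moreover have "((\<lambda>x. f x * b) has_sum (a * b)) UNIV"
    by (intro has_sum_cmult_left assms)
  ultimately show ?thesis
    using S has_sum_unique by fastforce
qed

text \<open>The lattice of pairs splits according to the parity of the sum of the coordinates.\<close>

lemma has_sum_rotate_lattice:
  fixes F :: "int \<times> int \<Rightarrow> complex"
  assumes F: "(F has_sum S) UNIV"
    and e: "\<And>n d. F (n + d, n - d) = u n * v d" "(u has_sum U) UNIV" "(v has_sum V) UNIV"
    and o: "\<And>n d. F (n + d + 1, n - d) = u' n * v' d" "(u' has_sum U') UNIV" "(v' has_sum V') UNIV"
  shows "S = U * V + U' * V'"
proof -
  let ?e = "\<lambda>(n :: int, d). (n + d, n - d)" and ?o = "\<lambda>(n :: int, d). (n + d + 1, n - d)"
  have 1: "(F has_sum (U * V)) (range ?e)"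
    by (subst has_sum_reindex)
       (use has_sum_product[OF e(2,3)] in \<open>auto simp: inj_on_def o_def e(1) case_prod_unfold\<close>)
  have 2: "(F has_sum (U' * V')) (range ?o)"
    by (subst has_sum_reindex)
       (use has_sum_product[OF o(2,3)] in \<open>auto simp: inj_on_def o_def o(1) case_prod_unfold\<close>)
  have disj: "range ?e \<inter> range ?o = {}"
    by auto presburger
  have "range ?e \<union> range ?o = UNIV"
  proof (intro equalityI subsetI)
    fix p :: "int \<times> int" assume "p \<in> UNIV"
    obtain i j where p: "p = (i, j)" by (cases p)
    show "p \<in> range ?e \<union> range ?o"
    proof (cases "even (i + j)")
      case True
      then have "p = ?e ((i + j) div 2, i - (i + j) div 2)" by (auto simp: p)
      then show ?thesis by blast
    next
      case False
      then have "p = ?o ((i + j) div 2, i - 1 - (i + j) div 2)" by (auto simp: p) presburger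
      then show ?thesis by blast
    qed
  qed auto
  with has_sum_Un_disjoint[OF 1 2 disj] F show ?thesis
    using has_sum_unique by fastforce
qed


lemma has_sum_parity_split:
  fixes f :: "int \<Rightarrow> complex"
  assumes f: "(f has_sum S) UNIV"
    and e: "((\<lambda>n. f (2 * n)) has_sum a) UNIV" and o: "((\<lambda>n. f (2 * n + 1)) has_sum b) UNIV"
  shows "S = a + b"
proof -
  have 1: "(f has_sum a) (range (\<lambda>n. 2 * n))"
    by (subst has_sum_reindex) (use e in \<open>auto simp: inj_on_def o_def\<close>)
  have 2: "(f has_sum b) (range (\<lambda>n. 2 * n + 1))"
    by (subst has_sum_reindex) (use o in \<open>auto simp: inj_on_def o_def\<close>)
  have disj: "range (\<lambda>n :: int. 2 * n) \<inter> range (\<lambda>n. 2 * n + 1) = {}"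
    by auto presburger
  have "range (\<lambda>n :: int. 2 * n) \<union> range (\<lambda>n. 2 * n + 1) = UNIV"
  proof (intro equalityI subsetI)
    show "k \<in> range (\<lambda>n :: int. 2 * n) \<union> range (\<lambda>n. 2 * n + 1)" for k
      by (cases "even k") (auto elim!: evenE oddE)
  qed simp
  with has_sum_Un_disjoint[OF 1 2 disj] f show ?thesis
    using has_sum_unique by fastforce
qed

abbreviation euler_prod :: "complex \<Rightarrow> complex"
  where "euler_prod q \<equiv> qpoch q q"

lemma norm_power_less_1: "norm q < 1 \<Longrightarrow> n > 0 \<Longrightarrow> norm (q ^ n) < 1" for q :: complex
  by (simp add: norm_power power_less_one_iff)

lemma euler_prod_pentagonal:
  assumes q: "norm q < 1" "q \<noteq> 0"
  shows "euler_prod q = theta (q ^ 2) (q ^ 3)"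
proof -
  have "q * q = q ^ 2" "q * q ^ 2 = q ^ 3"
    by (simp_all add: eval_nat_numeral)
  moreover from this have "q ^ 3 / q ^ 2 = q"
    using q by (metis nonzero_mult_div_cancel_right power_not_zero)
  ultimately show ?thesis
    using qpoch_split3[OF q(1), of q] by (simp only: theta_def mult_ac)
qed

lemma theta_1 [simp]: "norm q < 1 \<Longrightarrow> theta 1 q = 0"
  by (simp add: theta_def qpoch_rec[of q 1])

lemma dtheta_1:
  assumes q: "norm q < 1"
  shows "dtheta 1 q = - (euler_prod q ^ 3)"
proof -
  define h where "h z = qpoch (z * q) q * qpoch (q / z) q * euler_prod q" for z
  have th: "theta z q = (1 - z) * h z" for z
    unfolding theta_def h_def by (subst qpoch_rec[OF q, of z]) (simp only: mult_ac)
  have "h holomorphic_on - {0}"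
    unfolding h_def
    by (intro holomorphic_intros holomorphic_on_compose_gen[OF _ qpoch_holomorphic[OF q, of UNIV], unfolded o_def]) auto
  then obtain h' where h': "(h has_field_derivative h') (at 1)"
    using holomorphic_on_imp_differentiable_at[of h "- {0}" 1] by (auto simp: field_differentiable_def)
  have "((\<lambda>z. (1 - z) * h z) has_field_derivative - h 1) (at 1)"
    by (auto intro!: derivative_eq_intros h')
  then have "((\<lambda>z. theta z q) has_field_derivative - h 1) (at 1)"
    by (simp add: th)
  then show ?thesis
    by (simp add: dtheta_def DERIV_imp_deriv h_def eval_nat_numeral)
qed

lemma qpoch_uminus_self:
  assumes "norm q < 1"
  shows "euler_prod q * qpoch (- q) q = euler_prod (q ^ 2)"
  using qpoch_mult_uminus[OF assms, of q] .

lemma qpoch_odd_mult_uminus_self: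
  assumes q: "norm q < 1"
  shows "qpoch q (q ^ 2) * qpoch (- q) q = 1"
proof -
  have "euler_prod q = qpoch q (q ^ 2) * euler_prod (q ^ 2)"
    using qpoch_split2[OF q, of q] by (simp add: power2_eq_square)
  with qpoch_uminus_self[OF q] have "euler_prod (q ^ 2) * (qpoch q (q ^ 2) * qpoch (- q) q) = euler_prod (q ^ 2) * 1"
    by (simp add: mult_ac)
  then show ?thesis
    using qpoch_self_nonzero[OF norm_power_less_1[OF q, of 2]] by (simp only: mult_cancel_left) auto
qed

lemma one_div_omega: "1 / omega = omega ^ 2" "1 / omega ^ 2 = omega"
  using omega_cube by (auto simp: field_simps eval_nat_numeral)

lemma theta_omega:
  assumes q: "norm q < 1"
  shows "theta omega q = (1 - omega) * euler_prod (q ^ 3)"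
proof -
  have "theta omega q = (1 - omega) * (qpoch (omega * q) q * qpoch (omega ^ 2 * q) q * qpoch q q)"
    using one_div_omega(1) by (simp add: theta_def qpoch_rec[OF q, of omega] divide_inverse mult_ac)
  also have "qpoch (omega * q) q * qpoch (omega ^ 2 * q) q * qpoch q q = euler_prod (q ^ 3)"
    using qpoch_omega[OF q, of q] by (simp add: mult_ac)
  finally show ?thesis .
qed

lemma theta_uminus_omega:
  assumes q: "norm q < 1"
  shows "theta (- omega) q * euler_prod (q ^ 2) * euler_prod (q ^ 3)
    = - (omega ^ 2) * euler_prod (q ^ 6) * euler_prod q ^ 2"
proof -
  have "q / - omega = - (omega ^ 2 * q)"
    using one_div_omega(1) by (simp add: divide_inverse)
  then have "theta (- omega) q * qpoch (- q) q = (1 + omega) * (qpoch (- q) q * qpoch (- (omega * q)) q * qpoch (- (omega ^ 2 * q)) q) * euler_prod q"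
    by (simp add: theta_def qpoch_rec[OF q, of "- omega"] mult_ac)
  also have "qpoch (- q) q * qpoch (- (omega * q)) q * qpoch (- (omega ^ 2 * q)) q = qpoch (- (q ^ 3)) (q ^ 3)"
    using qpoch_omega[OF q, of "- q"] by simp
  also have "1 + omega = - (omega ^ 2)" by (simp add: omega_sq)
  finally have *: "theta (- omega) q * qpoch (- q) q = - (omega ^ 2) * qpoch (- (q ^ 3)) (q ^ 3) * euler_prod q" .
  have 2: "euler_prod (q ^ 2) = euler_prod q * qpoch (- q) q"
    using qpoch_uminus_self[OF q] by simp
  have 6: "euler_prod (q ^ 6) = euler_prod (q ^ 3) * qpoch (- (q ^ 3)) (q ^ 3)"
    using qpoch_uminus_self[OF norm_power_less_1[OF q, of 3]] by (simp flip: power_mult)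
  have "theta (- omega) q * euler_prod (q ^ 2) * euler_prod (q ^ 3)
      = (theta (- omega) q * qpoch (- q) q) * euler_prod q * euler_prod (q ^ 3)"
    unfolding 2 by (simp only: mult_ac)
  also have "\<dots> = - (omega ^ 2) * euler_prod (q ^ 6) * euler_prod q ^ 2"
    unfolding * 6 power2_eq_square[of "euler_prod q"] by (simp only: mult_ac)
  finally show ?thesis .
qed

lemma theta_product_mod6_even:
  assumes s: "norm s < 1" "s \<noteq> 0"
  shows "theta (- (omega ^ 2 * s)) (s ^ 2) * euler_prod (s ^ 3) = euler_prod s * theta (- (s ^ 4)) (s ^ 6)"
proof -
  define c where "c = qpoch (- s) (s ^ 2)"
  have n: "norm (s ^ 2) < 1" "norm (s ^ 3) < 1" "norm (s ^ 6) < 1" "norm (s ^ 4) < 1"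
    using s(1) by (auto intro: norm_power_less_1)
  have c: "c \<noteq> 0"
    unfolding c_def using s n by (intro qpoch_nonzero_ball) auto
  have "s ^ 2 / - (omega ^ 2 * s) = - (omega * s)"
    using one_div_omega(2) s by (simp add: power2_eq_square field_simps)
  then have "theta (- (omega ^ 2 * s)) (s ^ 2) * c = (qpoch (- s) (s ^ 2) * qpoch (omega * (- s)) (s ^ 2) * qpoch (omega ^ 2 * (- s)) (s ^ 2)) * euler_prod (s ^ 2)"
    by (simp add: theta_def c_def mult_ac)
  also have "\<dots> = qpoch (- (s ^ 3)) (s ^ 6) * euler_prod (s ^ 2)"
    using qpoch_omega[OF n(1), of "- s"] by (simp flip: power_mult)
  finally have 1: "theta (- (omega ^ 2 * s)) (s ^ 2) * c = qpoch (- (s ^ 3)) (s ^ 6) * euler_prod (s ^ 2)" .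
  have Es: "euler_prod s = qpoch s (s ^ 2) * euler_prod (s ^ 2)"
    using qpoch_split2[OF s(1), of s] by (simp add: power2_eq_square)
  have E3: "euler_prod (s ^ 3) = qpoch (s ^ 3) (s ^ 6) * euler_prod (s ^ 6)"
    using qpoch_split2[OF n(2), of "s ^ 3"] by (simp flip: power_mult power_add)
  have 2: "qpoch s (s ^ 2) * c = qpoch (s ^ 2) (s ^ 4)"
    using qpoch_mult_uminus[OF n(1), of s] by (simp add: c_def flip: power_mult)
  have 3: "qpoch (- (s ^ 3)) (s ^ 6) * qpoch (s ^ 3) (s ^ 6) = qpoch (s ^ 6) (s ^ 12)"
    using qpoch_mult_uminus[OF n(3), of "s ^ 3"] by (simp add: mult_ac flip: power_mult)
  have 4: "qpoch (s ^ 2) (s ^ 4) * qpoch (- (s ^ 2)) (s ^ 2) = 1"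
    using qpoch_odd_mult_uminus_self[OF n(1)] by (simp flip: power_mult)
  have 5: "qpoch (s ^ 6) (s ^ 12) * qpoch (- (s ^ 6)) (s ^ 6) = 1"
    using qpoch_odd_mult_uminus_self[OF n(3)] by (simp flip: power_mult)
  have 6: "qpoch (- (s ^ 2)) (s ^ 2) = qpoch (- (s ^ 2)) (s ^ 6) * qpoch (- (s ^ 4)) (s ^ 6) * qpoch (- (s ^ 6)) (s ^ 6)"
    using qpoch_split3[OF n(1), of "- (s ^ 2)"] by (simp flip: power_mult power_add)
  have 7: "theta (- (s ^ 4)) (s ^ 6) = qpoch (- (s ^ 4)) (s ^ 6) * qpoch (- (s ^ 2)) (s ^ 6) * euler_prod (s ^ 6)"
    using s power_diff[of s 4 6] by (simp add: theta_def)
  have "qpoch (s ^ 6) (s ^ 12) = qpoch (s ^ 2) (s ^ 4) * qpoch (- (s ^ 4)) (s ^ 6) * qpoch (- (s ^ 2)) (s ^ 6)"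
  proof -
    have nz: "qpoch (- (s ^ 6)) (s ^ 6) \<noteq> 0" using 5 by auto
    have "qpoch (s ^ 6) (s ^ 12) * qpoch (- (s ^ 6)) (s ^ 6) =
      (qpoch (s ^ 2) (s ^ 4) * qpoch (- (s ^ 4)) (s ^ 6) * qpoch (- (s ^ 2)) (s ^ 6)) * qpoch (- (s ^ 6)) (s ^ 6)"
      unfolding 5 using 4 6 by (simp add: mult_ac)
    with nz show ?thesis by (simp only: mult_cancel_right) auto
  qed
  then have "(theta (- (omega ^ 2 * s)) (s ^ 2) * c) * euler_prod (s ^ 3) = (qpoch s (s ^ 2) * c) * euler_prod (s ^ 2) * theta (- (s ^ 4)) (s ^ 6)"
    unfolding 1 2 E3 7 using 3 by (simp add: mult_ac)
  then have "c * (theta (- (omega ^ 2 * s)) (s ^ 2) * euler_prod (s ^ 3)) = c * (euler_prod s * theta (- (s ^ 4)) (s ^ 6))"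
    unfolding Es by (simp add: mult_ac)
  then show ?thesis using c by simp
qed

lemma theta_product_mod6_odd:
  assumes s: "norm s < 1" "s \<noteq> 0"
  shows "theta (- (omega ^ 2 * s ^ 2)) (s ^ 2) * euler_prod (s ^ 3) = - (omega ^ 2) * euler_prod s * theta (- (s ^ 5)) (s ^ 6)"
proof -
  define c where "c = qpoch (- (s ^ 2)) (s ^ 2)"
  define d where "d = qpoch (- (s ^ 3)) (s ^ 6)"
  have n: "norm (s ^ 2) < 1" "norm (s ^ 3) < 1" "norm (s ^ 6) < 1" "norm (s ^ 4) < 1"
    using s(1) by (auto intro: norm_power_less_1)
  have cd: "c \<noteq> 0" "d \<noteq> 0"
    unfolding c_def d_def using n by (intro qpoch_nonzero_ball; simp)+
  have "s ^ 2 / - (omega ^ 2 * s ^ 2) = - omega"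
    using one_div_omega(2) s by (simp add: power2_eq_square field_simps)
  then have "theta (- (omega ^ 2 * s ^ 2)) (s ^ 2) * c = (1 + omega) * (qpoch (- (s ^ 2)) (s ^ 2) * qpoch (omega * (- (s ^ 2))) (s ^ 2) * qpoch (omega ^ 2 * (- (s ^ 2))) (s ^ 2)) * euler_prod (s ^ 2)"
    by (simp add: theta_def c_def qpoch_rec[OF n(1), of "- omega"] mult_ac)
  also have "\<dots> = - (omega ^ 2) * qpoch (- (s ^ 6)) (s ^ 6) * euler_prod (s ^ 2)"
    using qpoch_omega[OF n(1), of "- (s ^ 2)"] by (simp add: omega_sq flip: power_mult)
  finally have 1: "theta (- (omega ^ 2 * s ^ 2)) (s ^ 2) * c = - (omega ^ 2) * qpoch (- (s ^ 6)) (s ^ 6) * euler_prod (s ^ 2)" .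
  have Es: "euler_prod s = qpoch s (s ^ 2) * euler_prod (s ^ 2)"
    using qpoch_split2[OF s(1), of s] by (simp add: power2_eq_square)
  have 2: "qpoch (- s) s = qpoch (- s) (s ^ 2) * c"
    using qpoch_split2[OF s(1), of "- s"] by (simp add: c_def power2_eq_square)
  have 3: "qpoch (- s) (s ^ 2) = qpoch (- s) (s ^ 6) * d * qpoch (- (s ^ 5)) (s ^ 6)"
    using qpoch_split3[OF n(1), of "- s"] by (simp add: d_def flip: power_mult power_add power_Suc)
  have 4: "qpoch s (s ^ 2) * qpoch (- s) s = 1"
    by (rule qpoch_odd_mult_uminus_self[OF s(1)])
  have "qpoch (- (s ^ 3)) (s ^ 3) = d * qpoch (- (s ^ 6)) (s ^ 6)"
    using qpoch_split2[OF n(2), of "- (s ^ 3)"] by (simp add: d_def flip: power_mult power_add)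
  then have 5: "euler_prod (s ^ 3) * d * qpoch (- (s ^ 6)) (s ^ 6) = euler_prod (s ^ 6)"
    using qpoch_uminus_self[OF n(2)] by (simp add: mult_ac flip: power_mult)
  have 6: "theta (- (s ^ 5)) (s ^ 6) = qpoch (- (s ^ 5)) (s ^ 6) * qpoch (- s) (s ^ 6) * euler_prod (s ^ 6)"
    using s power_diff[of s 5 6] by (simp add: theta_def)
  have "(theta (- (omega ^ 2 * s ^ 2)) (s ^ 2) * c) * d * euler_prod (s ^ 3) = - (omega ^ 2) * euler_prod (s ^ 2) * (euler_prod (s ^ 3) * d * qpoch (- (s ^ 6)) (s ^ 6))"
    unfolding 1 by (simp add: mult_ac)
  also have "\<dots> = - (omega ^ 2) * euler_prod (s ^ 2) * euler_prod (s ^ 6) * (qpoch s (s ^ 2) * qpoch (- s) s)"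
    unfolding 4 5 by simp
  also have "\<dots> = - (omega ^ 2) * euler_prod s * theta (- (s ^ 5)) (s ^ 6) * c * d"
    unfolding Es 2 3 6 by (simp add: mult_ac)
  finally have "(c * d) * (theta (- (omega ^ 2 * s ^ 2)) (s ^ 2) * euler_prod (s ^ 3)) = (c * d) * (- (omega ^ 2) * euler_prod s * theta (- (s ^ 5)) (s ^ 6))"
    by (simp only: mult_ac mult_minus_left mult_minus_right)
  then show ?thesis using cd by (simp only: mult_cancel_left mult_eq_0_iff) simp
qed


lemma triangle_double: "n * (n - 1) = 2 * (n * (n - 1) div 2)" for n :: int
  by (simp only: two_times_triangle)

lemma exponent_eqI: "2 * a = 2 * b \<Longrightarrow> q powi a = q powi b" for a b :: int and q :: complex
  by simp

text \<open>The exponents with even leading coefficient, written without the division.\<close>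

lemma theta_even_exponent:
  assumes "norm q < 1" "q \<noteq> 0" "z \<noteq> 0" "a > 0"
  shows "((\<lambda>n. (- z) powi n * q powi (int a * n ^ 2 + b * n)) has_sum theta (z * q powi (b + int a)) (q ^ (2 * a))) UNIV"
    and "((\<lambda>n. of_int n * ((- z) powi n * q powi (int a * n ^ 2 + b * n))) has_sum dtheta (z * q powi (b + int a)) (q ^ (2 * a))) UNIV"
proof -
  have e: "int (2 * a) * (n * (n - 1) div 2) + (b + int a) * n = int a * n ^ 2 + b * n" for n
    using two_times_triangle[of n] by (simp add: algebra_simps power2_eq_square)
  show "((\<lambda>n. (- z) powi n * q powi (int a * n ^ 2 + b * n)) has_sum theta (z * q powi (b + int a)) (q ^ (2 * a))) UNIV"
    "((\<lambda>n. of_int n * ((- z) powi n * q powi (int a * n ^ 2 + b * n))) has_sum dtheta (z * q powi (b + int a)) (q ^ (2 * a))) UNIV"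
    using theta_quadratic_exponent[OF assms(1-3), of "2 * a" "b + int a", unfolded e] assms(4) by simp_all
qed

lemma has_sum_diff:
  fixes f g :: "'a \<Rightarrow> complex"
  assumes "(f has_sum a) A" "(g has_sum b) A"
  shows "((\<lambda>x. f x - g x) has_sum (a - b)) A"
  using has_sum_add[OF assms(1), of "\<lambda>x. - g x" "- b"] assms(2) by (simp add: has_sum_uminus)

lemma omega_powi_minus: "(omega ^ 2) powi d = omega powi (- d)"
proof -
  have "omega ^ 2 = omega powi (- 1)"
    using one_div_omega(1) by (simp add: power_int_minus inverse_eq_divide)
  then show ?thesis by (simp only: power_int_mult[symmetric]) simp
qed

theorem eta_quotient_27_theta:
  assumes s: "norm s < 1" "s \<noteq> 0"
  obtains A1 A2 B1 B2 where
    "((\<lambda>n. of_int (2 * n - 1) * omega powi n * s powi (n ^ 2 - n)) has_sum A1) UNIV"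
    "((\<lambda>t. s powi (3 * t ^ 2 + t)) has_sum B1) UNIV"
    "((\<lambda>n. of_int (2 * n) * omega powi n * s powi (n ^ 2)) has_sum A2) UNIV"
    "((\<lambda>t. s powi (3 * t ^ 2 + 2 * t)) has_sum B2) UNIV"
    "(omega - 1) * (euler_prod s ^ 2 * euler_prod (s ^ 3) ^ 2) = A1 * B1 + omega ^ 2 * (A2 * B2)"
proof -
  define A1 where "A1 = 2 * dtheta (- omega * s powi 0) (s ^ 2) - theta (- omega * s powi 0) (s ^ 2)"
  define A2 where "A2 = 2 * dtheta (- omega * s) (s ^ 2)"
  define B1 where "B1 = theta (- (s ^ 4)) (s ^ 6)"
  define B2 where "B2 = theta (- (s ^ 5)) (s ^ 6)"
  define \<alpha> where "\<alpha> = theta (- (omega ^ 2 * s)) (s ^ 2)"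
  define \<beta> where "\<beta> = theta (- (omega ^ 2 * s ^ 2)) (s ^ 2)"
  have A1: "((\<lambda>n. of_int (2 * n - 1) * omega powi n * s powi (n ^ 2 - n)) has_sum A1) UNIV"
    using has_sum_diff[OF has_sum_cmult_right[OF theta_even_exponent(2)[OF s, of "- omega" 1 "-1"], of 2]
      theta_even_exponent(1)[OF s, of "- omega" 1 "-1"]]
    by (simp add: A1_def mult_ac left_diff_distrib right_diff_distrib)
  have A2: "((\<lambda>n. of_int (2 * n) * omega powi n * s powi (n ^ 2)) has_sum A2) UNIV"
    using has_sum_cmult_right[OF theta_even_exponent(2)[OF s, of "- omega" 1 0], of 2]
    by (simp add: A2_def mult_ac)
  have B1: "((\<lambda>t. s powi (3 * t ^ 2 + t)) has_sum B1) UNIV"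
    using theta_even_exponent(1)[OF s, of "- 1" 3 1] by (simp add: B1_def)
  have B2: "((\<lambda>t. s powi (3 * t ^ 2 + 2 * t)) has_sum B2) UNIV"
    using theta_even_exponent(1)[OF s, of "- 1" 3 2] by (simp add: B2_def)
  have \<alpha>: "((\<lambda>d. omega powi (- d) * s powi (d ^ 2)) has_sum \<alpha>) UNIV"
    using theta_even_exponent(1)[OF s, of "- (omega ^ 2)" 1 0] by (simp add: \<alpha>_def omega_powi_minus)
  have \<beta>: "((\<lambda>d. omega powi (- d) * s powi (d ^ 2 + d)) has_sum \<beta>) UNIV"
    using theta_even_exponent(1)[OF s, of "- (omega ^ 2)" 1 1] by (simp add: \<beta>_def omega_powi_minus)
  define t where "t i = (- 1) powi i * s powi (i * (i - 1) div 2) * 1 powi i" for i :: int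
  define t' where "t' j = (- 1) powi j * s powi (j * (j - 1) div 2) * omega powi j" for j :: int
  have t: "(t has_sum theta 1 s) UNIV" "((\<lambda>i. of_int i * t i) has_sum dtheta 1 s) UNIV"
    unfolding t_def using theta_expansion[OF s, of 1] dtheta_expansion[OF s, of 1] by simp_all
  have t': "(t' has_sum theta omega s) UNIV" "((\<lambda>i. of_int i * t' i) has_sum dtheta omega s) UNIV"
    unfolding t'_def using theta_expansion[OF s, of omega] dtheta_expansion[OF s, of omega]
    by (simp_all add: mult_ac)
  define F where "F = (\<lambda>(i, j). of_int (i + j - 1) * (t i * t' j))"
  have "((\<lambda>p. (case p of (i, j) \<Rightarrow> (of_int i * t i) * t' j) + (case p of (i, j) \<Rightarrow> t i * (of_int j * t' j))
      - (case p of (i, j) \<Rightarrow> t i * t' j)) has_sum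
      (dtheta 1 s * theta omega s + theta 1 s * dtheta omega s - theta 1 s * theta omega s)) UNIV"
    by (intro has_sum_diff has_sum_add has_sum_product t t')
  moreover have "(case p of (i, j) \<Rightarrow> (of_int i * t i) * t' j) + (case p of (i, j) \<Rightarrow> t i * (of_int j * t' j))
      - (case p of (i, j) \<Rightarrow> t i * t' j) = F p" for p
    by (cases p) (simp add: F_def algebra_simps)
  ultimately have F: "(F has_sum (dtheta 1 s * theta omega s)) UNIV"
    using s by simp
  have tt: "t i * t' j = (- 1) powi (i + j) * omega powi j * s powi (i * (i - 1) div 2 + j * (j - 1) div 2)" for i j
    using s by (simp add: t_def t'_def power_int_add)
  have Fe: "F (n + d, n - d) = (of_int (2 * n - 1) * omega powi n * s powi (n ^ 2 - n)) * (omega powi (- d) * s powi (d ^ 2))" for n d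
  proof -
    have "s powi ((n + d) * (n + d - 1) div 2 + (n - d) * (n - d - 1) div 2) = s powi ((n ^ 2 - n) + d ^ 2)"
      by (rule exponent_eqI) (simp add: distrib_left two_times_triangle, simp add: algebra_simps power2_eq_square)
    moreover have "omega powi (n - d) = omega powi n * omega powi (- d)"
      by (simp add: power_int_diff power_int_minus divide_inverse)
    moreover have "(- 1 :: complex) powi (n + d + (n - d)) = 1"
    proof -
      have e: "n + d + (n - d) = n + n" by simp
      show ?thesis unfolding e by (simp add: power_int_add power_int_mult_distrib[symmetric])
    qed
    moreover have "s powi ((n ^ 2 - n) + d ^ 2) = s powi (n ^ 2 - n) * s powi (d ^ 2)"
      using s by (simp add: power_int_add)
    ultimately show ?thesis
      unfolding F_def prod.case tt by (simp add: mult_ac)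
  qed
  have Fo: "F (n + d + 1, n - d) = (of_int (2 * n) * omega powi n * s powi (n ^ 2)) * (- 1 * (omega powi (- d) * s powi (d ^ 2 + d)))" for n d
  proof -
    have "s powi ((n + d + 1) * (n + d + 1 - 1) div 2 + (n - d) * (n - d - 1) div 2) = s powi (n ^ 2 + (d ^ 2 + d))"
      by (rule exponent_eqI) (simp only: distrib_left two_times_triangle, simp add: algebra_simps power2_eq_square)
    moreover have "omega powi (n - d) = omega powi n * omega powi (- d)"
      by (simp add: power_int_diff power_int_minus divide_inverse)
    moreover have "(- 1 :: complex) powi (n + d + 1 + (n - d)) = - 1"
    proof -
      have e: "n + d + 1 + (n - d) = (n + n) + 1" by simp
      show ?thesis unfolding e by (simp add: power_int_add power_int_mult_distrib[symmetric])
    qed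
    moreover have "s powi (n ^ 2 + (d ^ 2 + d)) = s powi (n ^ 2) * s powi (d ^ 2 + d)"
      using s by (simp add: power_int_add)
    ultimately show ?thesis
      unfolding F_def prod.case tt by (simp add: mult_ac)
  qed
  have "dtheta 1 s * theta omega s = A1 * \<alpha> + A2 * (- 1 * \<beta>)"
    by (rule has_sum_rotate_lattice[OF F Fe A1 \<alpha> Fo A2 has_sum_cmult_right[OF \<beta>]])
  then have *: "(omega - 1) * (euler_prod s ^ 3 * euler_prod (s ^ 3)) = A1 * \<alpha> - A2 * \<beta>"
    using s by (simp add: dtheta_1 theta_omega algebra_simps)
  have "euler_prod s * ((omega - 1) * (euler_prod s ^ 2 * euler_prod (s ^ 3) ^ 2)) = (A1 * \<alpha> - A2 * \<beta>) * euler_prod (s ^ 3)"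
    unfolding *[symmetric] by (simp only: power2_eq_square power3_eq_cube mult_ac)
  also have "\<dots> = A1 * (\<alpha> * euler_prod (s ^ 3)) - A2 * (\<beta> * euler_prod (s ^ 3))"
    by (simp add: algebra_simps)
  also have "\<dots> = euler_prod s * (A1 * B1 + omega ^ 2 * (A2 * B2))"
    unfolding \<alpha>_def \<beta>_def theta_product_mod6_even[OF s] theta_product_mod6_odd[OF s] B1_def B2_def
    by (simp add: algebra_simps)
  finally have "(omega - 1) * (euler_prod s ^ 2 * euler_prod (s ^ 3) ^ 2) = A1 * B1 + omega ^ 2 * (A2 * B2)"
    using qpoch_self_nonzero[OF s(1)] by (simp only: mult_cancel_left) auto
  with A1 A2 B1 B2 show ?thesis
    using that by blast
qed

lemma theta_logderiv:
  assumes q: "norm q < 1" and z: "z \<noteq> 0" and nz: "theta z q \<noteq> 0"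
  shows "summable (\<lambda>n. z * q ^ n / (1 - z * q ^ n))"
    and "summable (\<lambda>n. q / z * q ^ n / (1 - q / z * q ^ n))"
    and "dtheta z q / theta z q = (\<Sum>n. q / z * q ^ n / (1 - q / z * q ^ n)) - (\<Sum>n. z * q ^ n / (1 - z * q ^ n))"
proof -
  let ?Q = "\<lambda>a. qpoch a q"
  have nz': "?Q z \<noteq> 0" "?Q (q / z) \<noteq> 0" "?Q q \<noteq> 0"
    using nz by (auto simp: theta_def)
  have der: "(?Q has_field_derivative deriv ?Q a) (at a)" for a
    using qpoch_holomorphic[OF q, of UNIV] by (intro holomorphic_derivI[of _ UNIV]) auto
  have "((\<lambda>z. q / z) has_field_derivative (- q / z ^ 2)) (at z)"
    using z by (auto intro!: derivative_eq_intros simp: power2_eq_square)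
  with der have d2: "((\<lambda>z. ?Q (q / z)) has_field_derivative (deriv ?Q (q / z) * (- q / z ^ 2))) (at z)"
    by (rule DERIV_chain2[where f = ?Q])
  have "((\<lambda>z. theta z q) has_field_derivative
      ((deriv ?Q z * ?Q (q / z) + deriv ?Q (q / z) * (- q / z ^ 2) * ?Q z) * ?Q q)) (at z)"
    unfolding theta_def by (rule DERIV_cmult_right[OF DERIV_mult[OF der d2]])
  then have "dtheta z q = z * ((deriv ?Q z * ?Q (q / z) + deriv ?Q (q / z) * (- q / z ^ 2) * ?Q z) * ?Q q)"
    by (simp add: dtheta_def DERIV_imp_deriv)
  then have eq: "dtheta z q / theta z q = z * (deriv ?Q z / ?Q z) - q / z * (deriv ?Q (q / z) / ?Q (q / z))"
    using nz' z unfolding theta_def by (simp add: divide_simps power2_eq_square)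
  have s: "(\<lambda>n. a * q ^ n / (1 - a * q ^ n)) sums - (a * (deriv ?Q a / ?Q a))" if "?Q a \<noteq> 0" for a
    using sums_mult[OF qpoch_logderiv[OF q that], of "- a"] by simp
  from s[OF nz'(1)] s[OF nz'(2)] show "summable (\<lambda>n. z * q ^ n / (1 - z * q ^ n))"
    "summable (\<lambda>n. q / z * q ^ n / (1 - q / z * q ^ n))"
    by (auto simp: sums_iff)
  show "dtheta z q / theta z q = (\<Sum>n. q / z * q ^ n / (1 - q / z * q ^ n)) - (\<Sum>n. z * q ^ n / (1 - z * q ^ n))"
    unfolding eq using s[OF nz'(1)] s[OF nz'(2)] by (simp add: sums_iff)
qed


lemma norm_power_neq_1: "norm q < 1 \<Longrightarrow> n > 0 \<Longrightarrow> q ^ n \<noteq> 1" for q :: complex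
  using norm_power_less_1[of q n] by auto

lemma lambert_double_series:
  fixes q :: complex
  assumes q: "norm q < 1"
  shows "(\<Sum>n. (q ^ Suc n - (q ^ Suc n) ^ 2) / (1 - (q ^ Suc n) ^ 3)) =
    (\<Sum>m. q ^ (3 * m + 1) / (1 - q ^ (3 * m + 1)) - q ^ (3 * m + 2) / (1 - q ^ (3 * m + 2)))"
    (is "suminf ?a = suminf ?b")
    and "summable (\<lambda>n. (q ^ Suc n - (q ^ Suc n) ^ 2) / (1 - (q ^ Suc n) ^ 3))"
proof -
  define f where "f = (\<lambda>(n, m). q ^ (Suc n * (3 * m + 1)) - q ^ (Suc n * (3 * m + 2)))"
  have geo: "((\<lambda>n. x ^ Suc n) has_sum (x / (1 - x))) UNIV" if "norm x < 1" for x :: complex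
  proof -
    have "(\<lambda>n. x * x ^ n) sums (x * (1 / (1 - x)))"
      by (intro sums_mult geometric_sums that)
    moreover have "summable (\<lambda>n. norm (x * x ^ n))"
      using that by (simp add: norm_mult norm_power summable_geometric summable_mult)
    ultimately show ?thesis
      using norm_summable_imp_has_sum[of "\<lambda>n. x * x ^ n"] by simp
  qed
  have abs: "(\<lambda>p. norm (f p)) summable_on UNIV"
  proof (rule summable_on_comparison_test)
    have "((\<lambda>n. complex_of_real (norm q) ^ Suc n) has_sum (norm q / (1 - norm q))) UNIV"
      using geo[of "of_real (norm q)"] q by simp
    from has_sum_product[OF this this]
    have "(\<lambda>(x, y). complex_of_real (norm q) ^ Suc x * complex_of_real (norm q) ^ Suc y) summable_on UNIV"
      by (auto simp: summable_on_def)
    then have "(\<lambda>p. Re (case p of (x, y) \<Rightarrow> complex_of_real (norm q) ^ Suc x * complex_of_real (norm q) ^ Suc y)) summable_on UNIV"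
      by (rule summable_on_Re)
    then have "(\<lambda>(x, y). norm q ^ Suc x * norm q ^ Suc y) summable_on UNIV"
      by (simp add: case_prod_unfold flip: of_real_mult of_real_power)
    then show "(\<lambda>p. 2 / norm q * (case p of (x, y) \<Rightarrow> norm q ^ Suc x * norm q ^ Suc y)) summable_on UNIV"
      by (rule summable_on_cmult_right)
  next
    fix p :: "nat \<times> nat"
    obtain n m where p: "p = (n, m)" by (cases p)
    have le: "norm q ^ (Suc n * (3 * m + i)) \<le> norm q ^ (n + m + 1)" if "i \<ge> 1" for i
    proof (rule power_decreasing)
      have "Suc n * (3 * m + 1) \<le> Suc n * (3 * m + i)" using that by (intro mult_left_mono) auto
      then show "n + m + 1 \<le> Suc n * (3 * m + i)" by simp
    qed (use q in auto)
    have "norm (f p) \<le> norm q ^ (Suc n * (3 * m + 1)) + norm q ^ (Suc n * (3 * m + 2))"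
      unfolding f_def p prod.case norm_power[symmetric] by (rule norm_triangle_ineq4)
    also have "\<dots> \<le> 2 * norm q ^ (n + m + 1)"
      using le[of 1] le[of 2] by simp
    also have "\<dots> = 2 / norm q * (norm q ^ Suc n * norm q ^ Suc m)"
      by (cases "q = 0") (auto simp: power_add)
    finally show "norm (f p) \<le> 2 / norm q * (case p of (x, y) \<Rightarrow> norm q ^ Suc x * norm q ^ Suc y)"
      by (simp add: p)
  qed auto
  then have "f summable_on UNIV"
    by (rule Infinite_Sum.abs_summable_summable)
  then obtain S where S: "(f has_sum S) (UNIV \<times> UNIV)"
    by (auto simp: summable_on_def)
  have "(?a has_sum S) UNIV"
  proof (rule has_sum_SigmaD[OF S])
    fix n :: nat
    let ?t = "q ^ Suc n"
    have t: "norm ?t < 1" "norm (?t ^ 3) < 1" using q norm_power_less_1 by (blast, auto simp del: power_Suc intro!: norm_power_less_1)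
    have "(\<lambda>m. (?t - ?t ^ 2) * (?t ^ 3) ^ m) sums ((?t - ?t ^ 2) * (1 / (1 - ?t ^ 3)))"
      by (intro sums_mult geometric_sums t)
    moreover have "summable (\<lambda>m. norm ((?t - ?t ^ 2) * (?t ^ 3) ^ m))"
      using t(2) by (simp add: norm_mult norm_power summable_geometric summable_mult del: power_Suc)
    moreover have "(?t - ?t ^ 2) * (?t ^ 3) ^ m = f (n, m)" for m
    proof -
      have "(t - t ^ 2) * (t ^ 3) ^ m = t ^ (3 * m + 1) - t ^ (3 * m + 2)" for t :: complex
      proof -
        have "t ^ (3 * m + 1) = t * (t ^ 3) ^ m" "t ^ (3 * m + 2) = t ^ 2 * (t ^ 3) ^ m"
          by (simp_all only: power_add power_mult power_one_right mult.commute[of "(t ^ 3) ^ m"])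
        then show ?thesis by (simp only: left_diff_distrib)
      qed
      then show ?thesis
        by (simp only: f_def prod.case power_mult)
    qed
    ultimately show "((\<lambda>y. f (n, y)) has_sum ?a n) UNIV"
      using norm_summable_imp_has_sum[of "\<lambda>m. f (n, m)"] by simp
  qed
  then have a: "?a sums S" by (rule has_sum_imp_sums)
  have "((\<lambda>(m, n). f (n, m)) has_sum S) (UNIV \<times> UNIV)"
    using S by (subst (asm) has_sum_swap) simp
  then have "(?b has_sum S) UNIV"
  proof (rule has_sum_SigmaD)
    fix m :: nat
    have 1: "((\<lambda>n. (q ^ (3 * m + 1)) ^ Suc n) has_sum (q ^ (3 * m + 1) / (1 - q ^ (3 * m + 1)))) UNIV"
      by (rule geo) (rule norm_power_less_1[OF q], simp)
    have 2: "((\<lambda>n. (q ^ (3 * m + 2)) ^ Suc n) has_sum (q ^ (3 * m + 2) / (1 - q ^ (3 * m + 2)))) UNIV"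
      by (rule geo) (rule norm_power_less_1[OF q], simp)
    show "((\<lambda>y. case (m, y) of (m, n) \<Rightarrow> f (n, m)) has_sum ?b m) UNIV"
      using has_sum_diff[OF 1 2]
      by (simp only: f_def prod.case power_mult[symmetric] mult.commute[of "3 * m + 1"] mult.commute[of "3 * m + 2"])
  qed
  then have "?b sums S" by (rule has_sum_imp_sums)
  with a show "suminf ?a = suminf ?b" "summable ?a"
    by (auto simp: sums_iff)
qed

lemma lambert_identity:
  assumes q: "norm q < 1" "q \<noteq> 0"
  shows "(2 * dtheta omega q - theta omega q) * euler_prod q =
    omega ^ 2 * (6 * dtheta (q ^ 2) (q ^ 3) + theta (q ^ 2) (q ^ 3)) * euler_prod (q ^ 3)"
proof -
  define L where "L = (\<Sum>n. (q ^ Suc n - (q ^ Suc n) ^ 2) / (1 - (q ^ Suc n) ^ 3))"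
  have q3: "norm (q ^ 3) < 1" using q by (auto intro: norm_power_less_1)
  have t1: "theta omega q \<noteq> 0"
    using qpoch_self_nonzero[OF q3] by (simp add: theta_omega[OF q(1)])
  have t2: "theta (q ^ 2) (q ^ 3) \<noteq> 0"
    using qpoch_self_nonzero[OF q(1)] by (simp add: euler_prod_pentagonal[OF q, symmetric])
  have d2: "dtheta (q ^ 2) (q ^ 3) / theta (q ^ 2) (q ^ 3) = L"
  proof -
    have "q ^ 3 / q ^ 2 = q" using q power_diff[of q 2 3] by simp
    note ld = theta_logderiv[OF q3 _ t2, unfolded this]
    have "L = (\<Sum>m. q ^ (3 * m + 1) / (1 - q ^ (3 * m + 1)) - q ^ (3 * m + 2) / (1 - q ^ (3 * m + 2)))"
      unfolding L_def by (rule lambert_double_series(1)[OF q(1)])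
    also have "\<dots> = (\<Sum>m. q * (q ^ 3) ^ m / (1 - q * (q ^ 3) ^ m) - q ^ 2 * (q ^ 3) ^ m / (1 - q ^ 2 * (q ^ 3) ^ m))"
    proof -
      have "q ^ (3 * m + 1) = q * (q ^ 3) ^ m" "q ^ (3 * m + 2) = q ^ 2 * (q ^ 3) ^ m" for m
        by (simp_all only: power_add power_mult power_one_right mult.commute[of "(q ^ 3) ^ m"])
      then show ?thesis by (simp only:)
    qed
    also have "\<dots> = (\<Sum>m. q * (q ^ 3) ^ m / (1 - q * (q ^ 3) ^ m)) - (\<Sum>m. q ^ 2 * (q ^ 3) ^ m / (1 - q ^ 2 * (q ^ 3) ^ m))"
      using ld(1,2) q by (intro suminf_diff[symmetric]) auto
    finally show ?thesis using ld(3) q by simp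
  qed
  have "1 - omega \<noteq> 0" by (metis omega_neq_1 right_minus_eq)
  have d1: "dtheta omega q / theta omega q = (omega ^ 2 - omega) * L - omega / (1 - omega)"
  proof -
    have e: "q / omega = omega ^ 2 * q" using one_div_omega(1) by (simp add: divide_inverse)
    note ld = theta_logderiv[OF q(1) omega_nonzero t1, unfolded e]
    have s: "summable (\<lambda>n. omega * q ^ Suc n / (1 - omega * q ^ Suc n))"
      using summable_Suc_iff[of "\<lambda>n. omega * q ^ n / (1 - omega * q ^ n)"] ld(1) by (simp del: power_Suc)
    have "dtheta omega q / theta omega q = (\<Sum>n. omega ^ 2 * q * q ^ n / (1 - omega ^ 2 * q * q ^ n)) -
      (omega / (1 - omega) + (\<Sum>n. omega * q ^ Suc n / (1 - omega * q ^ Suc n)))"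
      unfolding ld(3) suminf_split_head[OF ld(1)] by simp
    also have "\<dots> = (\<Sum>n. omega ^ 2 * q * q ^ n / (1 - omega ^ 2 * q * q ^ n) - omega * q ^ Suc n / (1 - omega * q ^ Suc n)) - omega / (1 - omega)"
      using suminf_diff[OF ld(2) s] by simp
    also have "(\<lambda>n. omega ^ 2 * q * q ^ n / (1 - omega ^ 2 * q * q ^ n) - omega * q ^ Suc n / (1 - omega * q ^ Suc n))
      = (\<lambda>n. (omega ^ 2 - omega) * ((q ^ Suc n - (q ^ Suc n) ^ 2) / (1 - (q ^ Suc n) ^ 3)))"
    proof
      fix n
      define t where "t = q ^ Suc n"
      have n: "norm t < 1" unfolding t_def by (rule norm_power_less_1[OF q(1)]) simp
      have "norm (omega ^ 2 * t) < 1" "norm (omega * t) < 1"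
        using n by (simp_all add: norm_mult norm_power)
      then have nz: "1 - omega ^ 2 * t \<noteq> 0" "1 - omega * t \<noteq> 0" "1 - t ^ 3 \<noteq> 0"
        using norm_power_neq_1[OF n, of 3] by auto
      have f: "1 - t ^ 3 = (1 - omega ^ 2 * t) * (1 - omega * t) * (1 - t)"
      proof -
        have "(1 - omega ^ 2 * t) * (1 - omega * t) * (1 - t) = 1 - (1 + omega + omega ^ 2) * t + (omega + omega ^ 2 + omega ^ 3) * t ^ 2 - omega ^ 3 * t ^ 3"
          by (simp add: algebra_simps eval_nat_numeral)
        then show ?thesis by (simp add: omega_cube omega_sq)
      qed
      have "omega ^ 2 * t / (1 - omega ^ 2 * t) - omega * t / (1 - omega * t)
        = (omega ^ 2 - omega) * t / ((1 - omega ^ 2 * t) * (1 - omega * t))"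
      proof -
        have "a / (1 - a) - b / (1 - b) = (a - b) / ((1 - a) * (1 - b))" if "1 - a \<noteq> 0" "1 - b \<noteq> 0" for a b :: complex
          using that by (simp add: diff_frac_eq) (simp add: algebra_simps)
        from this[OF nz(1,2)] show ?thesis by (simp only: left_diff_distrib)
      qed
      also have "\<dots> = (omega ^ 2 - omega) * (t * (1 - t)) / (1 - t ^ 3)"
        using nz(3) unfolding f by simp
      also have "t * (1 - t) = t - t ^ 2" by (simp add: right_diff_distrib power2_eq_square)
      finally have "omega ^ 2 * t / (1 - omega ^ 2 * t) - omega * t / (1 - omega * t) =
        (omega ^ 2 - omega) * ((t - t ^ 2) / (1 - t ^ 3))"
        by (simp only: times_divide_eq_right)
      moreover have "omega ^ 2 * q * q ^ n = omega ^ 2 * t" by (simp add: t_def)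
      ultimately show "omega ^ 2 * q * q ^ n / (1 - omega ^ 2 * q * q ^ n) - omega * q ^ Suc n / (1 - omega * q ^ Suc n)
        = (omega ^ 2 - omega) * ((q ^ Suc n - (q ^ Suc n) ^ 2) / (1 - (q ^ Suc n) ^ 3))"
        by (simp only: t_def)
    qed
    also have "suminf \<dots> = (omega ^ 2 - omega) * L"
      unfolding L_def by (rule suminf_mult[OF lambert_double_series(2)[OF q(1)]])
    finally show ?thesis .
  qed
  have "(2 * dtheta omega q - theta omega q) * euler_prod q
      = theta omega q * (2 * (dtheta omega q / theta omega q) - 1) * euler_prod q"
    using t1 by (simp add: field_simps)
  also have "\<dots> = (1 - omega) * (2 * ((omega ^ 2 - omega) * L - omega / (1 - omega)) - 1) * euler_prod (q ^ 3) * euler_prod q"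
    by (simp only: d1) (simp only: theta_omega[OF q(1)] mult_ac)
  also have "(1 - omega) * (2 * ((omega ^ 2 - omega) * L - omega / (1 - omega)) - 1) = omega ^ 2 * (6 * L + 1)"
  proof -
    have "(1 - omega) * (2 * ((omega ^ 2 - omega) * L - omega / (1 - omega)) - 1)
      = 2 * ((1 - omega) * (omega ^ 2 - omega)) * L - (1 + omega)"
      using \<open>1 - omega \<noteq> 0\<close> by (simp add: divide_simps)
    also have "(1 - omega) * (omega ^ 2 - omega) = 3 * omega ^ 2"
    proof -
      have "(1 - omega) * (omega ^ 2 - omega) = 2 * omega ^ 2 - omega - omega ^ 3" by (simp add: algebra_simps eval_nat_numeral)
      then show ?thesis by (simp add: omega_cube omega_sq)
    qed
    finally show ?thesis by (simp add: omega_sq algebra_simps)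
  qed
  also have "omega ^ 2 * (6 * L + 1) * euler_prod (q ^ 3) * euler_prod q
    = omega ^ 2 * (6 * (L * theta (q ^ 2) (q ^ 3)) + theta (q ^ 2) (q ^ 3)) * euler_prod (q ^ 3)"
    by (simp only: euler_prod_pentagonal[OF q]) (simp only: distrib_left distrib_right mult_ac mult_1)
  also have "L * theta (q ^ 2) (q ^ 3) = dtheta (q ^ 2) (q ^ 3)"
    using t2 unfolding d2[symmetric] by simp
  finally show ?thesis .
qed


lemma jacobi_cube_parity:
  assumes q: "norm q < 1" "q \<noteq> 0"
  shows "((\<lambda>d. of_int (4 * d + 1) * q powi (2 * d ^ 2 + d)) has_sum (euler_prod q ^ 3)) UNIV"
    and "((\<lambda>d. of_int (- (4 * d + 3)) * q powi (2 * d ^ 2 + 3 * d + 1)) has_sum (euler_prod q ^ 3)) UNIV"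
    and "((\<lambda>d. (- 1) powi d * of_int (2 * d + 1) * q powi (d * (d + 1) div 2)) has_sum (2 * euler_prod q ^ 3)) UNIV"
proof -
  define V where "V = 4 * dtheta (- 1 * q powi (1 + int 2)) (q ^ (2 * 2)) + theta (- 1 * q powi (1 + int 2)) (q ^ (2 * 2))"
  have V: "((\<lambda>d. of_int (4 * d + 1) * q powi (2 * d ^ 2 + d)) has_sum V) UNIV"
    using has_sum_add[OF has_sum_cmult_right[OF theta_even_exponent(2)[OF q, of "- 1" 2 1], of 4]
        theta_even_exponent(1)[OF q, of "- 1" 2 1]]
    by (simp add: V_def distrib_right mult.assoc)
  have b: "bij_betw (\<lambda>d :: int. - 1 - d) UNIV UNIV"
    by (rule bij_betwI[where g = "\<lambda>d. - 1 - d"]) auto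
  have V': "((\<lambda>d. of_int (- (4 * d + 3)) * q powi (2 * d ^ 2 + 3 * d + 1)) has_sum V) UNIV"
  proof -
    have "of_int (4 * (- 1 - d) + 1) * q powi (2 * (- 1 - d) ^ 2 + (- 1 - d)) =
      of_int (- (4 * d + 3)) * q powi (2 * d ^ 2 + 3 * d + 1)" for d
    proof -
      have "4 * (- 1 - d) + 1 = - (4 * d + 3)" "2 * (- 1 - d) ^ 2 + (- 1 - d) = 2 * d ^ 2 + 3 * d + 1"
        by (simp_all add: power2_eq_square algebra_simps)
      then show ?thesis by (simp only:)
    qed
    then show ?thesis
      using has_sum_reindex_bij_betw[OF b, of "\<lambda>d. of_int (4 * d + 1) * q powi (2 * d ^ 2 + d)" V] V
      by (simp only:)
  qed
  define f where "f n = 2 * (of_int n * ((- 1) powi n * q powi (n * (n - 1) div 2))) - (- 1) powi n * q powi (n * (n - 1) div 2)"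
    for n :: int
  have "dtheta 1 q = - (euler_prod q ^ 3)" "theta 1 q = 0"
    using q by (simp_all add: dtheta_1)
  with has_sum_diff[OF has_sum_cmult_right[OF dtheta_expansion[OF q, of 1], of 2] theta_expansion[OF q, of 1]]
  have "(f has_sum - (2 * euler_prod q ^ 3)) UNIV"
    by (simp add: f_def[abs_def])
  moreover have b': "bij_betw (\<lambda>d :: int. d + 1) UNIV UNIV"
    by (rule bij_betwI[where g = "\<lambda>d. d - 1"]) auto
  ultimately have "((\<lambda>d. f (d + 1)) has_sum - (2 * euler_prod q ^ 3)) UNIV"
    using has_sum_reindex_bij_betw[OF b', of f] by blast
  moreover have "f (d + 1) = - ((- 1) powi d * of_int (2 * d + 1) * q powi (d * (d + 1) div 2))" for d
  proof -
    have "(d + 1) * (d + 1 - 1) = d * (d + 1)" by simp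
    moreover have "(- 1 :: complex) powi (d + 1) = - ((- 1) powi d)" by (simp add: power_int_add)
    ultimately show ?thesis
      unfolding f_def by (simp only:) (simp add: algebra_simps)
  qed
  ultimately have "((\<lambda>d. - ((- 1) powi d * of_int (2 * d + 1) * q powi (d * (d + 1) div 2))) has_sum - (2 * euler_prod q ^ 3)) UNIV"
    by (simp only:)
  then show J: "((\<lambda>d. (- 1) powi d * of_int (2 * d + 1) * q powi (d * (d + 1) div 2)) has_sum (2 * euler_prod q ^ 3)) UNIV"
    by (simp only: has_sum_uminus minus_minus)
  have "2 * euler_prod q ^ 3 = V + V"
  proof (rule has_sum_parity_split[OF J])
    have e: "q powi (2 * d * (2 * d + 1) div 2) = q powi (2 * d ^ 2 + d)"
      "q powi ((2 * d + 1) * (2 * d + 1 + 1) div 2) = q powi (2 * d ^ 2 + 3 * d + 1)" for d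
    proof -
      have "2 * d * (2 * d + 1) = 2 * (2 * d ^ 2 + d)" "(2 * d + 1) * (2 * d + 1 + 1) = 2 * (2 * d ^ 2 + 3 * d + 1)"
        by (simp_all add: power2_eq_square algebra_simps)
      then show "q powi (2 * d * (2 * d + 1) div 2) = q powi (2 * d ^ 2 + d)"
        "q powi ((2 * d + 1) * (2 * d + 1 + 1) div 2) = q powi (2 * d ^ 2 + 3 * d + 1)" by simp_all
    qed
    have m: "(- 1 :: complex) powi (2 * d) = 1" for d
      by (simp add: power_int_mult)
    show "((\<lambda>n. (- 1) powi (2 * n) * of_int (2 * (2 * n) + 1) * q powi (2 * n * (2 * n + 1) div 2)) has_sum V) UNIV"
      unfolding e m using V by simp
    have m': "(- 1 :: complex) powi (2 * d + 1) = - 1" for d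
      by (simp add: power_int_add m)
    show "((\<lambda>n. (- 1) powi (2 * n + 1) * of_int (2 * (2 * n + 1) + 1) * q powi ((2 * n + 1) * (2 * n + 1 + 1) div 2)) has_sum V) UNIV"
      unfolding e m' using V' by (simp add: algebra_simps)
  qed
  then have "V = euler_prod q ^ 3" by simp
  with V V' show "((\<lambda>d. of_int (4 * d + 1) * q powi (2 * d ^ 2 + d)) has_sum (euler_prod q ^ 3)) UNIV"
    "((\<lambda>d. of_int (- (4 * d + 3)) * q powi (2 * d ^ 2 + 3 * d + 1)) has_sum (euler_prod q ^ 3)) UNIV"
    by simp_all
qed

lemma theta_wronskian:
  assumes q: "norm q < 1" "q \<noteq> 0" and x: "x \<noteq> 0"
  shows "2 * (dtheta (x * q) (q ^ 2) * theta x (q ^ 2)) - 2 * (theta (x * q) (q ^ 2) * dtheta x (q ^ 2))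
    + theta (x * q) (q ^ 2) * theta x (q ^ 2) = euler_prod q ^ 3 * theta (- x) q"
proof -
  define a where "a w = (- x) powi w * q powi (w ^ 2)" for w :: int
  define c where "c v = (- x) powi v * q powi (v ^ 2 - v)" for v :: int
  have a: "(a has_sum theta (x * q) (q ^ 2)) UNIV" "((\<lambda>w. of_int w * a w) has_sum dtheta (x * q) (q ^ 2)) UNIV"
    unfolding a_def using theta_even_exponent[OF q x, of 1 0] by simp_all
  have c: "(c has_sum theta x (q ^ 2)) UNIV" "((\<lambda>v. of_int v * c v) has_sum dtheta x (q ^ 2)) UNIV"
    unfolding c_def using theta_even_exponent[OF q x, of 1 "-1"] by simp_all
  define F where "F = (\<lambda>(w, v). of_int (2 * w - 2 * v + 1) * (a w * c v))"
  have "((\<lambda>p. 2 * (case p of (w, v) \<Rightarrow> (of_int w * a w) * c v) - 2 * (case p of (w, v) \<Rightarrow> a w * (of_int v * c v))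
      + (case p of (w, v) \<Rightarrow> a w * c v)) has_sum
      (2 * (dtheta (x * q) (q ^ 2) * theta x (q ^ 2)) - 2 * (theta (x * q) (q ^ 2) * dtheta x (q ^ 2))
    + theta (x * q) (q ^ 2) * theta x (q ^ 2))) UNIV" (is "(_ has_sum ?S) _")
    by (intro has_sum_diff has_sum_add has_sum_cmult_right has_sum_product a c)
  moreover have "2 * (case p of (w, v) \<Rightarrow> (of_int w * a w) * c v) - 2 * (case p of (w, v) \<Rightarrow> a w * (of_int v * c v))
      + (case p of (w, v) \<Rightarrow> a w * c v) = F p" for p
    by (cases p) (simp add: F_def algebra_simps)
  ultimately have F: "(F has_sum ?S) UNIV" by simp
  have ac: "a w * c v = (- x) powi (w + v) * q powi (w ^ 2 + (v ^ 2 - v))" for w v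
    using q x by (simp add: a_def c_def power_int_add)
  define u where "u n = x powi (2 * n) * q powi (2 * n ^ 2 - n)" for n :: int
  define u' where "u' n = x powi (2 * n + 1) * q powi (2 * n ^ 2 + n)" for n :: int
  have m: "(- x) powi (n + n) = x powi (2 * n)" for n
    using x by (simp add: power_int_mult)
  have m': "(- x) powi (n + n + 1) = - (x powi (2 * n + 1))" for n
    using x by (simp add: power_int_add m)
  have Fe: "F (n + d, n - d) = u n * (of_int (4 * d + 1) * q powi (2 * d ^ 2 + d))" for n d
  proof -
    have e: "(n + d) ^ 2 + ((n - d) ^ 2 - (n - d)) = (2 * n ^ 2 - n) + (2 * d ^ 2 + d)" "n + d + (n - d) = n + n"
      "2 * (n + d) - 2 * (n - d) + 1 = 4 * d + 1"
      by (simp_all add: power2_eq_square algebra_simps)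
    have "q powi ((2 * n ^ 2 - n) + (2 * d ^ 2 + d)) = q powi (2 * n ^ 2 - n) * q powi (2 * d ^ 2 + d)"
      using q by (intro power_int_add) auto
    then show ?thesis
      unfolding F_def prod.case ac e m u_def by (simp only: mult_ac)
  qed
  have Fo: "F (n + d + 1, n - d) = u' n * (of_int (- (4 * d + 3)) * q powi (2 * d ^ 2 + 3 * d + 1))" for n d
  proof -
    have e: "(n + d + 1) ^ 2 + ((n - d) ^ 2 - (n - d)) = (2 * n ^ 2 + n) + (2 * d ^ 2 + 3 * d + 1)"
      "n + d + 1 + (n - d) = n + n + 1" "2 * (n + d + 1) - 2 * (n - d) + 1 = 4 * d + 3"
      by (simp_all add: power2_eq_square algebra_simps)
    have "q powi ((2 * n ^ 2 + n) + (2 * d ^ 2 + 3 * d + 1)) = q powi (2 * n ^ 2 + n) * q powi (2 * d ^ 2 + 3 * d + 1)"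
      using q by (intro power_int_add) auto
    then show ?thesis
      unfolding F_def prod.case ac e m' u'_def of_int_minus by (simp only: mult_ac mult_minus_left mult_minus_right)
  qed
  obtain U where U: "(u has_sum U) UNIV"
    using theta_even_exponent(1)[OF q, of "- (x ^ 2)" 2 "-1"] x by (auto simp: u_def[abs_def] power_int_mult)
  obtain U' where U': "(u' has_sum U') UNIV"
  proof -
    have "x powi (2 * n + 1) = x * (x ^ 2) powi n" for n
      using x by (simp add: power_int_mult power_int_add)
    then show ?thesis
      using has_sum_cmult_right[OF theta_even_exponent(1)[OF q, of "- (x ^ 2)" 2 1], of x] x that
      by (simp add: u'_def[abs_def] mult.assoc)
  qed
  have "?S = U * euler_prod q ^ 3 + U' * euler_prod q ^ 3"
    by (rule has_sum_rotate_lattice[OF F Fe U jacobi_cube_parity(1)[OF q] Fo U' jacobi_cube_parity(2)[OF q]])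
  moreover have "((\<lambda>n. x powi n * q powi (n * (n - 1) div 2)) has_sum theta (- x) q) UNIV"
    using jacobi_triple_product[OF q, of "- x"] x by simp
  then have "theta (- x) q = U + U'"
  proof (rule has_sum_parity_split)
    have e: "2 * n * (2 * n - 1) div 2 = 2 * n ^ 2 - n" "(2 * n + 1) * (2 * n + 1 - 1) div 2 = 2 * n ^ 2 + n" for n :: int
    proof -
      have "2 * n * (2 * n - 1) = 2 * (2 * n ^ 2 - n)" "(2 * n + 1) * (2 * n + 1 - 1) = 2 * (2 * n ^ 2 + n)"
        by (simp_all add: power2_eq_square algebra_simps)
      then show "2 * n * (2 * n - 1) div 2 = 2 * n ^ 2 - n" "(2 * n + 1) * (2 * n + 1 - 1) div 2 = 2 * n ^ 2 + n"
        by simp_all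
    qed
    show "((\<lambda>n. x powi (2 * n) * q powi (2 * n * (2 * n - 1) div 2)) has_sum U) UNIV"
      unfolding e using U by (simp add: u_def[abs_def])
    show "((\<lambda>n. x powi (2 * n + 1) * q powi ((2 * n + 1) * (2 * n + 1 - 1) div 2)) has_sum U') UNIV"
      unfolding e using U' by (simp add: u'_def[abs_def])
  qed
  ultimately show ?thesis by (simp add: algebra_simps)
qed

theorem eta_quotient_432_theta:
  assumes q: "norm q < 1" "q \<noteq> 0"
  shows "euler_prod q ^ 5 = euler_prod (q ^ 3) *
     (theta (omega * q) (q ^ 2) * (6 * dtheta (q ^ 4) (q ^ 6) + theta (q ^ 4) (q ^ 6))
      - 2 * (omega - omega ^ 2) * (theta (q ^ 4) (q ^ 6) * dtheta (omega * q) (q ^ 2)))"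
proof -
  define A DA where "A = theta (omega * q) (q ^ 2)" and "DA = dtheta (omega * q) (q ^ 2)"
  define P where "P = 6 * dtheta (q ^ 4) (q ^ 6) + theta (q ^ 4) (q ^ 6)"
  define H where "H = 2 * dtheta omega (q ^ 2) - theta omega (q ^ 2)"
  define E1 E2 E3 E6 where "E1 = euler_prod q" and "E2 = euler_prod (q ^ 2)" and "E3 = euler_prod (q ^ 3)" and "E6 = euler_prod (q ^ 6)"
  have n: "norm (q ^ 2) < 1" "q ^ 2 \<noteq> 0" "norm (q ^ 6) < 1"
    using q by (auto intro!: norm_power_less_1)
  have E6: "E6 \<noteq> 0" unfolding E6_def by (rule qpoch_self_nonzero[OF n(3)])
  have pent: "theta (q ^ 4) (q ^ 6) = E2"
    using euler_prod_pentagonal[OF n(1,2)] by (simp add: E2_def flip: power_mult)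
  have lam: "H * E2 = omega ^ 2 * P * E6"
    using lambert_identity[OF n(1,2)] by (simp add: H_def P_def E2_def E6_def flip: power_mult)
  have C: "theta omega (q ^ 2) = (1 - omega) * E6"
    using theta_omega[OF n(1)] by (simp add: E6_def flip: power_mult)
  have mo: "theta (- omega) q * E2 * E3 = - (omega ^ 2) * E6 * E1 ^ 2"
    using theta_uminus_omega[OF q(1)] by (simp add: E1_def E2_def E3_def E6_def)
  have "2 * DA * theta omega (q ^ 2) - A * H = E1 ^ 3 * theta (- omega) q"
    using theta_wronskian[OF q, of omega] by (simp add: A_def DA_def H_def E1_def algebra_simps)
  then have "(2 * DA * theta omega (q ^ 2) - A * H) * E2 * E3 = E1 ^ 3 * theta (- omega) q * E2 * E3"
    by simp
  also have "\<dots> = E1 ^ 3 * (theta (- omega) q * E2 * E3)" by simp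
  also have "\<dots> = - (omega ^ 2) * E6 * E1 ^ 5"
    unfolding mo by (simp add: eval_nat_numeral)
  also have "(2 * DA * theta omega (q ^ 2) - A * H) * E2 * E3 = 2 * (1 - omega) * DA * E6 * E2 * E3 - A * (H * E2) * E3"
    unfolding C by (simp add: algebra_simps)
  also have "\<dots> = - (omega ^ 2) * E6 * (E3 * (A * P - 2 * (omega - omega ^ 2) * (E2 * DA)))"
  proof -
    have "omega ^ 2 * (omega - omega ^ 2) = 1 - omega"
    proof -
      have "omega ^ 2 * (omega - omega ^ 2) = omega ^ 3 - omega ^ 3 * omega" by (simp add: algebra_simps eval_nat_numeral)
      then show ?thesis by (simp add: omega_cube)
    qed
    then have "2 * (1 - omega) * DA * E6 * E2 * E3 = 2 * (omega ^ 2 * (omega - omega ^ 2)) * DA * E6 * E2 * E3" by simp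
    then show ?thesis unfolding lam by (simp add: algebra_simps)
  qed
  finally have "- (omega ^ 2) * E6 * E1 ^ 5 = - (omega ^ 2) * E6 * (E3 * (A * P - 2 * (omega - omega ^ 2) * (E2 * DA)))"
    by (rule sym)
  then have "E1 ^ 5 = E3 * (A * P - 2 * (omega - omega ^ 2) * (E2 * DA))"
    using E6 by (simp only: mult_cancel_left) auto
  then show ?thesis
    by (simp only: A_def DA_def P_def E1_def E3_def pent)
qed


lemma fourier_coeff_eqI:
  assumes a: "\<And>\<tau>. Im \<tau> > 0 \<Longrightarrow> (\<lambda>n. a n * exp (2 * complex_of_real pi * \<i> * \<tau>) ^ n) sums f \<tau>"
  shows "fourier_coeff f = a"
  unfolding fourier_coeff_def
proof (rule the_equality)
  show "\<forall>\<tau>. Im \<tau> > 0 \<longrightarrow> (\<lambda>n. a n * exp (2 * complex_of_real pi * \<i> * \<tau>) ^ n) sums f \<tau>"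
    using a by blast
next
  fix b assume b: "\<forall>\<tau>. Im \<tau> > 0 \<longrightarrow> (\<lambda>n. b n * exp (2 * complex_of_real pi * \<i> * \<tau>) ^ n) sums f \<tau>"
  \<comment> \<open>The factor \<open>x\<close> makes the difference series vanish at the puncture \<open>0\<close> as well.\<close>
  define d where "d n = (case n of 0 \<Rightarrow> 0 | Suc m \<Rightarrow> b m - a m)" for n
  have d: "(\<lambda>n. d n * (x - 0) ^ n) sums 0" if x: "norm (x - 0) < 1" for x
  proof (cases "x = 0")
    case True
    have "(\<lambda>n. d n * 0 ^ n) sums (\<Sum>n\<in>{0}. d n * 0 ^ n)"
      by (rule sums_finite) (auto simp: d_def split: nat.splits)
    then show ?thesis using True by (simp add: d_def)
  next
    case False
    define \<tau> where "\<tau> = Ln x / (2 * complex_of_real pi * \<i>)"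
    have e: "exp (2 * complex_of_real pi * \<i> * \<tau>) = x"
      using False by (simp add: \<tau>_def)
    have "Im \<tau> = - ln (norm x) / (2 * pi)"
      using False by (simp add: \<tau>_def Im_divide Re_Ln power2_eq_square field_simps)
    moreover have "ln (norm x) < 0"
      using x False by simp
    ultimately have "Im \<tau> > 0"
      by (simp add: divide_neg_pos)
    then have "(\<lambda>n. b n * x ^ n - a n * x ^ n) sums (f \<tau> - f \<tau>)"
      using a[of \<tau>] b[rule_format, of \<tau>] unfolding e by (intro sums_diff)
    then have "(\<lambda>n. x * (b n * x ^ n - a n * x ^ n)) sums (x * 0)"
      by (intro sums_mult) simp
    then have "(\<lambda>n. d (Suc n) * x ^ Suc n) sums 0"
      by (simp add: d_def algebra_simps)
    then show ?thesis
      using sums_Suc[of "\<lambda>n. d n * x ^ n" 0] by (simp add: d_def)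
  qed
  show "b = a"
  proof
    fix m
    show "b m = a m"
    proof (rule ccontr)
      assume "b m \<noteq> a m"
      then have "d (Suc m) \<noteq> 0" by (simp add: d_def)
      from powser_0_nonzero[of 1 0 d "\<lambda>_. 0" "Suc m", OF _ d _ this]
      obtain s :: real where s: "s > 0" "\<And>z :: complex. z \<in> cball 0 s - {0} \<Longrightarrow> (0 :: complex) \<noteq> 0"
        by auto
      show False
        using s(2)[of "of_real s"] s(1) by auto
    qed
  qed
qed

text \<open>Collecting the terms with equal exponent.\<close>

lemma has_sum_imp_power_series:
  fixes c :: "'i \<Rightarrow> complex" and E :: "'i \<Rightarrow> nat"
  assumes "((\<lambda>i. c i * x ^ E i) has_sum S) UNIV" "x \<noteq> 0"
  shows "(\<lambda>n. infsum c {i. E i = n} * x ^ n) sums S"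
proof (rule has_sum_imp_sums)
  have "((\<lambda>(n, i). c i * x ^ n) has_sum S) (Sigma UNIV (\<lambda>n. {i. E i = n}))"
  proof -
    have "(\<lambda>i. (E i, i)) ` UNIV = Sigma UNIV (\<lambda>n. {i. E i = n})" by auto
    moreover have "inj (\<lambda>i. (E i, i))" by (auto simp: inj_def)
    ultimately show ?thesis
      using assms(1) has_sum_reindex[of "\<lambda>i. (E i, i)" UNIV "\<lambda>(n, i). c i * x ^ n" S]
      by (simp add: o_def)
  qed
  then show "((\<lambda>n. infsum c {i. E i = n} * x ^ n) has_sum S) UNIV"
  proof (rule has_sum_SigmaD)
    fix n
    have "(\<lambda>i. c i * x ^ E i) summable_on {i. E i = n}"
      using has_sum_imp_summable[OF assms(1)] by (rule summable_on_subset_banach) simp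
    then have "(\<lambda>i. c i * x ^ n) summable_on {i. E i = n}"
      using summable_on_cong[of "{i. E i = n}" "\<lambda>i. c i * x ^ E i" "\<lambda>i. c i * x ^ n"] by simp
    then have "(\<lambda>i. c i * x ^ n * (1 / x ^ n)) summable_on {i. E i = n}"
      by (rule summable_on_cmult_left)
    then have "c summable_on {i. E i = n}"
      using assms(2) by simp
    then have "((\<lambda>i. c i * x ^ n) has_sum (infsum c {i. E i = n} * x ^ n)) {i. E i = n}"
      by (intro has_sum_cmult_left has_sum_infsum)
    then show "((\<lambda>y. case (n, y) of (n, i) \<Rightarrow> c i * x ^ n) has_sum infsum c {i. E i = n} * x ^ n) {i. E i = n}"
      by simp
  qed
qed

lemma powi_nonneg_int: "e \<ge> 0 \<Longrightarrow> x powi e = x ^ nat e"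
  by (simp add: power_int_def)

lemma exp_nome_mult: "exp (2 * complex_of_real pi * \<i> * (of_nat m * \<tau>)) = exp (2 * complex_of_real pi * \<i> * \<tau>) ^ m"
  by (simp add: exp_of_nat_mult[symmetric] mult_ac)

lemma dedekind_eta_mult:
  "dedekind_eta (of_nat m * \<tau>) = exp (2 * complex_of_real pi * \<i> * \<tau> / 24) ^ m * euler_prod (exp (2 * complex_of_real pi * \<i> * \<tau>) ^ m)"
  unfolding dedekind_eta_def qpoch_def exp_nome_mult by (simp add: exp_of_nat_mult[symmetric] mult_ac)

lemma nome:
  fixes \<tau> :: complex
  assumes "Im \<tau> > 0"
  defines "x \<equiv> exp (2 * complex_of_real pi * \<i> * \<tau>)"
  shows "norm x < 1" "x \<noteq> 0" "exp (2 * complex_of_real pi * \<i> * \<tau> / 24) ^ 24 = x"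
proof -
  show "norm x < 1" "x \<noteq> 0"
    using assms(1) by (simp_all add: x_def)
  show "exp (2 * complex_of_real pi * \<i> * \<tau> / 24) ^ 24 = x"
    using exp_of_nat_mult[of 24 "2 * complex_of_real pi * \<i> * \<tau> / 24"] by (simp add: x_def mult_ac)
qed

lemma f_36_nome:
  assumes "Im \<tau> > 0"
  defines "x \<equiv> exp (2 * complex_of_real pi * \<i> * \<tau>)"
  shows "f_36_2_a_a \<tau> = x * euler_prod (x ^ 6) ^ 4"
proof -
  have "f_36_2_a_a \<tau> = dedekind_eta (of_nat 6 * \<tau>) ^ 4"
    by (simp add: f_36_2_a_a_def K5_def)
  then show ?thesis
    using nome(3)[OF assms(1)] unfolding dedekind_eta_mult by (simp add: x_def power_mult_distrib flip: power_mult)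
qed

lemma f_27_nome:
  assumes "Im \<tau> > 0"
  defines "x \<equiv> exp (2 * complex_of_real pi * \<i> * \<tau>)"
  shows "f_27_2_a_a \<tau> = x * (euler_prod (x ^ 3) ^ 2 * euler_prod (x ^ 9) ^ 2)"
proof -
  define y where "y = exp (2 * complex_of_real pi * \<i> * \<tau> / 24)"
  have "f_27_2_a_a \<tau> = dedekind_eta (of_nat 9 * \<tau>) ^ 2 * dedekind_eta (of_nat 3 * \<tau>) ^ 2"
    by (simp add: f_27_2_a_a_def K5_def)
  also have "\<dots> = (y ^ 18 * y ^ 6) * (euler_prod (x ^ 3) ^ 2 * euler_prod (x ^ 9) ^ 2)"
    unfolding dedekind_eta_mult y_def x_def by (simp add: power_mult_distrib flip: power_mult)
  also have "y ^ 18 * y ^ 6 = x"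
    using nome(3)[OF assms(1)] by (simp add: x_def y_def flip: power_add)
  finally show ?thesis .
qed

lemma f_432_nome:
  assumes "Im \<tau> > 0"
  defines "x \<equiv> exp (2 * complex_of_real pi * \<i> * \<tau>)"
  shows "f_432_2_c_a \<tau> = x * (euler_prod (x ^ 12) ^ 5 / euler_prod (x ^ 36))
    - 3 * (\<i> * complex_of_real (sqrt 3)) * (x ^ 7 * (euler_prod (x ^ 36) ^ 5 / euler_prod (x ^ 12)))"
proof -
  define y where "y = exp (2 * complex_of_real pi * \<i> * \<tau> / 24)"
  have y: "y \<noteq> 0" "y ^ 24 = x"
    using nome(3)[OF assms(1)] by (simp_all add: y_def x_def)
  have quot: "(a * b) ^ 5 / (c * d) = (a ^ 5 / c) * (b ^ 5 / d)" for a b c d :: complex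
    by (simp add: power_mult_distrib)
  have "K5 (1/12) (12 * \<tau>) = dedekind_eta (of_nat 12 * \<tau>) ^ 5 / dedekind_eta (of_nat 36 * \<tau>)"
  proof -
    have "\<lfloor>12 * (1 / 12 :: rat)\<rfloor> - 2 = - 1" "- \<lfloor>12 * (1 / 12 :: rat)\<rfloor> + 6 = int 5" "3 * (12 * \<tau>) = of_nat 36 * \<tau>"
      by simp_all
    then show ?thesis
      unfolding K5_def by (simp only: power_int_minus power_int_of_nat power_int_1_right divide_inverse mult.commute) simp
  qed
  also have "\<dots> = ((y ^ 12) ^ 5 / y ^ 36) * (euler_prod (x ^ 12) ^ 5 / euler_prod (x ^ 36))"
    unfolding dedekind_eta_mult y_def x_def by (rule quot)
  also have "(y ^ 12) ^ 5 = y ^ 36 * y ^ 24"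
    by (simp only: power_mult[symmetric] power_add[symmetric]) simp
  also have "y ^ 36 * y ^ 24 / y ^ 36 = x"
    using y by simp
  finally have 1: "K5 (1/12) (12 * \<tau>) = x * (euler_prod (x ^ 12) ^ 5 / euler_prod (x ^ 36))" .
  have "K5 (7/12) (12 * \<tau>) = dedekind_eta (of_nat 36 * \<tau>) ^ 5 / dedekind_eta (of_nat 12 * \<tau>)"
  proof -
    have "\<lfloor>12 * (7 / 12 :: rat)\<rfloor> - 2 = int 5" "- \<lfloor>12 * (7 / 12 :: rat)\<rfloor> + 6 = - 1" "3 * (12 * \<tau>) = of_nat 36 * \<tau>"
      by simp_all
    then show ?thesis
      unfolding K5_def by (simp only: power_int_minus power_int_of_nat power_int_1_right divide_inverse) simp
  qed
  also have "\<dots> = ((y ^ 36) ^ 5 / y ^ 12) * (euler_prod (x ^ 36) ^ 5 / euler_prod (x ^ 12))"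
    unfolding dedekind_eta_mult y_def x_def by (rule quot)
  also have "(y ^ 36) ^ 5 = y ^ 12 * (y ^ 24) ^ 7"
    by (simp only: power_mult[symmetric] power_add[symmetric]) simp
  also have "y ^ 12 * (y ^ 24) ^ 7 / y ^ 12 = x ^ 7"
    using y by simp
  finally show ?thesis
    using 1 by (simp add: f_432_2_c_a_def)
qed


lemma has_sum_imp_power_series_int:
  fixes c :: "'i \<Rightarrow> complex" and e :: "'i \<Rightarrow> int"
  assumes "((\<lambda>i. c i * x powi e i) has_sum S) UNIV" "x \<noteq> 0" "\<And>i. e i \<ge> 0"
  shows "(\<lambda>n. infsum c {i. e i = int n} * x ^ n) sums S"
proof -
  have "(\<lambda>i. c i * x powi e i) = (\<lambda>i. c i * x ^ nat (e i))"
    using assms(3) by (intro ext) (simp add: power_int_def)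
  then have "(\<lambda>n. infsum c {i. nat (e i) = n} * x ^ n) sums S"
    using has_sum_imp_power_series[of c x "\<lambda>i. nat (e i)" S] assms(1,2) by simp
  moreover have "{i. nat (e i) = n} = {i. e i = int n}" for n
    using assms(3) by (auto simp: nat_eq_iff)
  ultimately show ?thesis by simp
qed

lemma powi_affine_split:
  fixes x :: complex
  assumes "x \<noteq> 0"
  shows "x powi (int m * a + int m * b + 1) = (x ^ m) powi a * (x ^ m) powi b * x"
  using assms by (simp add: power_int_add power_int_mult)

lemma euler_prod_expansion:
  assumes q: "norm q < 1" "q \<noteq> 0"
  shows "((\<lambda>k. (- 1) powi k * q powi (3 * (k * (k - 1) div 2) + 2 * k)) has_sum euler_prod q) UNIV"
  using theta_quadratic_exponent(1)[OF q, of 1 3 2] by (simp add: euler_prod_pentagonal[OF q])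

lemma fourier_coeff_36:
  "fourier_coeff f_36_2_a_a p = 1/2 * infsum (\<lambda>(k, d). (- 1) powi (k + d) * of_int (2 * d + 1))
     {(k, d). (6 * k + 1) ^ 2 + 3 * (2 * d + 1) ^ 2 = 4 * int p}"
proof -
  define c :: "int \<times> int \<Rightarrow> complex" where "c = (\<lambda>(k, d). (- 1) powi (k + d) * of_int (2 * d + 1))"
  define e :: "int \<times> int \<Rightarrow> int" where "e = (\<lambda>(k, d). 9 * k ^ 2 + 3 * k + 3 * d ^ 2 + 3 * d + 1)"
  have e4: "4 * e (k, d) = (6 * k + 1) ^ 2 + 3 * (2 * d + 1) ^ 2" for k d
    by (simp add: e_def power2_eq_square algebra_simps)
  have "fourier_coeff f_36_2_a_a = (\<lambda>n. 1/2 * infsum c {i. e i = int n})"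
  proof (rule fourier_coeff_eqI)
    fix \<tau> :: complex assume \<tau>: "Im \<tau> > 0"
    define x where "x = exp (2 * complex_of_real pi * \<i> * \<tau>)"
    have x: "norm x < 1" "x \<noteq> 0" using nome[OF \<tau>] by (simp_all add: x_def)
    have s: "norm (x ^ 6) < 1" "x ^ 6 \<noteq> 0" using x by (auto intro: norm_power_less_1)
    have "((\<lambda>p. x * (case p of (k, d) \<Rightarrow> (- 1) powi k * (x ^ 6) powi (3 * (k * (k - 1) div 2) + 2 * k) *
       ((- 1) powi d * of_int (2 * d + 1) * (x ^ 6) powi (d * (d + 1) div 2)))) has_sum
       (x * (euler_prod (x ^ 6) * (2 * euler_prod (x ^ 6) ^ 3)))) UNIV"
      by (intro has_sum_cmult_right has_sum_product euler_prod_expansion jacobi_cube_parity(3) s)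
    moreover have "x * ((- 1) powi k * (x ^ 6) powi (3 * (k * (k - 1) div 2) + 2 * k) *
       ((- 1) powi d * of_int (2 * d + 1) * (x ^ 6) powi (d * (d + 1) div 2))) = c (k, d) * x powi (e (k, d))" for k d
    proof -
      have "2 * (d * (d + 1) div 2) = d * (d + 1)" by (rule dvd_mult_div_cancel) simp
      moreover have "e (k, d) = int 6 * (3 * K + 2 * k) + int 6 * D + 1" if "2 * K = k * (k - 1)" "2 * D = d * (d + 1)" for K D
        using that by (simp add: e_def power2_eq_square algebra_simps)
      ultimately have "e (k, d) = int 6 * (3 * (k * (k - 1) div 2) + 2 * k) + int 6 * (d * (d + 1) div 2) + 1"
        using two_times_triangle[of k] by blast
      then have "x powi (e (k, d)) = (x ^ 6) powi (3 * (k * (k - 1) div 2) + 2 * k) * (x ^ 6) powi (d * (d + 1) div 2) * x"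
        by (simp only: powi_affine_split[OF x(2)])
      moreover have "(- 1 :: complex) powi (k + d) = (- 1) powi k * (- 1) powi d"
        by (simp add: power_int_add)
      ultimately show ?thesis
        unfolding c_def prod.case by (simp only: mult_ac)
    qed
    ultimately have "((\<lambda>p. c p * x powi (e p)) has_sum (x * (euler_prod (x ^ 6) * (2 * euler_prod (x ^ 6) ^ 3)))) UNIV"
      by (simp add: case_prod_unfold)
    moreover have "e p \<ge> 0" for p
      using e4[of "fst p" "snd p"] by (smt (verit) prod.collapse zero_le_power2)
    ultimately have "(\<lambda>n. infsum c {i. e i = int n} * x ^ n) sums (x * (euler_prod (x ^ 6) * (2 * euler_prod (x ^ 6) ^ 3)))"
      using x(2) by (intro has_sum_imp_power_series_int)
    from sums_mult[OF this, of "1/2"]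
    have "(\<lambda>n. (1/2 * infsum c {i. e i = int n}) * x ^ n) sums (x * euler_prod (x ^ 6) ^ 4)"
      by (simp add: mult_ac eval_nat_numeral)
    then show "(\<lambda>n. 1/2 * infsum c {i. e i = int n} * exp (2 * complex_of_real pi * \<i> * \<tau>) ^ n) sums f_36_2_a_a \<tau>"
      unfolding f_36_nome[OF \<tau>] x_def .
  qed
  moreover have "{i. e i = int p} = {(k, d). (6 * k + 1) ^ 2 + 3 * (2 * d + 1) ^ 2 = 4 * int p}"
    unfolding e4[symmetric] by auto
  ultimately show ?thesis by (simp add: c_def)
qed

lemma fourier_coeff_27:
  "(omega - 1) * fourier_coeff f_27_2_a_a p =
    infsum (\<lambda>(n, t). of_int (2 * n - 1) * omega powi n) {(n, t). 3 * (2 * n - 1) ^ 2 + (6 * t + 1) ^ 2 = 4 * int p}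
    + omega ^ 2 * infsum (\<lambda>(n, t). of_int (2 * n) * omega powi n) {(n, t). 3 * n ^ 2 + (3 * t + 1) ^ 2 = int p}"
proof -
  define c c' :: "int \<times> int \<Rightarrow> complex" where "c = (\<lambda>(n, t). of_int (2 * n - 1) * omega powi n)"
    and "c' = (\<lambda>(n, t). of_int (2 * n) * omega powi n)"
  define e e' :: "int \<times> int \<Rightarrow> int" where "e = (\<lambda>(n, t). 3 * (n ^ 2 - n) + 3 * (3 * t ^ 2 + t) + 1)"
    and "e' = (\<lambda>(n, t). 3 * n ^ 2 + 3 * (3 * t ^ 2 + 2 * t) + 1)"
  have e4: "4 * e (n, t) = 3 * (2 * n - 1) ^ 2 + (6 * t + 1) ^ 2" for n t
    by (simp add: e_def power2_eq_square algebra_simps)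
  have e1: "e' (n, t) = 3 * n ^ 2 + (3 * t + 1) ^ 2" for n t
    by (simp add: e'_def power2_eq_square algebra_simps)
  have w: "omega - 1 \<noteq> 0" by simp
  have "fourier_coeff f_27_2_a_a = (\<lambda>k. (infsum c {i. e i = int k} + omega ^ 2 * infsum c' {i. e' i = int k}) / (omega - 1))"
  proof (rule fourier_coeff_eqI)
    fix \<tau> :: complex assume \<tau>: "Im \<tau> > 0"
    define x where "x = exp (2 * complex_of_real pi * \<i> * \<tau>)"
    have x: "norm x < 1" "x \<noteq> 0" using nome[OF \<tau>] by (simp_all add: x_def)
    have s: "norm (x ^ 3) < 1" "x ^ 3 \<noteq> 0" using x by (auto intro: norm_power_less_1)
    obtain A1 A2 B1 B2 where
      AB: "((\<lambda>n. of_int (2 * n - 1) * omega powi n * (x ^ 3) powi (n ^ 2 - n)) has_sum A1) UNIV"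
      "((\<lambda>t. (x ^ 3) powi (3 * t ^ 2 + t)) has_sum B1) UNIV"
      "((\<lambda>n. of_int (2 * n) * omega powi n * (x ^ 3) powi (n ^ 2)) has_sum A2) UNIV"
      "((\<lambda>t. (x ^ 3) powi (3 * t ^ 2 + 2 * t)) has_sum B2) UNIV"
      and eq: "(omega - 1) * (euler_prod (x ^ 3) ^ 2 * euler_prod ((x ^ 3) ^ 3) ^ 2) = A1 * B1 + omega ^ 2 * (A2 * B2)"
      by (rule eta_quotient_27_theta[OF s])
    have "((\<lambda>p. x * (case p of (n, t) \<Rightarrow> of_int (2 * n - 1) * omega powi n * (x ^ 3) powi (n ^ 2 - n) * (x ^ 3) powi (3 * t ^ 2 + t)))
      has_sum (x * (A1 * B1))) UNIV"
      by (intro has_sum_cmult_right has_sum_product AB)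
    moreover have "x * (of_int (2 * n - 1) * omega powi n * (x ^ 3) powi (n ^ 2 - n) * (x ^ 3) powi (3 * t ^ 2 + t))
      = c (n, t) * x powi (e (n, t))" for n t
    proof -
      have "x powi (e (n, t)) = (x ^ 3) powi (n ^ 2 - n) * (x ^ 3) powi (3 * t ^ 2 + t) * x"
        unfolding e_def prod.case using powi_affine_split[OF x(2), of 3 "n ^ 2 - n" "3 * t ^ 2 + t"] by simp
      then show ?thesis by (simp add: c_def)
    qed
    ultimately have "((\<lambda>p. c p * x powi (e p)) has_sum (x * (A1 * B1))) UNIV"
      by (simp add: case_prod_unfold)
    moreover have "e p \<ge> 0" for p
      using e4[of "fst p" "snd p"] by (smt (verit) prod.collapse zero_le_power2)
    ultimately have 1: "(\<lambda>k. infsum c {i. e i = int k} * x ^ k) sums (x * (A1 * B1))"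
      using x(2) by (intro has_sum_imp_power_series_int)
    have "((\<lambda>p. x * (case p of (n, t) \<Rightarrow> of_int (2 * n) * omega powi n * (x ^ 3) powi (n ^ 2) * (x ^ 3) powi (3 * t ^ 2 + 2 * t)))
      has_sum (x * (A2 * B2))) UNIV"
      by (intro has_sum_cmult_right has_sum_product AB)
    moreover have "x * (of_int (2 * n) * omega powi n * (x ^ 3) powi (n ^ 2) * (x ^ 3) powi (3 * t ^ 2 + 2 * t))
      = c' (n, t) * x powi (e' (n, t))" for n t
    proof -
      have "x powi (e' (n, t)) = (x ^ 3) powi (n ^ 2) * (x ^ 3) powi (3 * t ^ 2 + 2 * t) * x"
        unfolding e'_def prod.case using powi_affine_split[OF x(2), of 3 "n ^ 2" "3 * t ^ 2 + 2 * t"] by simp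
      then show ?thesis by (simp add: c'_def)
    qed
    ultimately have "((\<lambda>p. c' p * x powi (e' p)) has_sum (x * (A2 * B2))) UNIV"
      by (simp add: case_prod_unfold)
    moreover have "e' p \<ge> 0" for p
      using e1[of "fst p" "snd p"] by (smt (verit) prod.collapse zero_le_power2)
    ultimately have 2: "(\<lambda>k. infsum c' {i. e' i = int k} * x ^ k) sums (x * (A2 * B2))"
      using x(2) by (intro has_sum_imp_power_series_int)
    have "(\<lambda>k. (infsum c {i. e i = int k} + omega ^ 2 * infsum c' {i. e' i = int k}) / (omega - 1) * x ^ k) sums
      ((x * (A1 * B1) + omega ^ 2 * (x * (A2 * B2))) / (omega - 1))"
    proof -
      have "(u + v * w) / d * y = (u * y + v * (w * y)) / d" for u v w d y :: complex
        by (simp add: distrib_right mult.assoc)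
      then show ?thesis
        using sums_divide[OF sums_add[OF 1 sums_mult[OF 2, of "omega ^ 2"]], of "omega - 1"] by (simp only:)
    qed
    also have "(x * (A1 * B1) + omega ^ 2 * (x * (A2 * B2))) / (omega - 1) = x * ((A1 * B1 + omega ^ 2 * (A2 * B2)) / (omega - 1))"
      by (simp only: distrib_left mult.left_commute times_divide_eq_right)
    also have "\<dots> = x * (euler_prod (x ^ 3) ^ 2 * euler_prod ((x ^ 3) ^ 3) ^ 2)"
      unfolding eq[symmetric] using w by simp
    also have "\<dots> = f_27_2_a_a \<tau>"
      unfolding f_27_nome[OF \<tau>] x_def by (simp flip: power_mult)
    finally show "(\<lambda>k. (infsum c {i. e i = int k} + omega ^ 2 * infsum c' {i. e' i = int k}) / (omega - 1)
       * exp (2 * complex_of_real pi * \<i> * \<tau>) ^ k) sums f_27_2_a_a \<tau>"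
      by (simp only: x_def)
  qed
  moreover have "{i. e i = int p} = {(n, t). 3 * (2 * n - 1) ^ 2 + (6 * t + 1) ^ 2 = 4 * int p}"
    unfolding e4[symmetric] by auto
  moreover have "{i. e' i = int p} = {(n, t). 3 * n ^ 2 + (3 * t + 1) ^ 2 = int p}"
    unfolding e1[symmetric] by auto
  ultimately show ?thesis using w by (simp add: c_def c'_def)
qed

lemma euler_prod_holomorphic: "euler_prod holomorphic_on ball 0 1"
proof -
  have "euler_prod field_differentiable (at z)" if z: "z \<in> ball 0 1" for z
  proof -
    obtain r where r: "norm z < r" "r < 1" using z dense by auto
    have "uniformly_convergent_on (cball 0 r) (\<lambda>N q :: complex. \<Sum>n<N. norm ((1 - q * q ^ n) - 1))"
    proof (rule Weierstrass_m_test')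
      show "norm (norm ((1 - q * q ^ n) - 1)) \<le> r ^ Suc n" if "q \<in> cball 0 r" for n and q :: complex
      proof -
        have "norm (norm ((1 - q * q ^ n) - 1)) = norm q ^ Suc n" by (simp add: norm_mult norm_power)
        also have "\<dots> \<le> r ^ Suc n" using that by (intro power_mono) auto
        finally show ?thesis .
      qed
      show "summable (\<lambda>n. r ^ Suc n)"
      proof -
        have "0 < r" using r norm_ge_zero[of z] by linarith
        then have "norm r < 1" using r by simp
        then show ?thesis by (subst summable_Suc_iff) (rule summable_geometric)
      qed
    qed
    then have "uniformly_convergent_on (cball 0 r) (\<lambda>N q :: complex. \<Prod>n<N. 1 - q * q ^ n)"
      by (intro uniformly_convergent_on_prod') (auto intro!: continuous_intros)
    then obtain l where l: "uniform_limit (cball 0 r) (\<lambda>N q :: complex. \<Prod>n<N. 1 - q * q ^ n) l sequentially"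
      by (auto simp: uniformly_convergent_on_def)
    have "l holomorphic_on ball 0 r"
      by (rule holomorphic_uniform_limit[OF _ l]) (auto intro!: always_eventually continuous_intros holomorphic_intros)
    moreover have "l q = euler_prod q" if "q \<in> ball 0 r" for q
      using qpoch_eqI[of q q "l q"] tendsto_uniform_limitI[OF l, of q] that r by auto
    ultimately have "euler_prod holomorphic_on ball 0 r"
      by (subst holomorphic_cong[of _ "ball 0 r" _ l]) auto
    then show ?thesis
      using r by (intro holomorphic_on_imp_differentiable_at[of _ "ball 0 r"]) auto
  qed
  then show ?thesis
    using field_differentiable_at_within holomorphic_on_def by blast
qed

lemma fourier_coeff_432:
  assumes p: "p mod 12 \<noteq> 7"
  shows "fourier_coeff f_432_2_c_a p =
    infsum (\<lambda>(w, k). (- omega) powi w * (- 1) powi k * (of_int (6 * k + 1) - 2 * (omega - omega ^ 2) * of_int w))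
      {(w, k). (6 * k + 1) ^ 2 + 12 * w ^ 2 = int p}"
proof -
  define c :: "int \<times> int \<Rightarrow> complex" where "c = (\<lambda>(w, k). (- omega) powi w * (- 1) powi k * (of_int (6 * k + 1) - 2 * (omega - omega ^ 2) * of_int w))"
  define e :: "int \<times> int \<Rightarrow> int" where "e = (\<lambda>(w, k). 12 * (w ^ 2) + 12 * (3 * k ^ 2 + k) + 1)"
  have e1: "e (w, k) = (6 * k + 1) ^ 2 + 12 * w ^ 2" for w k
    by (simp add: e_def power2_eq_square algebra_simps)
  define h where "h q = euler_prod (q ^ 3) ^ 5 / euler_prod q" for q
  define b where "b n = (deriv ^^ n) h 0 / fact n" for n
  have h: "(\<lambda>n. b n * q ^ n) sums h q" if "norm q < 1" for q
  proof -
    have "(\<lambda>q. euler_prod (q ^ 3)) holomorphic_on ball 0 1"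
      by (rule holomorphic_on_compose_gen[OF _ euler_prod_holomorphic, unfolded o_def])
        (auto intro!: holomorphic_intros norm_power_less_1)
    then have "h holomorphic_on ball 0 1"
      unfolding h_def by (intro holomorphic_intros euler_prod_holomorphic) (auto simp: qpoch_self_nonzero)
    from holomorphic_power_series[OF this, of q] that show ?thesis
      by (simp add: b_def)
  qed
  have "fourier_coeff f_432_2_c_a = (\<lambda>n. infsum c {i. e i = int n} -
     3 * (\<i> * complex_of_real (sqrt 3)) * infsum b {i. 12 * i + 7 = n})"
  proof (rule fourier_coeff_eqI)
    fix \<tau> :: complex assume \<tau>: "Im \<tau> > 0"
    define x where "x = exp (2 * complex_of_real pi * \<i> * \<tau>)"
    have x: "norm x < 1" "x \<noteq> 0" using nome[OF \<tau>] by (simp_all add: x_def)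
    define Q where "Q = x ^ 12"
    have Q: "norm Q < 1" "Q \<noteq> 0" using x by (auto simp: Q_def intro: norm_power_less_1)
    have Q3: "euler_prod (Q ^ 3) \<noteq> 0"
      using Q by (intro qpoch_self_nonzero norm_power_less_1) auto
    have "summable (\<lambda>n. norm (b n * Q ^ n))"
    proof -
      obtain r where r: "norm Q < r" "r < 1" using Q dense by auto
      have "norm (complex_of_real r) = r" using r by (smt (verit) norm_ge_zero norm_of_real)
      then show ?thesis
        using powser_insidea[of b "of_real r" Q] h[of "of_real r"] r by (auto simp: sums_iff)
    qed
    then have "((\<lambda>n. b n * Q ^ n) has_sum h Q) UNIV"
      using h[OF Q(1)] by (rule norm_summable_imp_has_sum)
    then have "((\<lambda>n. x ^ 7 * (b n * Q ^ n)) has_sum (x ^ 7 * h Q)) UNIV"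
      by (rule has_sum_cmult_right)
    moreover have "x ^ 7 * (b n * Q ^ n) = b n * x ^ (12 * n + 7)" for n
      by (simp add: Q_def power_add power_mult)
    ultimately have 2: "(\<lambda>n. infsum b {i. 12 * i + 7 = n} * x ^ n) sums (x ^ 7 * h Q)"
      using x(2) has_sum_imp_power_series[of b x "\<lambda>i. 12 * i + 7"] by simp
    define A DA T DT where "A = theta (omega * Q) (Q ^ 2)" and "DA = dtheta (omega * Q) (Q ^ 2)"
      and "T = theta (Q ^ 4) (Q ^ 6)" and "DT = dtheta (Q ^ 4) (Q ^ 6)"
    define a where "a w = (- omega) powi w * Q powi (w ^ 2)" for w
    define t where "t k = (- 1) powi k * Q powi (3 * k ^ 2 + k)" for k
    have a: "(a has_sum A) UNIV" "((\<lambda>w. of_int w * a w) has_sum DA) UNIV"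
      using theta_even_exponent[OF Q, of omega 1 0] by (simp_all add: a_def[abs_def] A_def DA_def)
    have t: "(t has_sum T) UNIV" "((\<lambda>k. of_int k * t k) has_sum DT) UNIV"
      using theta_even_exponent[OF Q, of 1 3 1] by (simp_all add: t_def[abs_def] T_def DT_def)
    have "((\<lambda>p. x * (6 * (case p of (w, k) \<Rightarrow> a w * (of_int k * t k)) + (case p of (w, k) \<Rightarrow> a w * t k)
        - 2 * (omega - omega ^ 2) * (case p of (w, k) \<Rightarrow> (of_int w * a w) * t k)))
      has_sum (x * (6 * (A * DT) + A * T - 2 * (omega - omega ^ 2) * (DA * T)))) UNIV"
      by (intro has_sum_cmult_right has_sum_diff has_sum_add has_sum_product a t)
    moreover have "x * (6 * (a w * (of_int k * t k)) + a w * t k - 2 * (omega - omega ^ 2) * ((of_int w * a w) * t k))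
      = c (w, k) * x powi e (w, k)" for w k
    proof -
      have "x powi e (w, k) = Q powi (w ^ 2) * Q powi (3 * k ^ 2 + k) * x"
        unfolding e_def prod.case Q_def using powi_affine_split[OF x(2), of 12 "w ^ 2" "3 * k ^ 2 + k"] by simp
      then show ?thesis by (simp add: c_def a_def t_def algebra_simps)
    qed
    ultimately have "((\<lambda>p. c p * x powi e p) has_sum (x * (6 * (A * DT) + A * T - 2 * (omega - omega ^ 2) * (DA * T)))) UNIV"
      by (simp add: case_prod_unfold)
    moreover have "e p \<ge> 0" for p
      using e1[of "fst p" "snd p"] by (smt (verit) prod.collapse zero_le_power2)
    ultimately have "(\<lambda>n. infsum c {i. e i = int n} * x ^ n) sums (x * (6 * (A * DT) + A * T - 2 * (omega - omega ^ 2) * (DA * T)))"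
      using x(2) by (intro has_sum_imp_power_series_int)
    also have "6 * (A * DT) + A * T - 2 * (omega - omega ^ 2) * (DA * T) = euler_prod Q ^ 5 / euler_prod (Q ^ 3)"
    proof -
      have "euler_prod Q ^ 5 / euler_prod (Q ^ 3) = A * (6 * DT + T) - 2 * (omega - omega ^ 2) * (T * DA)"
        unfolding eta_quotient_432_theta[OF Q] A_def DA_def T_def DT_def using Q3 by simp
      then show ?thesis by (simp add: algebra_simps)
    qed
    finally have 1: "(\<lambda>n. infsum c {i. e i = int n} * x ^ n) sums (x * (euler_prod Q ^ 5 / euler_prod (Q ^ 3)))" .
    have "(\<lambda>n. (infsum c {i. e i = int n} - 3 * (\<i> * complex_of_real (sqrt 3)) * infsum b {i. 12 * i + 7 = n}) * x ^ n) sums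
       (x * (euler_prod Q ^ 5 / euler_prod (Q ^ 3)) - 3 * (\<i> * complex_of_real (sqrt 3)) * (x ^ 7 * h Q))"
      using sums_diff[OF 1 sums_mult[OF 2, of "3 * (\<i> * complex_of_real (sqrt 3))"]]
      by (simp only: left_diff_distrib mult.assoc)
    moreover have "Q ^ 3 = x ^ 36" by (simp add: Q_def flip: power_mult)
    ultimately show "(\<lambda>n. (infsum c {i. e i = int n} - 3 * (\<i> * complex_of_real (sqrt 3)) * infsum b {i. 12 * i + 7 = n})
       * exp (2 * complex_of_real pi * \<i> * \<tau>) ^ n) sums f_432_2_c_a \<tau>"
      unfolding f_432_nome[OF \<tau>] by (simp only: x_def[symmetric] h_def Q_def)
  qed
  moreover have "{i. 12 * i + 7 = p} = {}" using p by auto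
  moreover have "{i. e i = int p} = {(w, k). (6 * k + 1) ^ 2 + 12 * w ^ 2 = int p}"
    unfolding e1[symmetric] by auto
  ultimately show ?thesis by (simp add: c_def)
qed


locale odd_prime =
  fixes p :: nat
  assumes prime: "prime p" and gt2: "p > 2"
begin

definition res_sum :: "(int \<Rightarrow> complex) \<Rightarrow> complex"
  where "res_sum f = (\<Sum>x\<in>{0..<int p}. f x)"

definition periodic :: "(int \<Rightarrow> complex) \<Rightarrow> bool"
  where "periodic f \<longleftrightarrow> (\<forall>x y. [x = y] (mod int p) \<longrightarrow> f x = f y)"

lemma prime_int: "prime (int p)"
  using prime by simp

lemma periodicD: "periodic f \<Longrightarrow> [x = y] (mod int p) \<Longrightarrow> f x = f y"
  by (auto simp: periodic_def)

lemma periodic_mod: "periodic f \<Longrightarrow> f (x mod int p) = f x"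
  by (rule periodicD) (auto simp: cong_def)

lemma res_sum_cong: "(\<And>x. f x = g x) \<Longrightarrow> res_sum f = res_sum g"
  by (simp add: res_sum_def)

lemma res_sum_reindex:
  assumes f: "periodic f" and g: "\<And>x y. [g x = g y] (mod int p) \<Longrightarrow> [x = y] (mod int p)"
  shows "res_sum (\<lambda>x. f (g x)) = res_sum f"
proof -
  define h where "h x = g x mod int p" for x
  have inj: "inj_on h {0..<int p}"
  proof (rule inj_onI)
    fix x y assume xy: "x \<in> {0..<int p}" "y \<in> {0..<int p}" "h x = h y"
    then have "[g x = g y] (mod int p)" by (simp add: h_def cong_def)
    then have "[x = y] (mod int p)" by (rule g)
    then show "x = y" using xy by (simp add: cong_def)
  qed
  have sub: "h ` {0..<int p} \<subseteq> {0..<int p}"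
    using gt2 by (auto simp: h_def)
  have "h ` {0..<int p} = {0..<int p}"
    by (rule endo_inj_surj[OF _ sub inj]) simp
  with inj have bij: "bij_betw h {0..<int p} {0..<int p}"
    by (simp add: bij_betw_def)
  have "f (g x) = f (h x)" for x
    unfolding h_def by (rule periodic_mod[OF f, symmetric])
  then have "res_sum (\<lambda>x. f (g x)) = (\<Sum>x\<in>{0..<int p}. f (h x))"
    by (simp only: res_sum_def)
  also have "\<dots> = res_sum f"
    unfolding res_sum_def by (rule sum.reindex_bij_betw[OF bij])
  finally show ?thesis .
qed

lemma dvd_residue_iff: "x \<in> {0..<int p} \<Longrightarrow> int p dvd x \<longleftrightarrow> x = 0"
  using zdvd_imp_le[of "int p" x] by (cases "x = 0") auto

lemma res_sum_affine:
  assumes "periodic f" "\<not> int p dvd a"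
  shows "res_sum (\<lambda>x. f (a * x + b)) = res_sum f"
proof (rule res_sum_reindex[OF assms(1), of "\<lambda>x. a * x + b"])
  fix x y assume "[a * x + b = a * y + b] (mod int p)"
  then have "[a * x = a * y] (mod int p)" by (rule cong_add_rcancel[THEN iffD1])
  moreover have "coprime a (int p)"
    using assms(2) prime_int by (metis prime_imp_coprime coprime_commute)
  ultimately show "[x = y] (mod int p)"
    by (simp add: cong_mult_lcancel)
qed

lemma res_sum_reflect: "periodic f \<Longrightarrow> res_sum (\<lambda>x. f (c - x)) = res_sum f"
  using res_sum_affine[of f "-1" c] gt2 by (simp add: algebra_simps)

lemma res_sum_scale: "periodic f \<Longrightarrow> \<not> int p dvd a \<Longrightarrow> res_sum (\<lambda>x. f (a * x)) = res_sum f"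
  using res_sum_affine[of f a 0] by simp

definition recip :: "int \<Rightarrow> int" where "recip x = x ^ (p - 2)"

lemma recip: "\<not> int p dvd x \<Longrightarrow> [x * recip x = 1] (mod int p)"
proof -
  assume x: "\<not> int p dvd x"
  have "x * recip x = x ^ (p - 1)"
    using gt2 by (simp add: recip_def Suc_diff_Suc numeral_2_eq_2 flip: power_Suc)
  moreover have "[x ^ (p - 1) = 1] (mod int p)"
  proof -
    define n where "n = nat (x mod int p)"
    have n: "[x = int n] (mod int p)" using gt2 by (simp add: n_def cong_def)
    then have "\<not> p dvd n" using x cong_dvd_iff by (metis cong_dvd_iff cong_sym int_dvd_int_iff n cong_def dvd_eq_mod_eq_0)
    then have "[n ^ (p - 1) = 1] (mod p)" by (rule fermat_theorem[OF prime])
    then have "[int n ^ (p - 1) = 1] (mod int p)"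
      using cong_int_iff[of "n ^ (p - 1)" 1 p] by simp
    with cong_pow[OF n] show ?thesis by (rule cong_trans)
  qed
  ultimately show ?thesis by simp
qed

lemma recip_dvd: "int p dvd recip x \<longleftrightarrow> int p dvd x"
  using gt2 prime_int by (auto simp: recip_def prime_dvd_power_iff)

lemma res_sum_recip: "periodic f \<Longrightarrow> res_sum (\<lambda>x. f (recip x)) = res_sum f"
proof (erule res_sum_reindex)
  fix x y assume xy: "[recip x = recip y] (mod int p)"
  then have d: "int p dvd x \<longleftrightarrow> int p dvd y"
    using recip_dvd cong_dvd_iff by (metis cong_0_iff cong_sym cong_trans)
  show "[x = y] (mod int p)"
  proof (cases "int p dvd x")
    case True
    then show ?thesis using d by (metis cong_0_iff cong_sym cong_trans)
  next
    case False
    then have "[y * recip x = 1] (mod int p)"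
      using xy recip[of y] d by (meson cong_scalar_left cong_trans)
    from cong_scalar_left[OF this, of x] cong_scalar_left[OF recip[OF False], of y]
    show ?thesis by (simp add: mult_ac) (metis cong_sym cong_trans mult.left_commute)
  qed
qed

definition mult_char :: "(int \<Rightarrow> complex) \<Rightarrow> bool"
  where "mult_char \<alpha> \<longleftrightarrow> periodic \<alpha> \<and> (\<forall>x y. \<alpha> (x * y) = \<alpha> x * \<alpha> y) \<and> (\<forall>x. \<alpha> x = 0 \<longleftrightarrow> int p dvd x)"

definition nontrivial :: "(int \<Rightarrow> complex) \<Rightarrow> bool"
  where "nontrivial \<alpha> \<longleftrightarrow> (\<exists>x. \<not> int p dvd x \<and> \<alpha> x \<noteq> 1)"

definition Jac :: "(int \<Rightarrow> complex) \<Rightarrow> (int \<Rightarrow> complex) \<Rightarrow> complex"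
  where "Jac \<alpha> \<beta> = res_sum (\<lambda>x. \<alpha> x * \<beta> (1 - x))"

lemma mult_char_periodic: "mult_char \<alpha> \<Longrightarrow> periodic \<alpha>"
  and mult_char_mult: "mult_char \<alpha> \<Longrightarrow> \<alpha> (x * y) = \<alpha> x * \<alpha> y"
  and mult_char_0_iff: "mult_char \<alpha> \<Longrightarrow> \<alpha> x = 0 \<longleftrightarrow> int p dvd x"
  by (auto simp: mult_char_def)

lemma not_dvd_1: "\<not> int p dvd 1"
  using gt2 by simp

lemma mult_char_1: "mult_char \<alpha> \<Longrightarrow> \<alpha> 1 = 1"
  using mult_char_mult[of \<alpha> 1 1] mult_char_0_iff[of \<alpha> 1] not_dvd_1 by simp

lemma mult_char_power: "mult_char \<alpha> \<Longrightarrow> \<alpha> (x ^ n) = \<alpha> x ^ n"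
  by (induction n) (simp_all add: mult_char_1 mult_char_mult)

lemma mult_char_norm:
  assumes "mult_char \<alpha>" "\<not> int p dvd x"
  shows "norm (\<alpha> x) = 1"
proof -
  have "\<alpha> x * \<alpha> x ^ (p - 2) = 1"
    using periodicD[OF mult_char_periodic[OF assms(1)] recip[OF assms(2)]] mult_char_1[OF assms(1)]
    by (simp add: mult_char_mult[OF assms(1)] mult_char_power[OF assms(1)] recip_def)
  then have "\<alpha> x ^ Suc (p - 2) = 1" by simp
  then have "norm (\<alpha> x) ^ Suc (p - 2) = 1" by (metis norm_one norm_power)
  then show ?thesis
    using power_eq_imp_eq_base[of "norm (\<alpha> x)" "Suc (p - 2)" 1] by simp
qed

lemma mult_char_cnj_mult:
  assumes "mult_char \<alpha>" "\<not> int p dvd x"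
  shows "\<alpha> x * cnj (\<alpha> x) = 1" "cnj (\<alpha> x) * \<alpha> x = 1"
  using mult_char_norm[OF assms] complex_norm_square[of "\<alpha> x"] by (simp_all add: mult.commute)

lemma mult_char_recip:
  assumes "mult_char \<alpha>"
  shows "\<alpha> (recip x) = cnj (\<alpha> x)"
proof (cases "int p dvd x")
  case True
  then show ?thesis using mult_char_0_iff[OF assms] recip_dvd by (metis complex_cnj_zero)
next
  case False
  have "\<alpha> x * \<alpha> (recip x) = 1"
    using periodicD[OF mult_char_periodic[OF assms] recip[OF False]] mult_char_1[OF assms]
    by (simp add: mult_char_mult[OF assms])
  then have "\<alpha> x * \<alpha> (recip x) = \<alpha> x * cnj (\<alpha> x)"
    using mult_char_cnj_mult[OF assms False] by simp
  then show ?thesis using False mult_char_0_iff[OF assms] by simp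
qed

lemma mult_char_times: "mult_char \<alpha> \<Longrightarrow> mult_char \<beta> \<Longrightarrow> mult_char (\<lambda>x. \<alpha> x * \<beta> x)"
  unfolding mult_char_def by (auto simp: periodic_def mult_ac)

lemma mult_char_cnj: "mult_char \<alpha> \<Longrightarrow> mult_char (\<lambda>x. cnj (\<alpha> x))"
  unfolding mult_char_def periodic_def by auto

lemma mult_char_pow: "mult_char \<alpha> \<Longrightarrow> n > 0 \<Longrightarrow> mult_char (\<lambda>x. \<alpha> x ^ n)"
  unfolding mult_char_def periodic_def by (auto simp: power_mult_distrib)

lemma mult_char_minus_1_sq: "mult_char \<alpha> \<Longrightarrow> \<alpha> (- 1) * \<alpha> (- 1) = 1"
  using mult_char_mult[of \<alpha> "-1" "-1"] mult_char_1[of \<alpha>] by simp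

lemma periodic_comp_diff: "periodic f \<Longrightarrow> periodic (\<lambda>x. f (c - x))"
  unfolding periodic_def by (meson cong_diff cong_refl)

lemma periodic_comp_affine: "periodic f \<Longrightarrow> periodic (\<lambda>x. f (a * x + b))"
  unfolding periodic_def by (meson cong_add cong_scalar_left cong_refl)

lemma periodic_times: "periodic f \<Longrightarrow> periodic g \<Longrightarrow> periodic (\<lambda>x. f x * g x)"
  unfolding periodic_def by metis

lemma periodic_const: "periodic (\<lambda>x. k)"
  by (simp add: periodic_def)

lemma res_sum_nontrivial:
  assumes "mult_char \<alpha>" "nontrivial \<alpha>"
  shows "res_sum \<alpha> = 0"
proof -
  obtain a where a: "\<not> int p dvd a" "\<alpha> a \<noteq> 1" using assms(2) by (auto simp: nontrivial_def)
  have "res_sum \<alpha> = res_sum (\<lambda>x. \<alpha> (a * x))"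
    using res_sum_scale[OF mult_char_periodic[OF assms(1)] a(1)] by simp
  also have "\<dots> = \<alpha> a * res_sum \<alpha>"
    by (simp add: res_sum_def mult_char_mult[OF assms(1)] sum_distrib_left)
  finally show ?thesis using a(2) by simp
qed

lemma Jac_commute:
  assumes "mult_char \<alpha>" "mult_char \<beta>"
  shows "Jac \<alpha> \<beta> = Jac \<beta> \<alpha>"
proof -
  have "periodic (\<lambda>x. \<alpha> x * \<beta> (1 - x))"
    by (intro periodic_times periodic_comp_diff mult_char_periodic assms)
  from res_sum_reflect[OF this, of 1] show ?thesis
    by (simp add: Jac_def mult.commute)
qed

text \<open>The substitution \<open>x \<mapsto> 1/x\<close>.\<close>

lemma Jac_invert:
  assumes "mult_char \<alpha>" "mult_char \<beta>"
  shows "Jac \<alpha> \<beta> = \<beta> (- 1) * Jac (\<lambda>x. cnj (\<alpha> x * \<beta> x)) \<beta>"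
proof -
  have per: "periodic (\<lambda>x. \<alpha> x * \<beta> (1 - x))"
    by (intro periodic_times periodic_comp_diff mult_char_periodic assms)
  have "\<alpha> (recip x) * \<beta> (1 - recip x) = \<beta> (- 1) * (cnj (\<alpha> x * \<beta> x) * \<beta> (1 - x))" for x
  proof (cases "int p dvd x")
    case True
    then show ?thesis using mult_char_0_iff[OF assms(1)] by (simp add: mult_char_recip[OF assms(1)])
  next
    case False
    have "[recip x * (- 1 * (1 - x)) = 1 - recip x] (mod int p)"
      using recip[OF False] by (simp add: algebra_simps cong_diff)
    then have "\<beta> (1 - recip x) = \<beta> (recip x) * (\<beta> (- 1) * \<beta> (1 - x))"
      using periodicD[OF mult_char_periodic[OF assms(2)]] mult_char_mult[OF assms(2)] by metis
    then show ?thesis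
      by (simp add: mult_char_recip assms mult_ac)
  qed
  then show ?thesis
    using res_sum_recip[OF per] by (simp add: Jac_def res_sum_def sum_distrib_left)
qed

lemma Jac_convolution:
  assumes b: "mult_char b" and c: "mult_char c" and nt: "nontrivial (\<lambda>x. b x * c x)"
  shows "res_sum (\<lambda>y. b y * c (u - y)) = b u * c u * Jac b c"
proof (cases "int p dvd u")
  case True
  have "c (u - y) = c (- 1) * c y" for y
  proof -
    have "[u - y = - 1 * y] (mod int p)" using True by (simp add: cong_iff_dvd_diff)
    then show ?thesis using periodicD[OF mult_char_periodic[OF c]] mult_char_mult[OF c] by metis
  qed
  then have "res_sum (\<lambda>y. b y * c (u - y)) = c (- 1) * res_sum (\<lambda>y. b y * c y)"
    by (simp add: res_sum_def sum_distrib_left mult_ac)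
  also have "\<dots> = 0"
    using res_sum_nontrivial[OF mult_char_times[OF b c] nt] by simp
  finally show ?thesis using True mult_char_0_iff[OF b] by simp
next
  case False
  have "periodic (\<lambda>y. b y * c (u - y))"
    by (intro periodic_times periodic_comp_diff mult_char_periodic b c)
  from res_sum_scale[OF this False]
  have "res_sum (\<lambda>y. b y * c (u - y)) = res_sum (\<lambda>y. b (u * y) * c (u - u * y))" by simp
  also have "\<dots> = res_sum (\<lambda>y. b u * c u * (b y * c (1 - y)))"
  proof (rule res_sum_cong)
    fix y
    have "u - u * y = u * (1 - y)" by (simp add: algebra_simps)
    then show "b (u * y) * c (u - u * y) = b u * c u * (b y * c (1 - y))"
      by (simp only: mult_char_mult[OF b] mult_char_mult[OF c] mult_ac)
  qed
  also have "\<dots> = b u * c u * Jac b c"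
    by (simp add: res_sum_def Jac_def sum_distrib_left)
  finally show ?thesis .
qed

text \<open>Both sides count the weighted solutions of \<open>x + y + z = 1\<close>.\<close>

lemma Jac_cocycle:
  assumes a: "mult_char a" and b: "mult_char b" and c: "mult_char c"
    and ab: "nontrivial (\<lambda>x. a x * b x)" and bc: "nontrivial (\<lambda>x. b x * c x)"
  shows "Jac a b * Jac (\<lambda>x. a x * b x) c = Jac b c * Jac a (\<lambda>x. b x * c x)"
proof -
  have 1: "res_sum (\<lambda>x. res_sum (\<lambda>y. a x * (b y * c (1 - x - y)))) = Jac b c * Jac a (\<lambda>x. b x * c x)"
  proof -
    have "res_sum (\<lambda>x. res_sum (\<lambda>y. a x * (b y * c (1 - x - y)))) = res_sum (\<lambda>x. a x * res_sum (\<lambda>y. b y * c (1 - x - y)))"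
      by (simp only: res_sum_def sum_distrib_left)
    also have "\<dots> = res_sum (\<lambda>x. Jac b c * (a x * (b (1 - x) * c (1 - x))))"
      by (simp only: Jac_convolution[OF b c bc] mult_ac)
    also have "\<dots> = Jac b c * Jac a (\<lambda>x. b x * c x)"
      by (simp only: res_sum_def Jac_def sum_distrib_left)
    finally show ?thesis .
  qed
  have "res_sum (\<lambda>x. res_sum (\<lambda>y. a x * (b y * c (1 - x - y)))) =
    res_sum (\<lambda>x. res_sum (\<lambda>s. a x * (b (s - x) * c (1 - s))))"
  proof (rule res_sum_cong)
    fix x
    have "periodic (\<lambda>y. a x * (b y * c (1 - x - y)))"
      by (rule periodic_times[OF periodic_const periodic_times[OF mult_char_periodic[OF b]
            periodic_comp_diff[OF mult_char_periodic[OF c]]]])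
    from res_sum_affine[OF this, of 1 "- x"]
    show "res_sum (\<lambda>y. a x * (b y * c (1 - x - y))) = res_sum (\<lambda>s. a x * (b (s - x) * c (1 - s)))"
      using gt2 by simp
  qed
  also have "\<dots> = res_sum (\<lambda>s. c (1 - s) * res_sum (\<lambda>x. a x * b (s - x)))"
    unfolding res_sum_def by (subst sum.swap) (simp add: sum_distrib_left mult_ac)
  also have "\<dots> = Jac a b * Jac (\<lambda>x. a x * b x) c"
    unfolding Jac_convolution[OF a b ab] by (simp add: Jac_def res_sum_def sum_distrib_left mult_ac)
  finally show ?thesis using 1 by simp
qed

lemma Jac_norm_sq:
  assumes a: "mult_char a" and b: "mult_char b"
    and nt: "nontrivial a" "nontrivial b" "nontrivial (\<lambda>x. a x * b x)"
  shows "Jac a b * cnj (Jac a b) = of_nat p"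
proof -
  define K where "K t = res_sum (\<lambda>y. b (1 - t * y) * cnj (b (1 - y)))" for t
  note per_b = mult_char_periodic[OF b]
  have perc: "periodic (\<lambda>x. cnj (b x))" using mult_char_periodic[OF mult_char_cnj[OF b]] .
  have K: "K t = (if [t = 1] (mod int p) then of_nat p else 0) - b t" for t
  proof -
    have per: "periodic (\<lambda>y. b (1 - t * y) * cnj (b (1 - y)))"
    proof -
      have "periodic (\<lambda>y. b (1 - t * y))"
        using periodic_comp_affine[OF per_b, of "- t" 1] by simp
      from periodic_times[OF this periodic_comp_diff[OF perc, of 1]] show ?thesis .
    qed
    have "K t = res_sum (\<lambda>y. b (1 - t * (1 - y)) * cnj (b y))"
      unfolding K_def using res_sum_reflect[OF per, of 1] by simp
    also have "\<dots> = res_sum (\<lambda>y. b (1 - t * (1 - recip y)) * b y)"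
    proof -
      have "periodic (\<lambda>y. b (1 - t * (1 - y)) * cnj (b y))"
      proof -
        have "1 - t * (1 - y) = t * y + (1 - t)" for y by (simp add: algebra_simps)
        then have "periodic (\<lambda>y. b (1 - t * (1 - y)))"
          using periodic_comp_affine[OF per_b, of t "1 - t"] by (simp only:)
        from periodic_times[OF this perc] show ?thesis .
      qed
      from res_sum_recip[OF this] show ?thesis
        by (simp add: mult_char_recip[OF b])
    qed
    also have "\<dots> = res_sum (\<lambda>y. b ((1 - t) * y + t) - (if int p dvd y then b t else 0))"
    proof (rule res_sum_cong)
      fix y
      show "b (1 - t * (1 - recip y)) * b y = b ((1 - t) * y + t) - (if int p dvd y then b t else 0)"
      proof (cases "int p dvd y")
        case True
        then have "[(1 - t) * y + t = t] (mod int p)" by (simp add: cong_iff_dvd_diff)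
        then show ?thesis using True mult_char_0_iff[OF b, of y] periodicD[OF per_b] by simp
      next
        case False
        have "[(1 - t) * y + t * (y * recip y) = (1 - t) * y + t * 1] (mod int p)"
          by (intro cong_add cong_scalar_left recip[OF False] cong_refl)
        then have "[(1 - t * (1 - recip y)) * y = (1 - t) * y + t] (mod int p)"
          by (simp add: algebra_simps)
        then show ?thesis using False periodicD[OF per_b] mult_char_mult[OF b] by (simp flip: mult_char_mult[OF b])
      qed
    qed
    also have "\<dots> = res_sum (\<lambda>y. b ((1 - t) * y + t)) - res_sum (\<lambda>y. if int p dvd y then b t else 0)"
      by (simp add: res_sum_def sum_subtractf)
    also have "res_sum (\<lambda>y. if int p dvd y then b t else 0) = (\<Sum>y\<in>{0..<int p}. if y = 0 then b t else 0)"
      unfolding res_sum_def by (intro sum.cong refl) (simp add: dvd_residue_iff)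
    also have "\<dots> = b t" using gt2 by simp
    also have "res_sum (\<lambda>y. b ((1 - t) * y + t)) = (if [t = 1] (mod int p) then of_nat p else 0)"
    proof (cases "[t = 1] (mod int p)")
      case True
      have "b ((1 - t) * y + t) = 1" for y
      proof -
        have "int p dvd 1 - t" using True by (simp add: cong_iff_dvd_diff dvd_diff_commute)
        then have "[(1 - t) * y + t = t] (mod int p)" by (simp add: cong_iff_dvd_diff)
        then show ?thesis using True periodicD[OF per_b] mult_char_1[OF b] cong_trans by metis
      qed
      then show ?thesis using True by (simp add: res_sum_def)
    next
      case False
      then have "\<not> int p dvd 1 - t" by (simp add: cong_iff_dvd_diff dvd_diff_commute)
      then show ?thesis using False res_sum_affine[OF per_b] res_sum_nontrivial[OF b nt(2)] by simp
    qed
    finally show ?thesis .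
  qed
  have inner: "res_sum (\<lambda>x. a x * b (1 - x) * (cnj (a y) * cnj (b (1 - y)))) =
     res_sum (\<lambda>t. a t * (b (1 - t * y) * cnj (b (1 - y)) - (if int p dvd y then 1 else 0)))" for y
  proof (cases "int p dvd y")
    case True
    have "b (1 - t * y) = 1" "b (1 - y) = 1" for t
      using True periodicD[OF per_b, of "1 - t * y" 1] periodicD[OF per_b, of "1 - y" 1] mult_char_1[OF b]
      by (simp_all add: cong_iff_dvd_diff)
    then show ?thesis using True mult_char_0_iff[OF a, of y] by (simp add: res_sum_def)
  next
    case False
    have "periodic (\<lambda>x. a x * b (1 - x) * (cnj (a y) * cnj (b (1 - y))))"
      by (rule periodic_times[OF periodic_times[OF mult_char_periodic[OF a] periodic_comp_diff[OF per_b]] periodic_const])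
    from res_sum_scale[OF this False]
    have "res_sum (\<lambda>x. a x * b (1 - x) * (cnj (a y) * cnj (b (1 - y)))) =
      res_sum (\<lambda>t. a (y * t) * b (1 - y * t) * (cnj (a y) * cnj (b (1 - y))))" by simp
    also have "\<dots> = res_sum (\<lambda>t. a t * (b (1 - t * y) * cnj (b (1 - y))))"
    proof (rule res_sum_cong)
      fix t
      have "a (y * t) * b (1 - y * t) * (cnj (a y) * cnj (b (1 - y))) =
        (a y * cnj (a y)) * (a t * (b (1 - t * y) * cnj (b (1 - y))))"
        by (simp add: mult_char_mult[OF a] mult_ac)
      then show "a (y * t) * b (1 - y * t) * (cnj (a y) * cnj (b (1 - y))) = a t * (b (1 - t * y) * cnj (b (1 - y)))"
        using mult_char_cnj_mult[OF a False] by simp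
    qed
    finally show ?thesis using False by simp
  qed
  have "Jac a b * cnj (Jac a b) = res_sum (\<lambda>y. res_sum (\<lambda>x. a x * b (1 - x) * (cnj (a y) * cnj (b (1 - y)))))"
    by (simp add: Jac_def res_sum_def sum_distrib_left sum_distrib_right)
  also have "\<dots> = res_sum (\<lambda>y. res_sum (\<lambda>t. a t * (b (1 - t * y) * cnj (b (1 - y)) - (if int p dvd y then 1 else 0))))"
    by (simp only: inner)
  also have "\<dots> = res_sum (\<lambda>t. a t * (K t - 1))"
  proof -
    have one: "(\<Sum>y\<in>{0..<int p}. if int p dvd y then 1 else 0) = (1 :: complex)"
    proof -
      have "(\<Sum>y\<in>{0..<int p}. if int p dvd y then 1 else 0) = (\<Sum>y\<in>{0..<int p}. if y = 0 then 1 else (0 :: complex))"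
        by (intro sum.cong refl) (simp add: dvd_residue_iff)
      then show ?thesis using gt2 by simp
    qed
    show ?thesis
      unfolding res_sum_def K_def by (subst sum.swap) (simp add: sum_subtractf one flip: sum_distrib_left)
  qed
  also have "\<dots> = res_sum (\<lambda>t. (if t = 1 then of_nat p else 0) - a t * b t - a t)"
    unfolding res_sum_def
  proof (intro sum.cong refl)
    fix t assume t: "t \<in> {0..<int p}"
    have "[t = 1] (mod int p) \<longleftrightarrow> t = 1"
      using t gt2 by (simp add: cong_def)
    then show "a t * (K t - 1) = (if t = 1 then of_nat p else 0) - a t * b t - a t"
      unfolding K using mult_char_1[OF a] by (simp add: algebra_simps)
  qed
  also have "\<dots> = of_nat p - res_sum (\<lambda>t. a t * b t) - res_sum a"
    using gt2 by (simp add: res_sum_def sum_subtractf)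
  also have "\<dots> = of_nat p"
    using res_sum_nontrivial[OF a nt(1)] res_sum_nontrivial[OF mult_char_times[OF a b] nt(3)] by simp
  finally show ?thesis .
qed

end


definition eisenstein :: "complex set"
  where "eisenstein = {of_int a + of_int b * omega | a b. True}"

lemma eisensteinI: "z = of_int a + of_int b * omega \<Longrightarrow> z \<in> eisenstein"
  by (auto simp: eisenstein_def)

lemma eisenstein_of_int: "of_int a \<in> eisenstein"
  by (rule eisensteinI[of _ a 0]) simp

lemma eisenstein_add: "u \<in> eisenstein \<Longrightarrow> v \<in> eisenstein \<Longrightarrow> u + v \<in> eisenstein"
proof -
  assume "u \<in> eisenstein" "v \<in> eisenstein"
  then obtain a b c d where "u = of_int a + of_int b * omega" "v = of_int c + of_int d * omega"
    by (auto simp: eisenstein_def)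
  then show ?thesis by (intro eisensteinI[of _ "a + c" "b + d"]) (simp add: algebra_simps)
qed

lemma eisenstein_mult: "u \<in> eisenstein \<Longrightarrow> v \<in> eisenstein \<Longrightarrow> u * v \<in> eisenstein"
proof -
  assume "u \<in> eisenstein" "v \<in> eisenstein"
  then obtain a b c d where uv: "u = of_int a + of_int b * omega" "v = of_int c + of_int d * omega"
    by (auto simp: eisenstein_def)
  have "u * v = of_int (a * c) + of_int (a * d + b * c) * omega + of_int (b * d) * omega ^ 2"
    by (simp add: uv algebra_simps power2_eq_square)
  also have "\<dots> = of_int (a * c - b * d) + of_int (a * d + b * c - b * d) * omega"
    by (simp add: omega_sq algebra_simps)
  finally show ?thesis by (rule eisensteinI)
qed

lemma eisenstein_sum: "(\<And>x. x \<in> S \<Longrightarrow> f x \<in> eisenstein) \<Longrightarrow> sum f S \<in> eisenstein"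
  by (induction S rule: infinite_finite_induct)
     (use eisenstein_add eisenstein_of_int[of 0] in auto)

lemma eisenstein_omega: "omega \<in> eisenstein"
  by (rule eisensteinI[of _ 0 1]) simp

lemma cube_roots_of_unity:
  assumes "z ^ 3 = 1"
  shows "z = 1 \<or> z = omega \<or> z = omega ^ 2"
proof -
  have "(z - 1) * (z - omega) * (z - omega ^ 2) = z ^ 3 - (1 + omega + omega ^ 2) * z ^ 2 + (omega + omega ^ 2 + omega ^ 3) * z - omega ^ 3"
    by (simp add: algebra_simps eval_nat_numeral)
  also have "\<dots> = 0" using assms by (simp add: omega_cube omega_sq)
  finally show ?thesis by auto
qed

lemma Re_omega: "Re omega = - 1 / 2" "Re (omega ^ 2) = - 1 / 2"
  by (simp_all add: omega_def power2_eq_square)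

lemma norm_eisenstein: "(of_int a + of_int b * omega) * cnj (of_int a + of_int b * omega) = of_int (a ^ 2 - a * b + b ^ 2)"
proof -
  have "omega * cnj omega = 1" using complex_norm_square[of omega] by simp
  moreover have "omega + cnj omega = - 1" by (simp add: omega_def complex_eq_iff)
  moreover have "(of_int a + of_int b * omega) * cnj (of_int a + of_int b * omega)
    = of_int (a ^ 2) + of_int (a * b) * (omega + cnj omega) + of_int (b ^ 2) * (omega * cnj omega)"
    by (simp add: algebra_simps power2_eq_square)
  ultimately show ?thesis by simp
qed

lemma four_norm_eisenstein:
  fixes a b n :: int
  assumes "a ^ 2 - a * b + b ^ 2 = n"
  shows "(2 * a - b) ^ 2 + 3 * b ^ 2 = 4 * n"
  unfolding assms[symmetric] by (simp add: power2_eq_square algebra_simps)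

lemma prime_mod_3_gt2:
  assumes "prime p" "p mod 3 = 1"
  shows "(p :: nat) > 2"
  using assms prime_ge_2_nat[of p] by (cases "p = 2") auto

context odd_prime
begin

definition leg :: "int \<Rightarrow> complex"
  where "leg x = of_int (Legendre x (int p))"

lemma Legendre_mult: "Legendre (x * y) (int p) = Legendre x (int p) * Legendre y (int p)"
proof -
  have e: "[Legendre a (int p) = a ^ ((p - 1) div 2)] (mod int p)" for a
    using euler_criterion[OF prime gt2, of a] by simp
  have "[Legendre (x * y) (int p) = Legendre x (int p) * Legendre y (int p)] (mod int p)"
    using e[of "x * y"] cong_mult[OF e[of x] e[of y]] by (metis cong_sym cong_trans power_mult_distrib)
  then have "int p dvd Legendre (x * y) (int p) - Legendre x (int p) * Legendre y (int p)"
    by (simp add: cong_iff_dvd_diff)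
  moreover have "\<bar>Legendre (x * y) (int p) - Legendre x (int p) * Legendre y (int p)\<bar> < int p"
    using gt2 by (auto simp: Legendre_def)
  ultimately show ?thesis
    using zdvd_imp_le[of "int p" "\<bar>Legendre (x * y) (int p) - Legendre x (int p) * Legendre y (int p)\<bar>"] by auto
qed

lemma Legendre_cong:
  assumes "[x = y] (mod int p)"
  shows "Legendre x (int p) = Legendre y (int p)"
proof -
  have "[z = x] (mod int p) \<longleftrightarrow> [z = y] (mod int p)" "[x = z] (mod int p) \<longleftrightarrow> [y = z] (mod int p)" for z
    using assms by (auto simp: cong_def)
  then show ?thesis by (simp only: Legendre_def QuadRes_def)
qed

lemma mult_char_leg: "mult_char leg"
  unfolding mult_char_def
proof (intro conjI allI)
  show "periodic leg" unfolding periodic_def leg_def using Legendre_cong by auto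
  show "leg (x * y) = leg x * leg y" for x y by (simp add: leg_def Legendre_mult)
  show "leg x = 0 \<longleftrightarrow> int p dvd x" for x by (simp add: leg_def Legendre_def cong_0_iff)
qed

lemma leg_cases: "leg x = 0 \<or> leg x = 1 \<or> leg x = - 1"
  by (simp add: leg_def Legendre_def)

lemma leg_square: "\<not> int p dvd x \<Longrightarrow> leg x * leg x = 1"
  using leg_cases[of x] mult_char_0_iff[OF mult_char_leg, of x] by auto

lemma not_dvd_2: "\<not> int p dvd 2"
  using gt2 zdvd_imp_le[of "int p" 2] by auto

lemma card_square_roots: "of_nat (card {u \<in> {0..<int p}. u ^ 2 mod int p = v mod int p}) = 1 + leg v"
proof -
  let ?S = "{u \<in> {0..<int p}. u ^ 2 mod int p = v mod int p}"
  consider "int p dvd v" | "\<not> int p dvd v" "QuadRes (int p) v" | "\<not> int p dvd v" "\<not> QuadRes (int p) v" by blast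
  then show ?thesis
  proof cases
    case 1
    have "?S = {0}"
    proof (intro equalityI subsetI)
      fix u assume u: "u \<in> ?S"
      then have "int p dvd u ^ 2" using 1 by (simp add: dvd_eq_mod_eq_0)
      then have "int p dvd u" using prime_int prime_dvd_power by blast
      then show "u \<in> {0}" using u dvd_residue_iff[of u] by simp
    qed (use gt2 1 in \<open>auto simp: dvd_eq_mod_eq_0\<close>)
    moreover have "leg v = 0" using 1 mult_char_0_iff[OF mult_char_leg] by simp
    ultimately show ?thesis by simp
  next
    case 2
    then obtain w where w: "[w ^ 2 = v] (mod int p)" by (auto simp: QuadRes_def)
    define u where "u = w mod int p"
    have u: "[u ^ 2 = v] (mod int p)" using w unfolding u_def cong_def by (simp add: power_mod)
    have ur: "u \<in> {0..<int p}" using gt2 by (simp add: u_def)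
    have nd: "\<not> int p dvd u"
    proof
      assume "int p dvd u"
      then have "int p dvd u ^ 2" by (simp add: power2_eq_square)
      then show False using u 2 cong_dvd_iff by blast
    qed
    then have u0: "u \<noteq> 0" by auto
    have "?S = {u, int p - u}"
    proof (intro equalityI subsetI)
      fix t assume t: "t \<in> ?S"
      then have "[t ^ 2 = u ^ 2] (mod int p)" using u by (simp add: cong_def)
      then have "int p dvd (t - u) * (t + u)" by (simp add: cong_iff_dvd_diff power2_eq_square algebra_simps)
      then have "int p dvd t - u \<or> int p dvd t + u" using prime_int prime_dvd_mult_iff by blast
      then show "t \<in> {u, int p - u}"
      proof
        assume "int p dvd t - u"
        then have "[t = u] (mod int p)" by (simp add: cong_iff_dvd_diff)
        then show ?thesis using t ur by (simp add: cong_def)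
      next
        assume "int p dvd t + u"
        then have "int p dvd t + u - int p" by (simp only: dvd_diff dvd_refl)
        moreover have "t - (int p - u) = t + u - int p" by simp
        ultimately have "t mod int p = (int p - u) mod int p" by (simp only: mod_eq_dvd_iff)
        moreover have "(int p - u) mod int p = int p - u" using ur u0 by (intro mod_pos_pos_trivial) auto
        moreover have "t mod int p = t" using t by (intro mod_pos_pos_trivial) auto
        ultimately show ?thesis by simp
      qed
    next
      fix t assume "t \<in> {u, int p - u}"
      moreover have "[(int p - u) ^ 2 = u ^ 2] (mod int p)"
        by (simp add: cong_iff_dvd_diff power2_eq_square algebra_simps)
      ultimately show "t \<in> ?S" using u ur u0 by (auto simp: cong_def)
    qed
    moreover have "u \<noteq> int p - u"
    proof
      assume "u = int p - u"
      then have "int p dvd 2 * u" by (metis add_diff_cancel_left' diff_add_cancel dvd_refl mult_2)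
      then show False using nd not_dvd_2 prime_int prime_dvd_mult_iff by blast
    qed
    moreover have "leg v = 1" using 2 by (simp add: leg_def Legendre_def cong_0_iff)
    ultimately show ?thesis by simp
  next
    case 3
    then have "?S = {}" by (auto simp: QuadRes_def cong_def)
    moreover have "leg v = - 1" using 3 by (simp add: leg_def Legendre_def cong_0_iff)
    ultimately show ?thesis by (simp only: card.empty of_nat_0) simp
  qed
qed

lemma res_sum_squares:
  assumes g: "periodic g"
  shows "res_sum (\<lambda>u. g (u ^ 2)) = res_sum (\<lambda>v. (1 + leg v) * g v)"
proof -
  let ?I = "{0..<int p}"
  have "res_sum (\<lambda>u. g (u ^ 2)) = (\<Sum>u\<in>?I. g (u ^ 2 mod int p))"
    by (simp only: res_sum_def periodic_mod[OF g])
  also have "\<dots> = (\<Sum>v\<in>?I. \<Sum>u\<in>{u \<in> ?I. u ^ 2 mod int p = v}. g (u ^ 2 mod int p))"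
    by (rule sum.group[symmetric]) (use gt2 in auto)
  also have "\<dots> = (\<Sum>v\<in>?I. (1 + leg v) * g v)"
  proof (intro sum.cong refl)
    fix v assume v: "v \<in> ?I"
    have "(\<Sum>u\<in>{u \<in> ?I. u ^ 2 mod int p = v}. g (u ^ 2 mod int p)) = (\<Sum>u\<in>{u \<in> ?I. u ^ 2 mod int p = v mod int p}. g v)"
      using v by (intro sum.cong) auto
    then show "(\<Sum>u\<in>{u \<in> ?I. u ^ 2 mod int p = v}. g (u ^ 2 mod int p)) = (1 + leg v) * g v"
      by (simp only: sum_constant card_square_roots)
  qed
  finally show ?thesis by (simp add: res_sum_def)
qed

lemma Jac_self:
  assumes a: "mult_char a" and nt: "nontrivial a"
  shows "Jac a a = cnj (a 4) * Jac a leg"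
proof -
  have nd4: "\<not> int p dvd 4"
  proof
    assume "int p dvd 4"
    then have "int p dvd 2 * 2" by simp
    then show False using not_dvd_2 prime_int prime_dvd_mult_iff by blast
  qed
  note per = mult_char_periodic[OF a]
  have sq: "periodic (\<lambda>u. a (1 - u ^ 2))"
    unfolding periodic_def by (meson cong_diff cong_pow cong_refl periodicD[OF per])
  have "a 4 * Jac a a = res_sum (\<lambda>x. a (1 - (2 * x + (- 1)) ^ 2))"
  proof -
    have "a 4 * (a x * a (1 - x)) = a (1 - (2 * x + (- 1)) ^ 2)" for x
    proof -
      have "1 - (2 * x + (- 1)) ^ 2 = 4 * (x * (1 - x))" by (simp add: power2_eq_square algebra_simps)
      then show ?thesis by (simp only: mult_char_mult[OF a])
    qed
    then show ?thesis by (simp only: Jac_def res_sum_def sum_distrib_left)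
  qed
  also have "\<dots> = res_sum (\<lambda>u. a (1 - u ^ 2))"
    by (rule res_sum_affine[OF sq not_dvd_2])
  also have "\<dots> = res_sum (\<lambda>v. (1 + leg v) * a (1 - v))"
    by (rule res_sum_squares[OF periodic_comp_diff[OF per]])
  also have "\<dots> = res_sum (\<lambda>v. a (1 - v)) + Jac leg a"
    by (simp add: Jac_def res_sum_def sum.distrib distrib_right)
  also have "res_sum (\<lambda>v. a (1 - v)) = 0"
    using res_sum_reflect[OF per, of 1] res_sum_nontrivial[OF a nt] by simp
  finally have "a 4 * Jac a a = Jac a leg"
    using Jac_commute[OF mult_char_leg a] by simp
  then have "cnj (a 4) * (a 4 * Jac a a) = cnj (a 4) * Jac a leg" by simp
  then show ?thesis
    using mult_char_cnj_mult(2)[OF a nd4] by (simp flip: mult.assoc)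
qed

lemma quadratic_char_unique:
  assumes a: "mult_char a" and sq: "\<And>x. \<not> int p dvd x \<Longrightarrow> a x ^ 2 = 1" and nt: "nontrivial a"
  shows "a = leg"
proof
  obtain z where z: "\<not> int p dvd z" "a z \<noteq> 1" using nt by (auto simp: nontrivial_def)
  have res: "a x = 1" if nd: "\<not> int p dvd x" and qr: "QuadRes (int p) x" for x
  proof -
    obtain u where u: "[u ^ 2 = x] (mod int p)" using qr by (auto simp: QuadRes_def)
    then have "\<not> int p dvd u"
      using nd cong_dvd_iff[OF u] by (auto simp: power2_eq_square)
    then show ?thesis
      using sq[of u] periodicD[OF mult_char_periodic[OF a] u] by (simp add: mult_char_power[OF a])
  qed
  have leg1: "leg x = 1 \<longleftrightarrow> QuadRes (int p) x" if "\<not> int p dvd x" for x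
    using that by (simp add: leg_def Legendre_def cong_0_iff)
  have legz: "leg z = - 1" using res[OF z(1)] z leg1[OF z(1)] leg_cases[of z] mult_char_0_iff[OF mult_char_leg, of z] by auto
  have az: "a z = - 1" using sq[OF z(1)] z(2) by (auto simp: power2_eq_1_iff)
  fix x
  show "a x = leg x"
  proof (cases "int p dvd x")
    case True
    then show ?thesis using mult_char_0_iff[OF a] mult_char_0_iff[OF mult_char_leg] by metis
  next
    case False
    show ?thesis
    proof (cases "leg x = 1")
      case True
      then show ?thesis using res[OF False] leg1[OF False] by simp
    next
      case 2: False
      then have lx: "leg x = - 1" using leg_cases[of x] mult_char_0_iff[OF mult_char_leg, of x] False by auto
      have nd: "\<not> int p dvd x * z" using False z(1) prime_int prime_dvd_mult_iff by blast
      have "leg (x * z) = 1" using lx legz by (simp add: mult_char_mult[OF mult_char_leg])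
      then have "a (x * z) = 1" using res[OF nd] leg1[OF nd] by simp
      then show ?thesis using az lx by (simp add: mult_char_mult[OF a]) (metis minus_minus)
    qed
  qed
qed

lemma nontrivial_leg: "nontrivial leg"
proof (rule ccontr)
  assume "\<not> nontrivial leg"
  then have 1: "leg x = (if int p dvd x then 0 else 1)" for x
    using mult_char_0_iff[OF mult_char_leg] by (auto simp: nontrivial_def)
  have "res_sum (\<lambda>u. 1) = res_sum (\<lambda>v. (1 + leg v) * 1)"
    using res_sum_squares[OF periodic_const[of 1]] by simp
  also have "\<dots> = res_sum (\<lambda>v. 1) + res_sum leg"
    by (simp add: res_sum_def sum.distrib)
  finally have "res_sum leg = 0" by simp
  moreover have "res_sum leg = of_nat (card {v \<in> {0..<int p}. \<not> int p dvd v})"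
    by (simp add: res_sum_def 1 sum.If_cases Int_def)
  moreover have "card {v \<in> {0..<int p}. \<not> int p dvd v} > 0"
    using gt2 by (subst card_gt_0_iff) (auto intro!: exI[of _ 1] finite_subset[of _ "{0..<int p}"])
  ultimately show False by simp
qed

text \<open>Jacobi sums of a cubic character.\<close>

lemma cubic_char_values:
  assumes cube: "\<forall>x. \<not> int p dvd x \<longrightarrow> a x ^ 3 = 1" and x: "\<not> int p dvd x"
  shows "a x = 1 \<or> a x = omega \<or> a x = omega ^ 2"
  using cube_roots_of_unity[OF cube[rule_format, OF x]] .

lemma cubic_char_eisenstein:
  assumes a: "mult_char a" and cube: "\<forall>x. \<not> int p dvd x \<longrightarrow> a x ^ 3 = 1"
  shows "a x \<in> eisenstein"
proof (cases "int p dvd x")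
  case True
  then show ?thesis using mult_char_0_iff[OF a, of x] eisenstein_of_int[of 0] by simp
next
  case False
  have "1 \<in> eisenstein" "omega ^ 2 \<in> eisenstein"
    using eisenstein_of_int[of 1] eisenstein_mult[OF eisenstein_omega eisenstein_omega] by (simp_all add: power2_eq_square)
  then show ?thesis
    using cubic_char_values[OF cube False] eisenstein_omega by auto
qed

lemma Jac_cubic_cubic:
  assumes a: "mult_char a" and cube: "\<forall>x. \<not> int p dvd x \<longrightarrow> a x ^ 3 = 1" and nt: "nontrivial a"
    and p3: "p mod 3 = 1"
  obtains L N :: int where "4 * int p = L ^ 2 + 3 * N ^ 2" "3 dvd N" "L mod 3 = 1" "2 * Re (Jac a a) = of_int L"
proof -
  have "\<exists>e\<in>eisenstein. (a x - 1) * (a (1 - x) - 1) = 3 * e" for x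
  proof -
    have e3: "(omega - 1) * (omega - 1) = 3 * - omega" "(omega - 1) * (omega ^ 2 - 1) = 3 * 1"
      "(omega ^ 2 - 1) * (omega - 1) = 3 * 1" "(omega ^ 2 - 1) * (omega ^ 2 - 1) = 3 * - (omega ^ 2)"
    proof -
      have s: "(omega - 1) * (omega - 1) = omega ^ 2 - 2 * omega + 1"
        "(omega - 1) * (omega ^ 2 - 1) = omega ^ 3 - omega ^ 2 - omega + 1"
        "(omega ^ 2 - 1) * (omega ^ 2 - 1) = omega ^ 3 * omega - 2 * omega ^ 2 + 1"
        by (simp_all add: eval_nat_numeral algebra_simps)
      show "(omega - 1) * (omega - 1) = 3 * - omega" "(omega - 1) * (omega ^ 2 - 1) = 3 * 1"
        "(omega ^ 2 - 1) * (omega ^ 2 - 1) = 3 * - (omega ^ 2)"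
        unfolding s by (simp_all add: omega_cube omega_sq)
      then show "(omega ^ 2 - 1) * (omega - 1) = 3 * 1" by (simp only: mult.commute)
    qed
    have in_e: "0 \<in> eisenstein" "1 \<in> eisenstein" "- omega \<in> eisenstein" "- (omega ^ 2) \<in> eisenstein"
      using eisenstein_of_int[of 0] eisenstein_of_int[of 1] eisensteinI[of "- omega" 0 "-1"] eisensteinI[of "- (omega ^ 2)" 1 1]
      by (simp_all add: omega_sq)
    show ?thesis
    proof (cases "int p dvd x \<or> int p dvd 1 - x")
      case True
      then have "a x = 1 \<or> a (1 - x) = 1"
        using periodicD[OF mult_char_periodic[OF a], of "1 - x" 1] periodicD[OF mult_char_periodic[OF a], of x 1] mult_char_1[OF a]
        by (auto simp: cong_iff_dvd_diff dvd_diff_commute)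
      then show ?thesis using in_e(1) by auto
    next
      case False
      then have "a x = 1 \<or> a x = omega \<or> a x = omega ^ 2" "a (1 - x) = 1 \<or> a (1 - x) = omega \<or> a (1 - x) = omega ^ 2"
        using cubic_char_values[OF cube] by auto
      then show ?thesis using e3 in_e by (elim disjE) (auto simp del: mult_minus_right)
    qed
  qed
  then obtain e where e: "\<And>x. e x \<in> eisenstein" "\<And>x. (a x - 1) * (a (1 - x) - 1) = 3 * e x" by metis
  obtain c d where cd: "sum e {0..<int p} = of_int c + of_int d * omega"
    using eisenstein_sum[of "{0..<int p}" e] e(1) by (auto simp: eisenstein_def)
  have "res_sum (\<lambda>x. (a x - 1) * (a (1 - x) - 1)) = Jac a a - res_sum a - res_sum (\<lambda>x. a (1 - x)) + of_nat p"
    by (simp add: Jac_def res_sum_def algebra_simps sum.distrib sum_subtractf)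
  also have "\<dots> = Jac a a + of_nat p"
    using res_sum_nontrivial[OF a nt] res_sum_reflect[OF mult_char_periodic[OF a], of 1] by simp
  finally have "Jac a a + of_nat p = 3 * (of_int c + of_int d * omega)"
    unfolding res_sum_def e(2) by (simp add: cd flip: sum_distrib_left)
  then have J: "Jac a a = of_int (3 * c - int p) + of_int (3 * d) * omega"
    by (simp add: algebra_simps)
  have nt2: "nontrivial (\<lambda>x. a x * a x)"
  proof -
    obtain x where x: "\<not> int p dvd x" "a x \<noteq> 1" using nt by (auto simp: nontrivial_def)
    have "a x * a x \<noteq> 1"
    proof
      assume "a x * a x = 1"
      then have "a x ^ 3 = a x" by (simp add: power3_eq_cube)
      then show False using cube[rule_format, OF x(1)] x(2) by simp
    qed
    then show ?thesis using x(1) by (auto simp: nontrivial_def)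
  qed
  have "of_int ((3 * c - int p) ^ 2 - (3 * c - int p) * (3 * d) + (3 * d) ^ 2) = (of_int (int p) :: complex)"
    using Jac_norm_sq[OF a a nt nt nt2] unfolding J norm_eisenstein by simp
  then have N: "(3 * c - int p) ^ 2 - (3 * c - int p) * (3 * d) + (3 * d) ^ 2 = int p"
    by (simp only: of_int_eq_iff)
  show ?thesis
  proof (rule that[of "2 * (3 * c - int p) - 3 * d" "3 * d"])
    show "4 * int p = (2 * (3 * c - int p) - 3 * d) ^ 2 + 3 * (3 * d) ^ 2"
      by (rule four_norm_eisenstein[OF N, symmetric])
    have "int p mod 3 = 1" using p3 by (metis of_nat_1 of_nat_mod of_nat_numeral)
    then show "(2 * (3 * c - int p) - 3 * d) mod 3 = 1" by presburger
    show "2 * Re (Jac a a) = of_int (2 * (3 * c - int p) - 3 * d)"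
      unfolding J by (simp add: Re_omega)
  qed simp
qed

lemma Jac_cubic_leg:
  assumes a: "mult_char a" and cube: "\<forall>x. \<not> int p dvd x \<longrightarrow> a x ^ 3 = 1" and nt: "nontrivial a"
  obtains x y :: int where "int p = x ^ 2 + 3 * y ^ 2" "odd (x + y)" "(x + 1) mod 3 = 0" "Re (Jac a leg) = of_int x"
proof -
  define s where "s u = leg u + (if int p dvd u then 1 else 0)" for u
  have s: "s u = 1 \<or> s u = - 1" for u
    using leg_cases[of u] mult_char_0_iff[OF mult_char_leg, of u] by (auto simp: s_def)
  have "\<exists>e\<in>eisenstein. a u * (s (1 - u) - 1) = 2 * e" for u
  proof (cases "s (1 - u) = 1")
    case True
    then show ?thesis using eisenstein_of_int[of 0] by (intro bexI[of _ 0]) auto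
  next
    case False
    then have "s (1 - u) = - 1" using s by blast
    then show ?thesis
      using eisenstein_mult[OF eisenstein_of_int[of "-1"] cubic_char_eisenstein[OF a cube], of u]
      by (intro bexI[of _ "- a u"]) auto
  qed
  then obtain e where e: "\<And>u. e u \<in> eisenstein" "\<And>u. a u * (s (1 - u) - 1) = 2 * e u" by metis
  obtain c d where cd: "sum e {0..<int p} = of_int c + of_int d * omega"
    using eisenstein_sum[of "{0..<int p}" e] e(1) by (auto simp: eisenstein_def)
  have delta: "(\<Sum>u\<in>{0..<int p}. f u * (if int p dvd 1 - u then 1 else 0)) = f 1" for f :: "int \<Rightarrow> complex"
  proof -
    have "(\<Sum>u\<in>{0..<int p}. f u * (if int p dvd 1 - u then 1 else 0)) = (\<Sum>u\<in>{0..<int p}. if u = 1 then f u else 0)"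
    proof (intro sum.cong refl)
      fix u assume u: "u \<in> {0..<int p}"
      have "int p dvd 1 - u \<longleftrightarrow> [u = 1] (mod int p)" by (simp add: cong_iff_dvd_diff dvd_diff_commute)
      also have "\<dots> \<longleftrightarrow> u = 1" using u gt2 by (simp add: cong_def)
      finally show "f u * (if int p dvd 1 - u then 1 else 0) = (if u = 1 then f u else 0)" by simp
    qed
    then show ?thesis using gt2 by simp
  qed
  have "res_sum (\<lambda>u. a u * (s (1 - u) - 1)) = Jac a leg + (\<Sum>u\<in>{0..<int p}. a u * (if int p dvd 1 - u then 1 else 0)) - res_sum a"
    by (simp add: Jac_def res_sum_def s_def right_diff_distrib distrib_left sum.distrib sum_subtractf)
  also have "\<dots> = Jac a leg + 1"
    using res_sum_nontrivial[OF a nt] mult_char_1[OF a] by (simp only: delta) simp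
  finally have "Jac a leg + 1 = 2 * (of_int c + of_int d * omega)"
    unfolding res_sum_def e(2) by (simp add: cd flip: sum_distrib_left)
  then have J: "Jac a leg = of_int (2 * c - 1) + of_int (2 * d) * omega"
    by (simp add: algebra_simps)
  have ntal: "nontrivial (\<lambda>x. a x * leg x)"
  proof (rule ccontr)
    assume "\<not> ?thesis"
    then have al: "a x * leg x = 1" if "\<not> int p dvd x" for x using that by (auto simp: nontrivial_def)
    obtain x where x: "\<not> int p dvd x" "a x \<noteq> 1" using nt by (auto simp: nontrivial_def)
    have "a x = a x * (leg x * leg x)" using leg_square[OF x(1)] by simp
    also have "\<dots> = leg x" using al[OF x(1)] by (simp flip: mult.assoc)
    finally have "a x = leg x" .
    then have "a x = - 1" using x leg_cases[of x] mult_char_0_iff[OF a, of x] by auto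
    then show False using cube[rule_format, OF x(1)] by simp
  qed
  have "of_int ((2 * c - 1) ^ 2 - (2 * c - 1) * (2 * d) + (2 * d) ^ 2) = (of_int (int p) :: complex)"
    using Jac_norm_sq[OF a mult_char_leg nt nontrivial_leg ntal] unfolding J norm_eisenstein by simp
  then have N: "(2 * c - 1) ^ 2 - (2 * c - 1) * (2 * d) + (2 * d) ^ 2 = int p"
    by (simp only: of_int_eq_iff)
  have "\<exists>k :: int. Re (a u * leg (1 - u)) * 2 = Re (2 * leg (1 - u) - 2 * (leg (1 - u) * (if int p dvd u then 1 else 0))) - 3 * of_int k" for u
  proof (cases "int p dvd u")
    case True
    then show ?thesis using mult_char_0_iff[OF a, of u] by (intro exI[of _ 0]) simp
  next
    case False
    obtain l :: int where l: "leg (1 - u) = of_int l" by (auto simp: leg_def)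
    from cubic_char_values[OF cube False] show ?thesis
    proof (elim disjE)
      assume "a u = 1"
      then show ?thesis using False by (intro exI[of _ 0]) simp
    next
      assume "a u = omega"
      then show ?thesis using False by (intro exI[of _ l]) (simp add: l Re_omega)
    next
      assume "a u = omega ^ 2"
      then show ?thesis using False by (intro exI[of _ l]) (simp add: l Re_omega)
    qed
  qed
  then obtain k :: "int \<Rightarrow> int" where k: "\<And>u. Re (a u * leg (1 - u)) * 2 = Re (2 * leg (1 - u) - 2 * (leg (1 - u) * (if int p dvd u then 1 else 0))) - 3 * of_int (k u)"
    by metis
  have "2 * Re (Jac a leg) = (\<Sum>u\<in>{0..<int p}. Re (a u * leg (1 - u)) * 2)"
    by (simp add: Jac_def res_sum_def sum_distrib_left mult.commute)
  also have "\<dots> = Re (\<Sum>u\<in>{0..<int p}. 2 * leg (1 - u) - 2 * (leg (1 - u) * (if int p dvd u then 1 else 0))) - 3 * of_int (sum k {0..<int p})"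
    unfolding k by (simp add: sum_subtractf sum_distrib_left)
  also have "(\<Sum>u\<in>{0..<int p}. 2 * leg (1 - u) - 2 * (leg (1 - u) * (if int p dvd u then 1 else 0))) =
     2 * res_sum (\<lambda>u. leg (1 - u)) - 2 * (\<Sum>u\<in>{0..<int p}. if u = 0 then leg (1 - u) else 0)"
  proof -
    have "(\<Sum>u\<in>{0..<int p}. leg (1 - u) * (if int p dvd u then 1 else 0)) = (\<Sum>u\<in>{0..<int p}. if u = 0 then leg (1 - u) else 0)"
      by (intro sum.cong refl) (simp add: dvd_residue_iff)
    then show ?thesis by (simp add: sum_subtractf res_sum_def flip: sum_distrib_left)
  qed
  also have "\<dots> = - 2"
    using res_sum_reflect[OF mult_char_periodic[OF mult_char_leg], of 1] res_sum_nontrivial[OF mult_char_leg nontrivial_leg]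
      mult_char_1[OF mult_char_leg] gt2 by simp
  finally have re: "2 * Re (Jac a leg) = - 2 - 3 * of_int (sum k {0..<int p})" by simp
  have x: "Re (Jac a leg) = of_int (2 * c - 1 - d)"
    unfolding J by (simp add: Re_omega)
  have "real_of_int (2 * (2 * c - 1 - d)) = of_int (- 2 - 3 * sum k {0..<int p})"
    using re x by simp
  then have m: "2 * (2 * c - 1 - d) = - 2 - 3 * sum k {0..<int p}"
    by (simp only: of_int_eq_iff)
  show ?thesis
  proof (rule that[of "2 * c - 1 - d" d])
    show "int p = (2 * c - 1 - d) ^ 2 + 3 * d ^ 2"
      using N by (simp add: power2_eq_square algebra_simps)
    show "(2 * c - 1 - d + 1) mod 3 = 0" using m by presburger
  qed (use x in auto)
qed

end


lemma prime_not_square_int: "prime p \<Longrightarrow> x ^ 2 \<noteq> int p"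
proof
  assume p: "prime p" and x: "x ^ 2 = int p"
  then have "int p dvd x ^ 2" by simp
  then have "int p dvd x" using p prime_dvd_power[of "int p" x 2] by simp
  then obtain k where k: "x = int p * k" by blast
  then have "int p * (int p * k ^ 2) = int p * 1" using x by (simp add: power2_eq_square algebra_simps)
  then have "int p * k ^ 2 = 1" using p by (simp only: mult_cancel_left) (auto simp: prime_gt_0_nat)
  then have "int p dvd 1" by (metis dvd_triv_left)
  then show False using prime_gt_1_nat[OF p] by simp
qed

lemma norm_form_unique_aux:
  fixes X Y L N :: int
  assumes p: "prime p" and XY: "X ^ 2 + 3 * Y ^ 2 = 4 * int p" and LN: "L ^ 2 + 3 * N ^ 2 = 4 * int p"
    and dv: "int p dvd X * N - Y * L"
  shows "\<exists>e\<in>{1, - 1}. \<exists>f\<in>{1, - 1}. (X = e * L \<and> Y = f * N) \<or> (2 * X = e * (L + 3 * N) \<and> 2 * Y = f * (L - N))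
    \<or> (2 * X = e * (L - 3 * N) \<and> 2 * Y = f * (L + N))"
proof -
  have p0: "int p > 0" using prime_gt_0_nat[OF p] by simp
  obtain t where t: "X * N - Y * L = int p * t" using dv by blast
  have id: "(X * L + 3 * Y * N) ^ 2 + 3 * (X * N - Y * L) ^ 2 = (X ^ 2 + 3 * Y ^ 2) * (L ^ 2 + 3 * N ^ 2)"
    by (simp add: power2_eq_square algebra_simps)
  then have U2: "(X * L + 3 * Y * N) ^ 2 = int p * (int p * (16 - 3 * t ^ 2))"
    unfolding XY LN t by (simp add: power2_eq_square algebra_simps)
  then have "int p dvd (X * L + 3 * Y * N) ^ 2" by simp
  then have "int p dvd X * L + 3 * Y * N" using p prime_dvd_power[of "int p"] by simp
  then obtain u where u: "X * L + 3 * Y * N = int p * u" by blast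
  have "int p ^ 2 * u ^ 2 = int p ^ 2 * (16 - 3 * t ^ 2)"
    using U2 unfolding u by (simp add: power2_eq_square algebra_simps)
  then have ut: "u ^ 2 + 3 * t ^ 2 = 16" using p0 by simp
  have "4 * int p * X = (L ^ 2 + 3 * N ^ 2) * X" using LN by simp
  also have "\<dots> = (X * L + 3 * Y * N) * L + 3 * (X * N - Y * L) * N"
    by (simp add: power2_eq_square algebra_simps)
  also have "\<dots> = int p * (u * L + 3 * t * N)" unfolding u t by (simp add: algebra_simps)
  finally have X4: "4 * X = u * L + 3 * t * N" using p0 by simp
  have "4 * int p * Y = (L ^ 2 + 3 * N ^ 2) * Y" using LN by simp
  also have "\<dots> = (X * L + 3 * Y * N) * N - (X * N - Y * L) * L"
    by (simp add: power2_eq_square algebra_simps)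
  also have "\<dots> = int p * (u * N - t * L)" unfolding u t by (simp add: algebra_simps)
  finally have Y4: "4 * Y = u * N - t * L" using p0 by simp
  have "t ^ 2 \<le> 2 ^ 2 \<Longrightarrow> \<bar>t\<bar> \<le> 2" "u ^ 2 \<le> 4 ^ 2 \<Longrightarrow> \<bar>u\<bar> \<le> 4"
    using abs_le_square_iff[of t 2] abs_le_square_iff[of u 4] by auto
  moreover have "t ^ 2 \<le> 2 ^ 2"
  proof (rule ccontr)
    assume "\<not> t ^ 2 \<le> 2 ^ 2"
    then have "\<bar>t\<bar> \<ge> 3" using abs_le_square_iff[of t 2] by auto
    then have "t ^ 2 \<ge> 3 ^ 2" using abs_le_square_iff[of 3 t] by auto
    then show False using ut zero_le_power2[of u] by simp
  qed
  moreover have "u ^ 2 \<le> 4 ^ 2"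
  proof -
    have "(4 :: int) ^ 2 = 16" by simp
    then show ?thesis using ut zero_le_power2[of t] by linarith
  qed
  ultimately have "t \<in> {-2..2}" "u \<in> {-4..4}" by auto
  then have "t \<in> {-2, -1, 0, 1, 2}" "u \<in> {-4, -3, -2, -1, 0, 1, 2, 3, 4}" by auto
  with ut have "(t = 0 \<and> u = 4) \<or> (t = 0 \<and> u = - 4) \<or> (t = 2 \<and> u = 2) \<or> (t = 2 \<and> u = - 2) \<or> (t = - 2 \<and> u = 2) \<or> (t = - 2 \<and> u = - 2)"
    by (elim insertE emptyE) simp_all
  then show ?thesis
  proof (elim disjE conjE)
    assume "t = 0" "u = 4" then show ?thesis using X4 Y4 by (rule_tac bexI[where x = 1], rule_tac bexI[where x = 1]) simp_all
  next
    assume "t = 0" "u = - 4" then show ?thesis using X4 Y4 by (rule_tac bexI[where x = "- 1"], rule_tac bexI[where x = "- 1"]) simp_all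
  next
    assume "t = 2" "u = 2" then have "2 * X = L + 3 * N" "2 * Y = - (L - N)" using X4 Y4 by simp_all
    then show ?thesis by (rule_tac bexI[where x = 1], rule_tac bexI[where x = "- 1"]) simp_all
  next
    assume "t = 2" "u = - 2" then have "2 * X = - (L - 3 * N)" "2 * Y = - (L + N)" using X4 Y4 by simp_all
    then show ?thesis by (rule_tac bexI[where x = "- 1"], rule_tac bexI[where x = "- 1"]) simp_all
  next
    assume "t = - 2" "u = 2" then have "2 * X = L - 3 * N" "2 * Y = L + N" using X4 Y4 by simp_all
    then show ?thesis by (rule_tac bexI[where x = 1], rule_tac bexI[where x = 1]) simp_all
  next
    assume "t = - 2" "u = - 2" then have "2 * X = - (L + 3 * N)" "2 * Y = L - N" using X4 Y4 by simp_all
    then show ?thesis by (rule_tac bexI[where x = "- 1"], rule_tac bexI[where x = 1]) simp_all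
  qed
qed

lemma norm_form_unique:
  fixes X Y L N :: int
  assumes p: "prime p" and XY: "X ^ 2 + 3 * Y ^ 2 = 4 * int p" and LN: "L ^ 2 + 3 * N ^ 2 = 4 * int p"
  shows "\<exists>e\<in>{1, - 1}. \<exists>f\<in>{1, - 1}. (X = e * L \<and> Y = f * N) \<or> (2 * X = e * (L + 3 * N) \<and> 2 * Y = f * (L - N))
    \<or> (2 * X = e * (L - 3 * N) \<and> 2 * Y = f * (L + N))"
proof -
  have "(X * N - Y * L) * (X * N - Y * (- L)) = (X ^ 2 + 3 * Y ^ 2) * N ^ 2 - Y ^ 2 * (L ^ 2 + 3 * N ^ 2)"
    by (simp add: power2_eq_square algebra_simps)
  also have "\<dots> = int p * (4 * N ^ 2 - 4 * Y ^ 2)" unfolding XY LN by (simp add: algebra_simps)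
  finally have "int p dvd (X * N - Y * L) * (X * N - Y * (- L))" by simp
  then have "int p dvd X * N - Y * L \<or> int p dvd X * N - Y * (- L)"
    using p prime_dvd_mult_iff[of "int p"] by simp
  then show ?thesis
  proof
    assume "int p dvd X * N - Y * L"
    then show ?thesis by (rule norm_form_unique_aux[OF p XY LN])
  next
    assume d: "int p dvd X * N - Y * (- L)"
    have LN': "L ^ 2 + 3 * (- N) ^ 2 = 4 * int p" using LN by simp
    have d': "int p dvd X * (- N) - Y * L"
    proof -
      have "X * (- N) - Y * L = - (X * N - Y * (- L))" by simp
      then show ?thesis using d by (simp only: dvd_minus_iff)
    qed
    obtain e f where ef: "e \<in> {1, - 1}" "f \<in> {1, - 1}"
      "(X = e * L \<and> Y = f * - N) \<or> (2 * X = e * (L + 3 * - N) \<and> 2 * Y = f * (L - - N))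
        \<or> (2 * X = e * (L - 3 * - N) \<and> 2 * Y = f * (L + - N))"
      using norm_form_unique_aux[OF p XY LN' d'] by blast
    from ef(3) show ?thesis
    proof (elim disjE)
      assume "X = e * L \<and> Y = f * - N"
      then show ?thesis using ef(1,2) by (intro bexI[of _ e] bexI[of _ "- f"]) auto
    next
      assume "2 * X = e * (L + 3 * - N) \<and> 2 * Y = f * (L - - N)"
      then show ?thesis using ef(1,2) by (intro bexI[of _ e] bexI[of _ f]) auto
    next
      assume "2 * X = e * (L - 3 * - N) \<and> 2 * Y = f * (L + - N)"
      then show ?thesis using ef(1,2) by (intro bexI[of _ e] bexI[of _ f]) auto
    qed
  qed
qed

lemma norm_form_cases:
  fixes X Y L N :: int
  assumes "prime p" "X ^ 2 + 3 * Y ^ 2 = 4 * int p" "L ^ 2 + 3 * N ^ 2 = 4 * int p"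
  obtains (same) "X = L \<or> X = - L" "Y = N \<or> Y = - N"
    | (plus) "2 * X = L + 3 * N \<or> 2 * X = - (L + 3 * N)" "2 * Y = L - N \<or> 2 * Y = - (L - N)"
    | (minus) "2 * X = L - 3 * N \<or> 2 * X = - (L - 3 * N)" "2 * Y = L + N \<or> 2 * Y = - (L + N)"
proof -
  obtain e f where ef: "e = 1 \<or> e = - 1" "f = 1 \<or> f = - 1"
    "(X = e * L \<and> Y = f * N) \<or> (2 * X = e * (L + 3 * N) \<and> 2 * Y = f * (L - N))
        \<or> (2 * X = e * (L - 3 * N) \<and> 2 * Y = f * (L + N))"
    using norm_form_unique[OF assms] by blast
  have m: "e * z = z \<or> e * z = - z" "f * z = z \<or> f * z = - z" for z
    using ef(1,2) by auto
  from ef(3) show ?thesis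
    by (elim disjE conjE) (metis m same, metis m plus, metis m minus)
qed

lemma minus_one_powi: "(- 1 :: complex) powi k = (if even k then 1 else - 1)" for k :: int
  by (simp add: power_int_def) (auto simp: even_nat_iff)

lemma mod3_0I: "b = 3 * c \<Longrightarrow> b mod 3 = 0"
  and mod3_1I: "b = 1 + 3 * c \<Longrightarrow> b mod 3 = 1"
  and mod3_2I: "b = 2 + 3 * c \<Longrightarrow> b mod 3 = 2" for b c :: int
  by simp_all

lemma sign_pos_mod3: "X = Z \<or> X = - Z \<Longrightarrow> X mod 3 = 1 \<Longrightarrow> Z mod 3 = 1 \<Longrightarrow> X = Z"
  and sign_neg_mod3: "X = Z \<or> X = - Z \<Longrightarrow> X mod 3 = 1 \<Longrightarrow> Z mod 3 = 2 \<Longrightarrow> X = - Z" for X Z :: int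
  by presburger+

lemma fourier_coeff_36_prime:
  fixes x y :: int
  assumes p: "prime p" and xy: "int p = x ^ 2 + 3 * y ^ 2" "odd (x + y)" "(x + 1) mod 3 = 0"
  shows "fourier_coeff f_36_2_a_a p = - 2 * of_int x"
proof -
  have "3 dvd x + 1" using xy(3) by (simp add: dvd_eq_mod_eq_0)
  then obtain m where m: "x + 1 = 3 * m" by (rule dvdE)
  have "even (m + y)" using xy(2) m by presburger
  then obtain j where j: "m + y = 2 * j" by (rule evenE)
  have k1: "6 * (- j) + 1 = - (x + 3 * y)" and k2: "6 * (y - j) + 1 = - (x - 3 * y)"
    using m j by (smt (verit))+
  define d1 d2 where "d1 = (x - y) div 2" and "d2 = (x + y) div 2"
  have "odd (x - y)" using xy(2) by simp
  then have d1: "2 * d1 + 1 = x - y" unfolding d1_def by (rule odd_two_times_div_two_succ)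
  have d2: "2 * d2 + 1 = x + y" unfolding d2_def using xy(2) by (rule odd_two_times_div_two_succ)
  have y0: "y \<noteq> 0"
  proof
    assume "y = 0"
    then have "x ^ 2 = int p" using xy(1) by simp
    then show False using prime_not_square_int[OF p] by blast
  qed
  let ?S = "{(k, d). (6 * k + 1) ^ 2 + 3 * (2 * d + 1) ^ 2 = 4 * int p}"
  have base: "(2 * x) ^ 2 + 3 * (2 * y) ^ 2 = 4 * int p"
    unfolding xy(1) by (simp add: power2_eq_square)
  have S: "?S = {(- j, d1), (- j, - 1 - d1), (y - j, d2), (y - j, - 1 - d2)}"
  proof (intro equalityI subsetI)
    fix q assume "q \<in> ?S"
    then obtain k d where q: "q = (k, d)" and kd: "(6 * k + 1) ^ 2 + 3 * (2 * d + 1) ^ 2 = 4 * int p" by blast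
    from p kd base show "q \<in> {(- j, d1), (- j, - 1 - d1), (y - j, d2), (y - j, - 1 - d2)}"
    proof (cases rule: norm_form_cases)
      case same
      have False using same(1) by presburger
      then show ?thesis ..
    next
      case plus
      have "6 * k + 1 = - (x + 3 * y)"
      proof (rule sign_neg_mod3)
        show "6 * k + 1 = x + 3 * y \<or> 6 * k + 1 = - (x + 3 * y)" using plus(1) by (smt (verit))
        show "(6 * k + 1) mod 3 = 1" by (rule mod3_1I[of _ "2 * k"]) simp
        show "(x + 3 * y) mod 3 = 2" by (rule mod3_2I[of _ "m + y - 1"]) (use m in simp)
      qed
      then have "k = - j" using k1 by (smt (verit))
      moreover have "d = d1 \<or> d = - 1 - d1" using plus(2) d1 by (smt (verit))
      ultimately show ?thesis unfolding q by blast
    next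
      case minus
      have "6 * k + 1 = - (x - 3 * y)"
      proof (rule sign_neg_mod3)
        show "6 * k + 1 = x - 3 * y \<or> 6 * k + 1 = - (x - 3 * y)" using minus(1) by (smt (verit))
        show "(6 * k + 1) mod 3 = 1" by (rule mod3_1I[of _ "2 * k"]) simp
        show "(x - 3 * y) mod 3 = 2" by (rule mod3_2I[of _ "m - y - 1"]) (use m in simp)
      qed
      then have "k = y - j" using k2 by (smt (verit))
      moreover have "d = d2 \<or> d = - 1 - d2" using minus(2) d2 by (smt (verit))
      ultimately show ?thesis unfolding q by blast
    qed
  next
    have "(x + 3 * y) ^ 2 + 3 * (x - y) ^ 2 = 4 * int p" "(x - 3 * y) ^ 2 + 3 * (x + y) ^ 2 = 4 * int p"
      unfolding xy(1) by (simp_all add: power2_eq_square algebra_simps)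
    moreover have "2 * (- 1 - d1) + 1 = - (x - y)" "2 * (- 1 - d2) + 1 = - (x + y)" using d1 d2 by (smt (verit))+
    moreover fix q assume "q \<in> {(- j, d1), (- j, - 1 - d1), (y - j, d2), (y - j, - 1 - d2)}"
    ultimately show "q \<in> ?S"
      using k1 k2 d1 d2 by (elim insertE emptyE) (simp_all only: mem_Collect_eq prod.case power2_minus)
  qed
  have dd: "d \<noteq> - 1 - d" for d :: int by (smt (verit))
  define g where "g = (\<lambda>(k :: int, d :: int). (- 1) powi (k + d) * complex_of_int (2 * d + 1))"
  have "infsum g ?S = g (- j, d1) + (g (- j, - 1 - d1) + (g (y - j, d2) + g (y - j, - 1 - d2)))"
    unfolding S using y0 dd by simp
  moreover have "g (- j, d1) = - of_int (x - y)" "g (- j, - 1 - d1) = - of_int (x - y)"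
  proof -
    have "3 * (- j + d1) = x - 3 * y - 2" using k1 d1 by (smt (verit))
    then have o: "odd (- j + d1)" "even (- j + (- 1 - d1))" using xy(2) by presburger+
    have "2 * (- 1 - d1) + 1 = - (x - y)" using d1 by (smt (verit))
    then show "g (- j, - 1 - d1) = - of_int (x - y)"
      unfolding g_def prod.case minus_one_powi if_P[OF o(2)] by simp
    show "g (- j, d1) = - of_int (x - y)"
      unfolding g_def prod.case minus_one_powi if_not_P[OF o(1)] d1 by simp
  qed
  moreover have "g (y - j, d2) = - of_int (x + y)" "g (y - j, - 1 - d2) = - of_int (x + y)"
  proof -
    have "3 * (y - j + d2) = x + 3 * y - 2" using k2 d2 by (smt (verit))
    then have o: "odd (y - j + d2)" "even (y - j + (- 1 - d2))" using xy(2) by presburger+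
    have "2 * (- 1 - d2) + 1 = - (x + y)" using d2 by (smt (verit))
    then show "g (y - j, - 1 - d2) = - of_int (x + y)"
      unfolding g_def prod.case minus_one_powi if_P[OF o(2)] by simp
    show "g (y - j, d2) = - of_int (x + y)"
      unfolding g_def prod.case minus_one_powi if_not_P[OF o(1)] d2 by simp
  qed
  ultimately have "infsum g ?S = - 4 * of_int x" by simp
  then show ?thesis unfolding fourier_coeff_36 g_def by simp
qed

lemma omega_powi_mod: "omega powi n = omega powi (n mod 3)"
proof -
  have "omega powi (3 * (n div 3) + n mod 3) = omega powi (3 * (n div 3)) * omega powi (n mod 3)"
    by (rule power_int_add) simp
  also have "omega powi (3 * (n div 3)) = (omega powi 3) powi (n div 3)"
    by (rule power_int_mult)
  also have "omega powi 3 = 1" using omega_cube by simp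
  finally show ?thesis by simp
qed

lemma omega_powi_cong: "n mod 3 = k mod 3 \<Longrightarrow> omega powi n = omega powi k"
  using omega_powi_mod[of n] omega_powi_mod[of k] by simp

lemma infsum_reindex_inj:
  fixes g :: "'b \<Rightarrow> complex"
  assumes "inj_on h A"
  shows "infsum (\<lambda>x. g (h x)) A = infsum g (h ` A)"
  using infsum_reindex[OF assms, of g] by (simp add: o_def)

text \<open>The two sums over the parity classes become one sum over all representations.\<close>

lemma fourier_coeff_27_reps:
  "(omega - 1) * fourier_coeff f_27_2_a_a p =
    infsum (\<lambda>(X, Y). of_int Y * omega powi (2 * Y + 2)) {(X, Y). X ^ 2 + 3 * Y ^ 2 = 4 * int p \<and> X mod 3 = 1}"
    if fin: "finite {(X :: int, Y :: int). X ^ 2 + 3 * Y ^ 2 = 4 * int p \<and> X mod 3 = 1}"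
proof -
  define S1 where "S1 = {(n, t). 3 * (2 * n - 1) ^ 2 + (6 * t + 1) ^ 2 = 4 * int p}"
  define S2 where "S2 = {(n, t). 3 * n ^ 2 + (3 * t + 1) ^ 2 = int p}"
  define h1 h2 where "h1 = (\<lambda>(n :: int, t :: int). (6 * t + 1, 2 * n - 1))" and "h2 = (\<lambda>(n :: int, t :: int). (- 6 * t - 2, 2 * n))"
  define g where "g = (\<lambda>(X :: int, Y :: int). of_int Y * omega powi (2 * Y + 2))"
  have "infsum (\<lambda>(n, t). of_int (2 * n - 1) * omega powi n) S1 = infsum (\<lambda>q. g (h1 q)) S1"
  proof (rule infsum_cong)
    fix q :: "int \<times> int"
    obtain n t where q: "q = (n, t)" by (cases q)
    have "2 * (2 * n - 1) + 2 = n + n * 3" by simp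
    then have "omega powi (2 * (2 * n - 1) + 2) = omega powi n"
      by (intro omega_powi_cong) (simp only: mod_mult_self1)
    then show "(case q of (n, t) \<Rightarrow> of_int (2 * n - 1) * omega powi n) = g (h1 q)"
      by (simp add: q g_def h1_def)
  qed
  also have "\<dots> = infsum g (h1 ` S1)"
    by (rule infsum_reindex_inj) (auto simp: inj_on_def h1_def)
  finally have 1: "infsum (\<lambda>(n, t). of_int (2 * n - 1) * omega powi n) S1 = infsum g (h1 ` S1)" .
  have "omega ^ 2 * infsum (\<lambda>(n, t). of_int (2 * n) * omega powi n) S2 = infsum (\<lambda>q. omega ^ 2 * (case q of (n, t) \<Rightarrow> of_int (2 * n) * omega powi n)) S2"
    by (rule infsum_cmult_right'[symmetric])
  also have "\<dots> = infsum (\<lambda>q. g (h2 q)) S2"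
  proof (rule infsum_cong)
    fix q :: "int \<times> int"
    obtain n t where q: "q = (n, t)" by (cases q)
    have "2 * (2 * n) + 2 = (n + 2) + n * 3" by simp
    then have "omega powi (2 * (2 * n) + 2) = omega powi (n + 2)"
      by (intro omega_powi_cong) (simp only: mod_mult_self1)
    also have "\<dots> = omega powi n * omega ^ 2" by (simp add: power_int_add)
    finally have "omega powi (2 * (2 * n) + 2) = omega powi n * omega ^ 2" .
    then show "omega ^ 2 * (case q of (n, t) \<Rightarrow> of_int (2 * n) * omega powi n) = g (h2 q)"
      unfolding q g_def h2_def prod.case by (simp only: mult_ac)
  qed
  also have "\<dots> = infsum g (h2 ` S2)"
    by (rule infsum_reindex_inj) (auto simp: inj_on_def h2_def)
  finally have 2: "omega ^ 2 * infsum (\<lambda>(n, t). of_int (2 * n) * omega powi n) S2 = infsum g (h2 ` S2)" .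
  have disj: "h1 ` S1 \<inter> h2 ` S2 = {}"
  proof -
    have "2 * n - 1 \<noteq> 2 * n'" for n n' :: int by presburger
    then show ?thesis by (auto simp: h1_def h2_def)
  qed
  have un: "h1 ` S1 \<union> h2 ` S2 = {(X, Y). X ^ 2 + 3 * Y ^ 2 = 4 * int p \<and> X mod 3 = 1}" (is "_ = ?Sol")
  proof (intro equalityI subsetI)
    fix q assume "q \<in> h1 ` S1 \<union> h2 ` S2"
    then show "q \<in> ?Sol"
    proof
      assume "q \<in> h1 ` S1"
      then obtain n t where q: "q = (6 * t + 1, 2 * n - 1)" "3 * (2 * n - 1) ^ 2 + (6 * t + 1) ^ 2 = 4 * int p"
        by (auto simp: h1_def S1_def)
      have "(6 * t + 1) mod 3 = 1" by presburger
      then show ?thesis unfolding q(1) using q(2) by simp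
    next
      assume "q \<in> h2 ` S2"
      then obtain n t where q: "q = (- 6 * t - 2, 2 * n)" "3 * n ^ 2 + (3 * t + 1) ^ 2 = int p"
        by (auto simp: h2_def S2_def)
      have "(- 6 * t - 2) mod 3 = 1" by presburger
      moreover have "(- 6 * t - 2) ^ 2 + 3 * (2 * n) ^ 2 = 4 * (3 * n ^ 2 + (3 * t + 1) ^ 2)"
        by (simp add: power2_eq_square algebra_simps)
      ultimately show ?thesis unfolding q(1) q(2) by blast
    qed
  next
    fix q assume q: "q \<in> ?Sol"
    obtain X Y where XY: "q = (X, Y)" by (cases q)
    have s: "X ^ 2 + 3 * Y ^ 2 = 4 * int p" "X mod 3 = 1" using q unfolding XY by blast+
    have "even (X ^ 2 + 3 * Y ^ 2)" unfolding s(1) by simp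
    then have XYp: "even (X + Y)" by simp
    show "q \<in> h1 ` S1 \<union> h2 ` S2"
    proof (cases "even Y")
      case False
      define n where "n = (Y + 1) div 2"
      have n: "Y = 2 * n - 1" using False unfolding n_def by presburger
      define t where "t = (X - 1) div 6"
      have t: "X = 6 * t + 1" using XYp False s(2) unfolding t_def by presburger
      have "(n, t) \<in> S1" using s(1) by (simp add: S1_def n t)
      moreover have "q = h1 (n, t)" by (simp add: XY h1_def n t)
      ultimately show ?thesis by blast
    next
      case True
      then obtain n where n: "Y = 2 * n" by (rule evenE)
      define t where "t = (- X - 2) div 6"
      have t: "X = - 6 * t - 2" using XYp True s(2) unfolding t_def by presburger
      have "4 * (3 * n ^ 2 + (3 * t + 1) ^ 2) = 4 * int p"
        unfolding s(1)[symmetric] n t by (simp add: power2_eq_square algebra_simps)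
      then have "(n, t) \<in> S2" by (simp add: S2_def)
      moreover have "q = h2 (n, t)" by (simp add: XY h2_def n t)
      ultimately show ?thesis by blast
    qed
  qed
  have fin': "finite (h1 ` S1)" "finite (h2 ` S2)"
    using fin unfolding un[symmetric] by simp_all
  have "(omega - 1) * fourier_coeff f_27_2_a_a p = infsum g (h1 ` S1) + infsum g (h2 ` S2)"
    unfolding fourier_coeff_27 S1_def[symmetric] S2_def[symmetric] 1 2 ..
  also have "\<dots> = sum g (h1 ` S1 \<union> h2 ` S2)"
    using fin' disj by (simp only: infsum_finite sum.union_disjoint)
  also have "\<dots> = infsum g (h1 ` S1 \<union> h2 ` S2)"
    using fin' by (simp only: infsum_finite finite_UnI)
  finally show ?thesis unfolding un g_def .
qed

lemma fourier_coeff_27_prime: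
  fixes L N :: int
  assumes p: "prime p" and LN: "4 * int p = L ^ 2 + 3 * N ^ 2" "3 dvd N" "L mod 3 = 1"
  shows "fourier_coeff f_27_2_a_a p = - of_int L"
proof -
  obtain n where n: "N = 3 * n" using LN(2) by (rule dvdE)
  define l where "l = L div 3"
  have l: "L = 1 + 3 * l" using LN(3) unfolding l_def by presburger
  define g where "g = (\<lambda>(X :: int, Y :: int). of_int Y * omega powi (2 * Y + 2))"
  have "even (4 * int p)" by simp
  then have "even (L ^ 2 + 3 * N ^ 2)" unfolding LN(1) .
  then have par: "even (L + N)" "even (L - N)" by simp_all
  obtain b where "L - N = 2 * b" using par(2) by (rule evenE)
  then have b: "2 * b = L - N" by simp
  obtain b' where "L + N = 2 * b'" using par(1) by (rule evenE)
  then have b': "2 * b' = L + N" by simp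
  define a a' where "a = - (2 * b' - b)" and "a' = - (2 * b - b')"
  have a: "2 * a = - (L + 3 * N)" and a': "2 * a' = - (L - 3 * N)"
    using b b' unfolding a_def a'_def by (smt (verit))+
  have am: "a mod 3 = 1" by (rule mod3_1I[of _ "l + 3 * n + a"]) (use a l n in \<open>smt (verit)\<close>)
  have am': "a' mod 3 = 1" by (rule mod3_1I[of _ "l - 3 * n + a'"]) (use a' l n in \<open>smt (verit)\<close>)
  have bm: "b mod 3 = 2" by (rule mod3_2I[of _ "2 * (l - n) - b"]) (use b l n in \<open>smt (verit)\<close>)
  have bm': "b' mod 3 = 2" by (rule mod3_2I[of _ "2 * (l + n) - b'"]) (use b' l n in \<open>smt (verit)\<close>)
  let ?Sol = "{(L, N), (L, - N), (a, b), (a, - b), (a', b'), (a', - b')}"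
  have ab: "a ^ 2 + 3 * b ^ 2 = 4 * int p" if ab: "2 * a = - (L + 3 * M)" "2 * b = L - M" "M ^ 2 = N ^ 2" for a b M
  proof -
    have "4 * (a ^ 2 + 3 * b ^ 2) = (2 * a) ^ 2 + 3 * (2 * b) ^ 2" by (simp add: power2_eq_square)
    also have "\<dots> = 4 * (L ^ 2 + 3 * M ^ 2)" unfolding ab(1,2) by (simp add: power2_eq_square algebra_simps)
    finally show ?thesis unfolding ab(3) LN(1) by simp
  qed
  have sol: "{(X, Y). X ^ 2 + 3 * Y ^ 2 = 4 * int p \<and> X mod 3 = 1} = ?Sol"
  proof (intro equalityI subsetI)
    fix q assume q: "q \<in> ?Sol"
    have "a ^ 2 + 3 * b ^ 2 = 4 * int p" by (rule ab[OF a b]) simp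
    moreover have "a' ^ 2 + 3 * b' ^ 2 = 4 * int p" by (rule ab[of a' "- N" b']) (use a' b' in simp_all)
    ultimately show "q \<in> {(X, Y). X ^ 2 + 3 * Y ^ 2 = 4 * int p \<and> X mod 3 = 1}"
      using q am am' LN(3) LN(1)[symmetric]
      by (elim insertE emptyE) (simp_all only: mem_Collect_eq prod.case power2_minus conj_assoc simp_thms)
  next
    fix q assume "q \<in> {(X, Y). X ^ 2 + 3 * Y ^ 2 = 4 * int p \<and> X mod 3 = 1}"
    then obtain X Y where q: "q = (X, Y)" and XY: "X ^ 2 + 3 * Y ^ 2 = 4 * int p" and X3: "X mod 3 = 1" by blast
    from p XY LN(1)[symmetric] show "q \<in> ?Sol"
    proof (cases rule: norm_form_cases)
      case same
      have "X = L" by (rule sign_pos_mod3[OF same(1) X3 LN(3)])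
      then show ?thesis using same(2) unfolding q by blast
    next
      case plus
      have "X = a" by (rule sign_pos_mod3[OF _ X3 am]) (use plus(1) a in \<open>smt (verit)\<close>)
      moreover have "Y = b \<or> Y = - b" using plus(2) b by (smt (verit))
      ultimately show ?thesis unfolding q by blast
    next
      case minus
      have "X = a'" by (rule sign_pos_mod3[OF _ X3 am']) (use minus(1) a' in \<open>smt (verit)\<close>)
      moreover have "Y = b' \<or> Y = - b'" using minus(2) b' by (smt (verit))
      ultimately show ?thesis unfolding q by blast
    qed
  qed
  have N0: "N \<noteq> 0"
  proof
    assume "N = 0"
    then have "even L" using par(1) by simp
    then obtain l where "L = 2 * l" by (rule evenE)
    then have "l ^ 2 = int p" using LN(1) \<open>N = 0\<close> by (simp add: power2_eq_square)
    then show False using prime_not_square_int[OF p] by blast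
  qed
  have ne: "b \<noteq> 0" "b' \<noteq> 0" "L \<noteq> a" "L \<noteq> a'" "a \<noteq> a'"
  proof -
    show "b \<noteq> 0" "b' \<noteq> 0" using bm bm' by auto
    show "L \<noteq> a"
    proof
      assume "L = a"
      then have "L = 3 * (- n)" using a n by (smt (verit))
      then have "L mod 3 = 0" by (rule mod3_0I)
      then show False using LN(3) by simp
    qed
    show "L \<noteq> a'"
    proof
      assume "L = a'"
      then have "L = 3 * n" using a' n by (smt (verit))
      then have "L mod 3 = 0" by (rule mod3_0I)
      then show False using LN(3) by simp
    qed
    show "a \<noteq> a'" using a a' N0 by (smt (verit))
  qed
  have pair: "g (c, Y) + g (c, - Y) = (omega - 1) * - of_int Y" if "Y mod 3 = 2" for c Y
  proof -
    have "omega powi (2 * Y + 2) = omega powi 0"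
      by (rule omega_powi_cong) (use that in presburger)
    moreover have "omega powi (2 * - Y + 2) = omega powi 1"
      by (rule omega_powi_cong) (use that in presburger)
    ultimately show ?thesis unfolding g_def prod.case by (simp only:) (simp add: algebra_simps)
  qed
  have "(omega - 1) * fourier_coeff f_27_2_a_a p = infsum g ?Sol"
    unfolding sol[symmetric] g_def by (rule fourier_coeff_27_reps) (simp only: sol finite.intros)
  also have "\<dots> = (g (L, N) + g (L, - N)) + ((g (a, b) + g (a, - b)) + (g (a', b') + g (a', - b')))"
    using N0 ne by simp
  also have "g (L, N) + g (L, - N) = 0"
  proof -
    have "(2 * N + 2) mod 3 = (2 * - N + 2) mod 3" unfolding n by presburger
    then have "omega powi (2 * N + 2) = omega powi (2 * - N + 2)" by (rule omega_powi_cong)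
    then show ?thesis unfolding g_def prod.case by (simp only: of_int_minus) simp
  qed
  also have "g (a, b) + g (a, - b) = (omega - 1) * - of_int b"
    by (rule pair[OF bm])
  also have "g (a', b') + g (a', - b') = (omega - 1) * - of_int b'"
    by (rule pair[OF bm'])
  finally have "(omega - 1) * fourier_coeff f_27_2_a_a p = (omega - 1) * - of_int (b + b')"
    by (simp add: algebra_simps)
  moreover have "b + b' = L" using b b' by (smt (verit))
  ultimately show ?thesis by (simp only: mult_cancel_left) simp
qed

lemma fourier_coeff_432_prime:
  fixes x w L N :: int
  assumes p: "prime p" and p12: "p mod 12 = 1"
    and xw: "int p = x ^ 2 + 3 * (2 * w) ^ 2" "(x + 1) mod 3 = 0" and x: "x = - (6 * k + 1)"
    and LN: "4 * int p = L ^ 2 + 3 * N ^ 2" "3 dvd N" "L mod 3 = 1"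
  shows "fourier_coeff f_432_2_c_a p = - ((- 1) powi (k + w) * of_int L)"
proof -
  obtain n where n: "N = 3 * n" using LN(2) by (rule dvdE)
  have "3 dvd x + 1" using xw(2) by (simp add: dvd_eq_mod_eq_0)
  then obtain m where m: "x + 1 = 3 * m" by (rule dvdE)
  define s where "s = omega - omega ^ 2"
  have base: "(2 * x) ^ 2 + 3 * (2 * (2 * w)) ^ 2 = 4 * int p"
    unfolding xw(1) by (simp add: power2_eq_square)
  have w0: "w \<noteq> 0"
  proof
    assume "w = 0"
    then have "x ^ 2 = int p" using xw(1) by simp
    then show False using prime_not_square_int[OF p] by blast
  qed
  let ?S = "{(w, k). (6 * k + 1) ^ 2 + 12 * w ^ 2 = int p}"
  have S: "?S = {(w, k), (- w, k)}"
  proof (intro equalityI subsetI)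
    fix q assume "q \<in> ?S"
    then obtain w' k' where q: "q = (w', k')" and wk: "(6 * k' + 1) ^ 2 + 12 * w' ^ 2 = int p" by blast
    have "(2 * (6 * k' + 1)) ^ 2 + 3 * (4 * w') ^ 2 = 4 * int p"
      unfolding wk[symmetric] by (simp add: power2_eq_square algebra_simps)
    from p this base show "q \<in> {(w, k), (- w, k)}"
    proof (cases rule: norm_form_cases)
      case same
      have "k' = k" using same(1) unfolding x by presburger
      moreover have "w' = w \<or> w' = - w" using same(2) by (smt (verit))
      ultimately show ?thesis unfolding q by blast
    next
      case plus
      have "x = 2 * (6 * k' + 1 - 3 * w) \<or> x = 2 * (- (6 * k' + 1) - 3 * w)" using plus(1) by (smt (verit))
      then have "even x" by (elim disjE) simp_all
      then have False unfolding x by simp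
      then show ?thesis ..
    next
      case minus
      have "x = 2 * (6 * k' + 1 + 3 * w) \<or> x = 2 * (- (6 * k' + 1) + 3 * w)" using minus(1) by (smt (verit))
      then have "even x" by (elim disjE) simp_all
      then have False unfolding x by simp
      then show ?thesis ..
    qed
  next
    fix q assume "q \<in> {(w, k), (- w, k)}"
    moreover have "(6 * k + 1) ^ 2 + 12 * w ^ 2 = int p"
      unfolding xw(1) x by (simp add: power2_eq_square algebra_simps)
    ultimately show "q \<in> ?S" by auto
  qed
  have L: "omega powi w * (of_int x + 2 * s * of_int w) + omega powi (- w) * (of_int x - 2 * s * of_int w) = of_int L"
  proof -
    have ss: "omega * s = omega ^ 2 - 1" "omega ^ 2 * s = 1 - omega"
    proof -
      have "omega * s = omega ^ 2 - omega ^ 3" "omega ^ 2 * s = omega ^ 3 - omega ^ 3 * omega"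
        by (simp_all add: s_def algebra_simps eval_nat_numeral)
      then show "omega * s = omega ^ 2 - 1" "omega ^ 2 * s = 1 - omega" by (simp_all add: omega_cube)
    qed
    from p LN(1)[symmetric] base show ?thesis
    proof (cases rule: norm_form_cases)
      case same
      have "(2 * x) mod 3 = 1" by (rule mod3_1I[of _ "2 * m - 1"]) (use m in simp)
      then have "L = 2 * x" by (rule sign_pos_mod3[OF same(1) LN(3)])
      moreover have "w = 3 * (n - w) \<or> w = 3 * (- n - w)" using same(2) n by (smt (verit))
      then have w3: "w mod 3 = 0" by (elim disjE) (erule mod3_0I)+
      then have "omega powi w = omega powi 0" by (intro omega_powi_cong) simp
      moreover have "omega powi (- w) = omega powi 0" by (rule omega_powi_cong) (use w3 in presburger)
      ultimately show ?thesis by simp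
    next
      case plus
      have z: "(x + 3 * (2 * w)) mod 3 = 2" by (rule mod3_2I[of _ "m - 1 + 2 * w"]) (use m in simp)
      have hL: "L = - (x + 3 * (2 * w))"
        by (rule sign_neg_mod3[OF _ LN(3) z]) (use plus(1) in \<open>smt (verit)\<close>)
      have "w = 1 + 3 * (w - m + n) \<or> w = 1 + 3 * (w - m - n)" using plus(2) n m by (smt (verit))
      then have w3: "w mod 3 = 1" by (elim disjE) (erule mod3_1I)+
      then have o1: "omega powi w = omega powi 1" by (intro omega_powi_cong) simp
      have o2: "omega powi (- w) = omega powi 2" by (rule omega_powi_cong) (use w3 in presburger)
      have e: "omega powi w * (of_int x + 2 * s * of_int w) + omega powi (- w) * (of_int x - 2 * s * of_int w)
        = (omega + omega ^ 2) * of_int x + 2 * (omega * s - omega ^ 2 * s) * of_int w"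
        unfolding o1 o2 by (simp add: algebra_simps)
      show ?thesis unfolding e ss by (simp add: hL omega_sq algebra_simps)
    next
      case minus
      have z: "(x - 3 * (2 * w)) mod 3 = 2" by (rule mod3_2I[of _ "m - 1 - 2 * w"]) (use m in simp)
      have hL: "L = - (x - 3 * (2 * w))"
        by (rule sign_neg_mod3[OF _ LN(3) z]) (use minus(1) in \<open>smt (verit)\<close>)
      have "w = 2 + 3 * (w + m - n - 1) \<or> w = 2 + 3 * (w + m + n - 1)" using minus(2) n m by (smt (verit))
      then have w3: "w mod 3 = 2" by (elim disjE) (erule mod3_2I)+
      then have o1: "omega powi w = omega powi 2" by (intro omega_powi_cong) simp
      have o2: "omega powi (- w) = omega powi 1" by (rule omega_powi_cong) (use w3 in presburger)
      have e: "omega powi w * (of_int x + 2 * s * of_int w) + omega powi (- w) * (of_int x - 2 * s * of_int w)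
        = (omega + omega ^ 2) * of_int x + 2 * (omega ^ 2 * s - omega * s) * of_int w"
        unfolding o1 o2 by (simp add: algebra_simps)
      show ?thesis unfolding e ss by (simp add: hL omega_sq algebra_simps)
    qed
  qed
  define g where "g = (\<lambda>(w, k). (- omega) powi w * (- 1) powi k * (of_int (6 * k + 1) - 2 * s * of_int w))"
  have kx: "of_int (6 * k + 1) = - (of_int x :: complex)" unfolding x by simp
  have "p mod 12 \<noteq> 7" using p12 by simp
  then have "fourier_coeff f_432_2_c_a p = infsum g ?S"
    unfolding g_def s_def by (rule fourier_coeff_432)
  also have "\<dots> = g (w, k) + g (- w, k)" unfolding S using w0 by simp
  also have "g (w, k) = - ((- 1) powi (k + w) * (omega powi w * (of_int x + 2 * s * of_int w)))"
    unfolding g_def prod.case kx uminus_powi[of omega] by (simp add: power_int_add algebra_simps)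
  also have "g (- w, k) = - ((- 1) powi (k + w) * (omega powi (- w) * (of_int x - 2 * s * of_int w)))"
  proof -
    have "(- 1 :: complex) powi (- w) = (- 1) powi w" by (simp add: minus_one_powi)
    then show ?thesis
      unfolding g_def prod.case kx uminus_powi[of omega] by (simp add: power_int_add algebra_simps)
  qed
  finally show ?thesis
    unfolding L[symmetric] by (simp add: distrib_left)
qed


definition char4 :: "int \<Rightarrow> int"
  where "char4 n = (if n mod 4 = 1 then 1 else if n mod 4 = 3 then - 1 else 0)"

definition char3 :: "int \<Rightarrow> int"
  where "char3 n = (if n mod 3 = 1 then 1 else if n mod 3 = 2 then - 1 else 0)"

definition char12 :: "int \<Rightarrow> int"
  where "char12 n = char4 n * char3 n"

lemma char12_mult: "char12 (m * n) = char12 m * char12 n"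
proof -
  have "m mod 4 = 0 \<or> m mod 4 = 1 \<or> m mod 4 = 2 \<or> m mod 4 = 3"
    "n mod 4 = 0 \<or> n mod 4 = 1 \<or> n mod 4 = 2 \<or> n mod 4 = 3" by presburger+
  then have "char4 (m * n) = char4 m * char4 n"
    unfolding char4_def mod_mult_eq[of m 4 n, symmetric] by (elim disjE) simp_all
  moreover have "m mod 3 = 0 \<or> m mod 3 = 1 \<or> m mod 3 = 2" "n mod 3 = 0 \<or> n mod 3 = 1 \<or> n mod 3 = 2"
    by presburger+
  then have "char3 (m * n) = char3 m * char3 n"
    unfolding char3_def mod_mult_eq[of m 3 n, symmetric] by (elim disjE) simp_all
  ultimately show ?thesis by (simp add: char12_def)
qed

lemma Legendre_3:
  assumes q: "prime q" "q > 3"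
  shows "Legendre 3 (int q) = char12 (int q)"
proof -
  have nd: "\<not> 2 dvd q" "\<not> 3 dvd q"
    using q primes_dvd_imp_eq[of 2 q] primes_dvd_imp_eq[of 3 q] by auto
  have rec: "Legendre 3 (int q) * Legendre (int q) 3 = (- 1) ^ ((q - 1) div 2)"
    using Quadratic_Reciprocity[of 3 q] q by simp
  have res: "Legendre (int q) 3 = (if q mod 3 = 1 then 1 else - 1)"
  proof -
    have z: "\<not> [int q = 0] (mod 3)" using nd(2) by (simp add: cong_0_iff) presburger
    show ?thesis
    proof (cases "q mod 3 = 1")
      case True
      then have "[1 ^ 2 = int q] (mod 3)" by (simp add: cong_def) presburger
      then have "QuadRes 3 (int q)" unfolding QuadRes_def by blast
      then show ?thesis using True z by (simp add: Legendre_def)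
    next
      case False
      then have q2: "int q mod 3 = 2" using nd(2) by presburger
      have "\<not> QuadRes 3 (int q)"
      proof
        assume "QuadRes 3 (int q)"
        then obtain y where "(y * y) mod 3 = (2 :: int)" using q2 by (auto simp: QuadRes_def cong_def power2_eq_square)
        moreover have "(y * y) mod 3 = ((y mod 3) * (y mod 3)) mod 3" by (simp add: mod_mult_eq)
        moreover have "y mod 3 = 0 \<or> y mod 3 = 1 \<or> y mod 3 = 2" by presburger
        ultimately show False by auto
      qed
      then show ?thesis using False z by (simp add: Legendre_def)
    qed
  qed
  have par: "(- 1 :: int) ^ ((q - 1) div 2) = (if q mod 4 = 1 then 1 else - 1)"
  proof -
    have "even ((q - 1) div 2) \<longleftrightarrow> q mod 4 = 1" using nd(1) by presburger
    then show ?thesis by simp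
  qed
  have eq: "Legendre 3 (int q) = (if q mod 4 = 1 then 1 else - 1) * (if q mod 3 = 1 then 1 else - 1)"
    using rec unfolding res par by (auto split: if_splits)
  have i: "int q mod 4 = int (q mod 4)" "int q mod 3 = int (q mod 3)" by (simp_all add: zmod_int)
  have "q mod 4 = 1 \<or> q mod 4 = 3" using nd(1) by presburger
  moreover have "q mod 3 = 1 \<or> q mod 3 = 2" using nd(2) by presburger
  ultimately show ?thesis unfolding eq char12_def char4_def char3_def i by auto
qed

context odd_prime
begin

lemma leg_eq_by_prime_factors:
  fixes f :: "int \<Rightarrow> int"
  assumes f: "f 1 = 1" "f (- 1) = 1" "\<And>x y. f (x * y) = f x * f y" and leg: "leg (- 1) = 1"
    and m: "m \<noteq> 0" "\<And>q. prime q \<Longrightarrow> q dvd m \<Longrightarrow> leg q = of_int (f q)"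
  shows "leg m = of_int (f m)"
  using m
proof (induction m rule: prime_divisors_induct)
  case zero
  then show ?case by simp
next
  case (unit x)
  then have "x = 1 \<or> x = - 1" by auto
  then show ?case using f(1,2) leg mult_char_1[OF mult_char_leg] by auto
next
  case (factor q x)
  have "leg x = of_int (f x)" by (rule factor.IH) (use factor.prems in auto)
  moreover have "leg q = of_int (f q)" by (rule factor.prems(2)[OF factor.hyps]) simp
  ultimately show ?case by (simp add: mult_char_mult[OF mult_char_leg] f(3))
qed

lemma Legendre_unit: "\<not> int p dvd a \<Longrightarrow> Legendre a (int p) * Legendre a (int p) = 1"
  by (auto simp: Legendre_def cong_0_iff)

lemma leg_flip:
  assumes p4: "p mod 4 = 1" and q: "prime q" "q > 2" "q \<noteq> p"
  shows "leg (int q) = of_int (Legendre (int p) (int q))"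
proof -
  have "even ((p - 1) div 2)" using p4 by presburger
  then have "Legendre (int p) (int q) * Legendre (int q) (int p) = 1"
    using Quadratic_Reciprocity[OF prime gt2 q(1,2) q(3)[symmetric]] by simp
  moreover have "Legendre (int p) (int q) \<in> {0, 1, - 1}" "Legendre (int q) (int p) \<in> {0, 1, - 1}"
    by (auto simp: Legendre_def)
  ultimately have "Legendre (int q) (int p) = Legendre (int p) (int q)" by auto
  then show ?thesis by (simp add: leg_def)
qed

lemma leg_minus_1:
  assumes p4: "p mod 4 = 1"
  shows "leg (- 1) = 1"
proof -
  have "even ((p - 1) div 2)" using p4 by presburger
  then have "[Legendre (- 1) (int p) = 1] (mod int p)"
    using euler_criterion[OF prime gt2, of "- 1"] by simp
  then have "int p dvd Legendre (- 1) (int p) - 1" by (simp add: cong_iff_dvd_diff)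
  moreover have "Legendre (- 1) (int p) \<in> {0, 1, - 1}" by (auto simp: Legendre_def)
  ultimately have "Legendre (- 1) (int p) = 1" using not_dvd_1 not_dvd_2 by auto
  then show ?thesis by (simp add: leg_def)
qed

lemma sqrt_minus_1:
  assumes p4: "p mod 4 = 1"
  obtains i where "[i ^ 2 = - 1] (mod int p)"
proof -
  have "Legendre (- 1) (int p) = 1" using leg_minus_1[OF p4] by (simp add: leg_def)
  then have "QuadRes (int p) (- 1)" by (auto simp: Legendre_def split: if_splits)
  then show ?thesis using that by (auto simp: QuadRes_def)
qed

lemma leg_2:
  assumes p4: "p mod 4 = 1"
  shows "leg 2 = (if p mod 8 = 1 then 1 else - 1)"
proof -
  obtain i where i: "[i ^ 2 = - 1] (mod int p)" using sqrt_minus_1[OF p4] .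
  have idvd: "\<not> int p dvd i"
  proof
    assume "int p dvd i"
    then have "[i ^ 2 = 0] (mod int p)" by (simp add: cong_0_iff power2_eq_square)
    then have "[- 1 = 0] (mod int p)" using i cong_sym cong_trans by blast
    then show False using not_dvd_1 by (simp add: cong_0_iff)
  qed
  have c: "[(1 + i) ^ 2 = 2 * i] (mod int p)"
  proof -
    have "[1 + 2 * i + i ^ 2 = 1 + 2 * i + - 1] (mod int p)" by (rule cong_add[OF cong_refl i])
    then show ?thesis by (simp add: power2_eq_square algebra_simps)
  qed
  have nd: "\<not> int p dvd 2 * i" using idvd not_dvd_2 prime_int prime_dvd_mult_iff by blast
  then have "\<not> int p dvd (1 + i) ^ 2" using c cong_dvd_iff cong_sym by (metis cong_0_iff cong_trans)
  then have "\<not> int p dvd 1 + i" by (auto simp: power2_eq_square)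
  then have "leg (1 + i) * leg (1 + i) = 1" by (rule leg_square)
  then have "leg 2 * leg i = 1"
    using periodicD[OF mult_char_periodic[OF mult_char_leg] c]
    by (simp add: mult_char_mult[OF mult_char_leg] power2_eq_square)
  moreover have "leg i = (if p mod 8 = 1 then 1 else - 1)"
  proof -
    have "p = 4 * (p div 4) + 1" using p4 mult_div_mod_eq[of 4 p] by simp
    then obtain m where m: "p = 4 * m + 1" by blast
    have "i ^ ((p - 1) div 2) = (i ^ 2) ^ m" by (simp add: m flip: power_mult)
    moreover have "[(i ^ 2) ^ m = (- 1) ^ m] (mod int p)" by (rule cong_pow[OF i])
    moreover have "p mod 8 = 1 \<longleftrightarrow> even m"
    proof (cases "even m")
      case True
      then obtain v where "m = 2 * v" by (rule evenE)
      then show ?thesis using m by simp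
    next
      case False
      then obtain v where "m = 2 * v + 1" by (rule oddE)
      then have "p = 5 + v * 8" using m by simp
      then show ?thesis using False by simp
    qed
    ultimately have "[Legendre i (int p) = (if p mod 8 = 1 then 1 else - 1)] (mod int p)"
      using euler_criterion[OF prime gt2, of i] by (auto intro: cong_trans)
    then have "int p dvd Legendre i (int p) - (if p mod 8 = 1 then 1 else - 1)" by (simp add: cong_iff_dvd_diff)
    moreover have "Legendre i (int p) = 1 \<or> Legendre i (int p) = - 1" using idvd by (auto simp: Legendre_def cong_0_iff)
    ultimately have "Legendre i (int p) = (if p mod 8 = 1 then 1 else - 1)" using not_dvd_2 by (auto split: if_splits)
    then show ?thesis by (simp add: leg_def)
  qed
  ultimately show ?thesis by (metis mult.right_neutral mult_minus_right minus_minus)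
qed

lemma mod_8_of_norm_form:
  fixes x w k :: int
  assumes "int p = x * x + 12 * (w * w)" "x = - (6 * k + 1)"
  shows "p mod 8 = 1 \<longleftrightarrow> even w"
proof -
  have kk: "even (k * (3 * k + 1))" by simp
  then obtain m where m: "k * (3 * k + 1) = 2 * m" by (rule evenE)
  have "x * x = 12 * (k * (3 * k + 1)) + 1" unfolding assms(2) by (simp add: algebra_simps)
  then have e: "int p = 8 * (3 * m) + 1 + 12 * (w * w)" unfolding assms(1) m by simp
  have i: "int p mod 8 = int (p mod 8)" by (simp add: zmod_int)
  show ?thesis
  proof (cases "even w")
    case True
    then obtain v where "w = 2 * v" by (rule evenE)
    then have "int p = 1 + (3 * m + 6 * (v * v)) * 8" unfolding e by simp
    then have "int p mod 8 = 1" by (simp only: mod_mult_self1) simp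
    then show ?thesis using True unfolding i by simp
  next
    case False
    then obtain v where "w = 2 * v + 1" by (rule oddE)
    then have "int p = 5 + (3 * m + 6 * (v * v) + 6 * v + 1) * 8" unfolding e by (simp add: algebra_simps)
    then have "int p mod 8 = 5" by (simp only: mod_mult_self1) simp
    then show ?thesis using False unfolding i by simp
  qed
qed

lemma char12_of_norm_form: "x = - (6 * k + 1) \<Longrightarrow> char12 x = (if even k then 1 else - 1)"
proof (cases "even k")
  case True
  assume x: "x = - (6 * k + 1)"
  from True obtain v where "k = 2 * v" by (rule evenE)
  then have e: "x = 3 + (- 3 * v - 1) * 4" "x = 2 + (- 4 * v - 1) * 3" unfolding x by simp_all
  have "x mod 4 = 3" unfolding e(1) mod_mult_self1 by simp
  moreover have "x mod 3 = 2" unfolding e(2) mod_mult_self1 by simp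
  ultimately show ?thesis using True by (simp add: char12_def char4_def char3_def)
next
  case False
  assume x: "x = - (6 * k + 1)"
  from False obtain v where "k = 2 * v + 1" by (rule oddE)
  then have e: "x = 1 + (- 3 * v - 2) * 4" "x = 2 + (- 4 * v - 3) * 3" unfolding x by simp_all
  have "x mod 4 = 1" unfolding e(1) mod_mult_self1 by simp
  moreover have "x mod 3 = 2" unfolding e(2) mod_mult_self1 by simp
  ultimately show ?thesis using False by (simp add: char12_def char4_def char3_def)
qed

lemma prime_factor_neq:
  assumes q: "int q dvd z" "z \<noteq> 0" "z * z < int p"
  shows "q \<noteq> p"
proof -
  have "int q \<le> \<bar>z\<bar>" using zdvd_imp_le[of "int q" "\<bar>z\<bar>"] q(1,2) by simp
  also have "\<bar>z\<bar> \<le> \<bar>z\<bar> * \<bar>z\<bar>" using q(2) mult_mono[of 1 "\<bar>z\<bar>" "\<bar>z\<bar>" "\<bar>z\<bar>"] by simp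
  also have "\<dots> < int p" using q(3) by simp
  finally show ?thesis by simp
qed

lemma prime_not_dvd_p: "prime q \<Longrightarrow> q \<noteq> p \<Longrightarrow> \<not> int q dvd int p"
  using prime primes_dvd_imp_eq[of q p] by auto

lemma leg_norm_form_x:
  fixes x w k :: int
  assumes p4: "p mod 4 = 1" and p_eq: "int p = x * x + 12 * (w * w)" and x: "x = - (6 * k + 1)" and w0: "w \<noteq> 0"
  shows "leg x = (- 1) powi k"
proof -
  have x0: "x \<noteq> 0" unfolding x by presburger
  have ww: "w * w > 0" using w0 by (simp flip: power2_eq_square)
  have odd_x: "\<not> 2 dvd x" "\<not> 3 dvd x" unfolding x by presburger+
  have "leg x = of_int (char12 x)"
  proof (rule leg_eq_by_prime_factors[OF _ _ char12_mult leg_minus_1[OF p4] x0])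
    fix q assume q: "prime q" "q dvd x"
    obtain n where n: "q = int n" using q(1) prime_ge_0_int[of q] nonneg_int_cases by blast
    have pn: "prime n" using q(1) n by simp
    have "n \<noteq> 2" "n \<noteq> 3" using q(2) odd_x n by auto
    then have n3: "n > 3" using prime_ge_2_nat[OF pn] by simp
    then interpret Q: odd_prime n by unfold_locales (use pn in auto)
    have np: "n \<noteq> p" by (rule prime_factor_neq[of _ x]) (use q(2) n x0 p_eq ww in auto)
    have "\<not> int n dvd 2 * w"
    proof
      assume "int n dvd 2 * w"
      then have "int n dvd x * x + 3 * ((2 * w) * (2 * w))" using q(2) n
        by (intro dvd_add[OF dvd_mult2] dvd_mult[OF dvd_mult2]) auto
      then have "int n dvd int p" unfolding p_eq by (simp add: mult_ac)
      then show False using prime_not_dvd_p[OF pn np] by blast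
    qed
    moreover have "[int p = 3 * ((2 * w) * (2 * w))] (mod int n)"
      unfolding p_eq using q(2) n by (simp add: cong_iff_dvd_diff mult_ac)
    ultimately have "Legendre (int p) (int n) = Legendre 3 (int n)"
      using Q.Legendre_cong[of "int p" "3 * ((2 * w) * (2 * w))"] Q.Legendre_unit[of "2 * w"]
      by (metis Q.Legendre_mult mult.right_neutral)
    then show "leg q = of_int (char12 q)"
      using leg_flip[OF p4 pn Q.gt2 np] Legendre_3[OF pn n3] n by simp
  qed (simp_all add: char12_def char4_def char3_def)
  then show ?thesis by (simp add: char12_of_norm_form[OF x] minus_one_powi)
qed

lemma leg_norm_form_y:
  fixes x w k :: int
  assumes p4: "p mod 4 = 1" and p_eq: "int p = x * x + 12 * (w * w)" and x: "x = - (6 * k + 1)" and w0: "w \<noteq> 0"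
  shows "leg (2 * w) = (- 1) powi w"
proof -
  have x0: "x \<noteq> 0" unfolding x by presburger
  have xx: "x * x > 0" using x0 by (simp flip: power2_eq_square)
  note p8 = mod_8_of_norm_form[OF p_eq x]
  have lw: "leg w = of_int 1"
  proof (rule leg_eq_by_prime_factors[where f = "\<lambda>_. 1", OF _ _ _ leg_minus_1[OF p4] w0])
    fix q assume q: "prime q" "q dvd w"
    obtain n where n: "q = int n" using q(1) prime_ge_0_int[of q] nonneg_int_cases by blast
    have pn: "prime n" using q(1) n by simp
    show "leg q = of_int 1"
    proof (cases "n = 2")
      case True
      then show ?thesis using leg_2[OF p4] p8 q(2) n by simp
    next
      case False
      then have n2: "n > 2" using prime_ge_2_nat[OF pn] by simp
      have np: "n \<noteq> p"
      proof (rule prime_factor_neq[of _ w])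
        have "w * w \<le> 12 * (w * w)" by simp
        then show "w * w < int p" using p_eq xx by linarith
      qed (use q(2) n w0 in auto)
      have "[x ^ 2 = int p] (mod int n)"
        unfolding p_eq power2_eq_square using q(2) n by (simp add: cong_iff_dvd_diff)
      then have "QuadRes (int n) (int p)" unfolding QuadRes_def by blast
      then have "Legendre (int p) (int n) = 1"
        using prime_not_dvd_p[OF pn np] by (simp add: Legendre_def cong_0_iff)
      then show ?thesis using leg_flip[OF p4 pn n2 np] n by simp
    qed
  qed simp_all
  show ?thesis
    using lw leg_2[OF p4] p8 by (simp add: mult_char_mult[OF mult_char_leg] minus_one_powi)
qed

lemma quartic_char_minus_4:
  assumes p4: "p mod 4 = 1" and psi: "mult_char \<psi>" "\<And>x. \<psi> x ^ 2 = leg x"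
  shows "\<psi> (- 4) = 1"
proof -
  obtain i where i: "[i ^ 2 = - 1] (mod int p)" using sqrt_minus_1[OF p4] .
  have ii: "[(1 + i) ^ 2 * (1 + i) ^ 2 = - 4] (mod int p)"
  proof -
    have "[(1 + 2 * i + i ^ 2) * (1 + 2 * i + i ^ 2) = (1 + 2 * i + - 1) * (1 + 2 * i + - 1)] (mod int p)"
      by (intro cong_mult cong_add cong_refl i)
    also have "(1 + 2 * i + - 1) * (1 + 2 * i + - 1) = 4 * i ^ 2" by (simp add: power2_eq_square)
    also have "[4 * i ^ 2 = 4 * (- 1)] (mod int p)" by (intro cong_mult cong_refl i)
    finally show ?thesis by (simp add: power2_eq_square algebra_simps)
  qed
  have "\<psi> (- 4) = leg (1 + i) ^ 2"
    using periodicD[OF mult_char_periodic[OF psi(1)] ii]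
    unfolding mult_char_mult[OF psi(1), of "(1 + i) ^ 2"] mult_char_power[OF psi(1)] psi(2) by (simp add: power2_eq_square)
  moreover have "\<not> int p dvd 1 + i"
  proof
    assume "int p dvd 1 + i"
    then have "[(1 + i) ^ 2 * (1 + i) ^ 2 = 0] (mod int p)" by (simp add: cong_0_iff power2_eq_square)
    then have "[- 4 = 0] (mod int p)" using ii cong_sym cong_trans by blast
    then have "int p dvd 2 * 2" by (simp add: cong_0_iff)
    then show False using not_dvd_2 prime_int prime_dvd_mult_iff by blast
  qed
  ultimately show ?thesis using leg_square[of "1 + i"] by (simp add: power2_eq_square)
qed

lemma quartic_char_12:
  fixes x w k :: int
  assumes p12: "p mod 12 = 1" and xw: "int p = x ^ 2 + 3 * (2 * w) ^ 2" and x: "x = - (6 * k + 1)"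
    and psi: "mult_char \<psi>" "\<And>x. \<psi> x ^ 2 = leg x"
  shows "\<psi> 12 = (- 1) powi (k + w)"
proof -
  have p4: "p mod 4 = 1" using p12 mod_mod_cancel[of 4 12 p] by simp
  have w0: "w \<noteq> 0"
  proof
    assume "w = 0"
    then have "x ^ 2 = int p" using xw by simp
    then show False using prime_not_square_int[OF prime] by blast
  qed
  have p_eq: "int p = x * x + 12 * (w * w)" unfolding xw by (simp add: power2_eq_square)
  note psi_mult = mult_char_mult[OF psi(1)]
  have "[12 * ((2 * w) * (2 * w)) = - 4 * (x * x)] (mod int p)"
  proof -
    have "12 * ((2 * w) * (2 * w)) - - 4 * (x * x) = int p * 4" unfolding p_eq by (simp add: algebra_simps)
    then show ?thesis by (metis cong_iff_dvd_diff dvd_triv_left)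
  qed
  from periodicD[OF mult_char_periodic[OF psi(1)] this]
  have e: "\<psi> 12 * \<psi> (2 * w) ^ 2 = \<psi> (- 4) * \<psi> x ^ 2"
    unfolding psi_mult[of 12] psi_mult[of "2 * w" "2 * w"] psi_mult[of "- 4"] psi_mult[of x x] power2_eq_square .
  have "\<psi> 12 * (- 1) powi w = (- 1) powi k"
    using e unfolding psi(2) quartic_char_minus_4[OF p4 psi]
      leg_norm_form_x[OF p4 p_eq x w0] leg_norm_form_y[OF p4 p_eq x w0] by simp
  then have "\<psi> 12 * ((- 1) powi w * (- 1) powi w) = (- 1) powi (k + w)"
    by (simp only: mult.assoc[symmetric]) (simp add: power_int_add)
  then show ?thesis by (simp add: minus_one_powi split: if_splits)
qed

end


context odd_prime
begin

definition unit_char :: "int \<Rightarrow> complex"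
  where "unit_char x = (if int p dvd x then 0 else 1)"

definition appell_char_sum :: "(int \<Rightarrow> complex) \<Rightarrow> (int \<Rightarrow> complex) \<Rightarrow> (int \<Rightarrow> complex) \<Rightarrow> complex"
  where "appell_char_sum A R C = res_sum (\<lambda>u. res_sum (\<lambda>v. R u * unit_char v * (cnj (R (1 - u)) * unit_char (1 - u)) *
    (cnj (unit_char (1 - v)) * C (1 - v)) * cnj (A (1 - u - v))))"

lemma mult_char_minus: "mult_char a \<Longrightarrow> a (- x) = a (- 1) * a x"
  using mult_char_mult[of a "- 1" x] by simp

lemma unit_char_mult: "mult_char a \<Longrightarrow> unit_char x * a x = a x" "mult_char a \<Longrightarrow> cnj (unit_char x) * a x = a x"
  using mult_char_0_iff[of a x] by (auto simp: unit_char_def)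

lemma sum_unit_char: "periodic f \<Longrightarrow> res_sum (\<lambda>v. unit_char v * f v) = res_sum f - f 0"
proof -
  have "res_sum (\<lambda>v. unit_char v * f v) = res_sum (\<lambda>v. f v - (if v = 0 then f 0 else 0))"
    unfolding res_sum_def by (intro sum.cong refl) (auto simp: unit_char_def dvd_residue_iff)
  also have "\<dots> = res_sum f - f 0"
    using gt2 by (simp add: res_sum_def sum_subtractf)
  finally show ?thesis .
qed

lemma appell_char_sum_eq:
  assumes A: "mult_char A" and R: "mult_char R" and C: "mult_char C" and A1: "A (- 1) = 1"
  shows "appell_char_sum A R C = Jac C (\<lambda>x. cnj (A x)) * Jac (\<lambda>x. R x * C x * cnj (A x)) (\<lambda>x. cnj (R x))
    - Jac R (\<lambda>x. cnj (R x * A x))"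
proof -
  define B where "B x = cnj (A x)" for x
  have B: "mult_char B" unfolding B_def by (rule mult_char_cnj[OF A])
  note per = mult_char_periodic
  have B1: "B (- x) = B x" for x
    using A1 mult_char_minus[OF B, of x] by (simp add: B_def)
  have inner: "res_sum (\<lambda>v. unit_char v * (C (1 - v) * B (1 - u - v))) = C u * B u * Jac C B - B (1 - u)"
    if u: "\<not> int p dvd u" for u
  proof -
    have pf: "periodic (\<lambda>s. C s * B (u - s))"
      by (rule periodic_times[OF per[OF C] periodic_comp_diff[OF per[OF B]]])
    have e: "C (1 - v) * B (1 - u - v) = C (1 - v) * B (u - (1 - v))" for v
      using B1[of "u - (1 - v)"] by (simp add: algebra_simps)
    have "res_sum (\<lambda>v. C (1 - v) * B (1 - u - v)) = res_sum (\<lambda>s. C s * B (u - s))"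
      unfolding e by (rule res_sum_reflect[OF pf])
    also have "\<dots> = res_sum (\<lambda>t. C (u * t) * B (u - u * t))"
      using res_sum_scale[OF pf u] by simp
    also have "\<dots> = res_sum (\<lambda>t. C u * B u * (C t * B (1 - t)))"
    proof (rule res_sum_cong)
      fix t
      have "u - u * t = u * (1 - t)" by (simp add: algebra_simps)
      then show "C (u * t) * B (u - u * t) = C u * B u * (C t * B (1 - t))"
        by (simp only: mult_char_mult[OF C] mult_char_mult[OF B] mult_ac)
    qed
    also have "\<dots> = C u * B u * Jac C B" by (simp add: res_sum_def Jac_def sum_distrib_left)
    finally have "res_sum (\<lambda>v. C (1 - v) * B (1 - u - v)) = C u * B u * Jac C B" .
    moreover have "periodic (\<lambda>v. C (1 - v) * B (1 - u - v))"
      by (rule periodic_times[OF periodic_comp_diff[OF per[OF C]] periodic_comp_diff[OF per[OF B]]])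
    ultimately show ?thesis using sum_unit_char mult_char_1[OF C] by simp
  qed
  have "appell_char_sum A R C = res_sum (\<lambda>u. R u * cnj (R (1 - u)) * (C u * B u * Jac C B - B (1 - u)))"
    unfolding appell_char_sum_def
  proof (rule res_sum_cong)
    fix u
    show "res_sum (\<lambda>v. R u * unit_char v * (cnj (R (1 - u)) * unit_char (1 - u)) * (cnj (unit_char (1 - v)) * C (1 - v)) * cnj (A (1 - u - v)))
      = R u * cnj (R (1 - u)) * (C u * B u * Jac C B - B (1 - u))"
    proof (cases "int p dvd u")
      case True
      then have "R u = 0" using mult_char_0_iff[OF R] by simp
      then show ?thesis by (simp add: res_sum_def)
    next
      case False
      have "res_sum (\<lambda>v. R u * unit_char v * (cnj (R (1 - u)) * unit_char (1 - u)) * (cnj (unit_char (1 - v)) * C (1 - v)) * cnj (A (1 - u - v)))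
        = res_sum (\<lambda>v. R u * cnj (R (1 - u)) * (unit_char v * (C (1 - v) * B (1 - u - v))))"
      proof (rule res_sum_cong)
        fix v
        have e: "cnj (R (1 - u)) * unit_char (1 - u) = cnj (R (1 - u))"
          using unit_char_mult(1)[OF mult_char_cnj[OF R], of "1 - u"] by (simp add: mult.commute)
        show "R u * unit_char v * (cnj (R (1 - u)) * unit_char (1 - u)) * (cnj (unit_char (1 - v)) * C (1 - v)) * cnj (A (1 - u - v))
          = R u * cnj (R (1 - u)) * (unit_char v * (C (1 - v) * B (1 - u - v)))"
          unfolding e unit_char_mult(2)[OF C] B_def by (simp only: mult_ac)
      qed
      also have "\<dots> = R u * cnj (R (1 - u)) * (C u * B u * Jac C B - B (1 - u))"
        unfolding inner[OF False, symmetric] by (simp only: res_sum_def sum_distrib_left)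
      finally show ?thesis .
    qed
  qed
  also have "\<dots> = Jac C B * Jac (\<lambda>x. R x * C x * B x) (\<lambda>x. cnj (R x)) - Jac R (\<lambda>x. cnj (R x * A x))"
    by (simp add: res_sum_def Jac_def B_def right_diff_distrib sum_subtractf sum_distrib_left mult_ac)
  finally show ?thesis unfolding B_def .
qed

lemma appell_term_reduction:
  assumes A: "mult_char A" and R: "mult_char R" and C: "mult_char C" and A1: "A (- 1) = 1"
  shows "R (- 27) * C (- 1) * (R (- 1) * C (- 1) * appell_char_sum A R C)
     - R (- 27) * Jac C (\<lambda>x. A x * cnj (C x)) * Jac (\<lambda>x. R x * C x * cnj (A x)) (\<lambda>x. A x * cnj (C x))
    = - R 27 * Jac R (\<lambda>x. cnj (R x * A x))"
proof -
  define B where "B x = cnj (A x)" for x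
  define K where "K x = A x * cnj (C x)" for x
  define H where "H x = R x * C x * B x" for x
  have B: "mult_char B" unfolding B_def by (rule mult_char_cnj[OF A])
  have K: "mult_char K" unfolding K_def by (rule mult_char_times[OF A mult_char_cnj[OF C]])
  have H: "mult_char H" unfolding H_def by (rule mult_char_times[OF mult_char_times[OF R C] B])
  have R': "mult_char (\<lambda>x. cnj (R x))" by (rule mult_char_cnj[OF R])
  have "Jac C B = Jac B C" by (rule Jac_commute[OF C B])
  also have "\<dots> = C (- 1) * Jac (\<lambda>x. cnj (B x * C x)) C" by (rule Jac_invert[OF B C])
  also have "(\<lambda>x. cnj (B x * C x)) = K" by (simp add: B_def K_def fun_eq_iff)
  also have "Jac K C = Jac C K" by (rule Jac_commute[OF K C])
  finally have 1: "Jac C B = C (- 1) * Jac C K" .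
  have "Jac H (\<lambda>x. cnj (R x)) = Jac (\<lambda>x. cnj (R x)) H" by (rule Jac_commute[OF H R'])
  also have "\<dots> = H (- 1) * Jac (\<lambda>x. cnj (cnj (R x) * H x)) H" by (rule Jac_invert[OF R' H])
  also have "(\<lambda>x. cnj (cnj (R x) * H x)) = K"
  proof
    fix x
    show "cnj (cnj (R x) * H x) = K x"
    proof (cases "int p dvd x")
      case True
      then have "H x = 0" "K x = 0" using mult_char_0_iff H K by auto
      then show ?thesis by simp
    next
      case False
      have "cnj (cnj (R x) * H x) = (R x * cnj (R x)) * K x"
        by (simp add: H_def K_def B_def mult_ac)
      then show ?thesis using mult_char_cnj_mult[OF R False] by simp
    qed
  qed
  also have "Jac K H = Jac H K" by (rule Jac_commute[OF K H])
  also have "H (- 1) = R (- 1) * C (- 1)" using A1 by (simp add: H_def B_def)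
  finally have 2: "Jac H (\<lambda>x. cnj (R x)) = R (- 1) * C (- 1) * Jac H K" .
  have sq: "R (- 1) * R (- 1) = 1" "C (- 1) * C (- 1) = 1"
    using mult_char_minus_1_sq R C by auto
  have R27: "R (- 27) = R (- 1) * R 27" using mult_char_minus[OF R, of 27] by simp
  have "appell_char_sum A R C = Jac C B * Jac H (\<lambda>x. cnj (R x)) - Jac R (\<lambda>x. cnj (R x * A x))"
    unfolding H_def[abs_def] B_def[abs_def] by (rule appell_char_sum_eq[OF A R C A1])
  also have "\<dots> = (C (- 1) * C (- 1)) * R (- 1) * (Jac C K * Jac H K) - Jac R (\<lambda>x. cnj (R x * A x))"
    unfolding 1 2 by (simp only: mult_ac)
  finally have S: "appell_char_sum A R C = R (- 1) * (Jac C K * Jac H K) - Jac R (\<lambda>x. cnj (R x * A x))"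
    unfolding sq by simp
  have "R (- 27) * C (- 1) * (R (- 1) * C (- 1) * appell_char_sum A R C)
    = (R (- 1) * R (- 1)) * (C (- 1) * C (- 1)) * (R 27 * appell_char_sum A R C)"
    unfolding R27 by (simp only: mult_ac)
  also have "\<dots> = R 27 * (R (- 1) * (Jac C K * Jac H K) - Jac R (\<lambda>x. cnj (R x * A x)))"
    unfolding sq S by simp
  finally have T: "R (- 27) * C (- 1) * (R (- 1) * C (- 1) * appell_char_sum A R C)
    = R 27 * (R (- 1) * (Jac C K * Jac H K) - Jac R (\<lambda>x. cnj (R x * A x)))" .
  have "R (- 27) * C (- 1) * (R (- 1) * C (- 1) * appell_char_sum A R C) - R (- 27) * Jac C K * Jac H K
    = - R 27 * Jac R (\<lambda>x. cnj (R x * A x))"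
    unfolding T unfolding R27 by (simp add: algebra_simps)
  then show ?thesis unfolding H_def[abs_def] B_def[abs_def] K_def[abs_def] .
qed

lemma Jac_cnj: "Jac (\<lambda>x. cnj (a x)) (\<lambda>x. cnj (b x)) = cnj (Jac a b)"
  by (simp add: Jac_def res_sum_def)

lemma leg_minus_3:
  assumes xy: "int p = x ^ 2 + 3 * y ^ 2" and p3: "p mod 3 = 1"
  shows "leg (- 3) = 1"
proof -
  have y0: "y \<noteq> 0"
  proof
    assume "y = 0"
    then have "x ^ 2 = int p" using xy by simp
    then show False using prime_not_square_int[OF prime] by blast
  qed
  then have "y ^ 2 > 0" by simp
  moreover have "x ^ 2 \<ge> 0" by simp
  ultimately have "y * y < int p" using xy unfolding power2_eq_square by linarith
  then have "\<not> int p dvd y" using prime_factor_neq[of p y] y0 by blast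
  then have ly: "leg y * leg y = 1" by (rule leg_square)
  have "[x ^ 2 = - 3 * y ^ 2] (mod int p)" using xy by (simp add: cong_iff_dvd_diff)
  from periodicD[OF mult_char_periodic[OF mult_char_leg] this]
  have e: "leg (- 3) = leg x * leg x"
    using ly unfolding power2_eq_square mult_char_mult[OF mult_char_leg] by simp
  moreover have "leg (- 3) \<noteq> 0"
  proof -
    have "\<not> p dvd 3" using primes_dvd_imp_eq[OF prime, of 3] p3 by auto
    then have "\<not> int p dvd 3" by (metis int_dvd_int_iff of_nat_numeral)
    then show ?thesis using mult_char_0_iff[OF mult_char_leg, of "- 3"] by simp
  qed
  ultimately show ?thesis using leg_square[of x] leg_cases[of x] by auto
qed

lemma mult_char_eqI:
  "mult_char a \<Longrightarrow> mult_char b \<Longrightarrow> (\<And>x. \<not> int p dvd x \<Longrightarrow> a x = b x) \<Longrightarrow> a = b"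
  using mult_char_0_iff by (metis ext)

lemma leg_times_leg: "mult_char a \<Longrightarrow> leg x * (leg x * a x) = a x"
  using leg_square[of x] mult_char_0_iff[of a x] by (cases "int p dvd x") (simp_all add: mult.assoc[symmetric])

lemma cnj_leg: "cnj (leg x) = leg x"
  by (simp add: leg_def)

lemma Jac_times_leg:
  assumes a: "mult_char a" and nt: "nontrivial a" "nontrivial (\<lambda>x. a x * a x)" "nontrivial (\<lambda>x. a x * leg x)"
  shows "Jac a (\<lambda>x. a x * leg x) = cnj (a 4) * Jac (\<lambda>x. a x * a x) leg"
proof -
  have "Jac a a * Jac (\<lambda>x. a x * a x) leg = Jac a leg * Jac a (\<lambda>x. a x * leg x)"
    by (rule Jac_cocycle[OF a a mult_char_leg nt(2,3)])
  moreover have "Jac a leg * cnj (Jac a leg) = of_nat p"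
    by (rule Jac_norm_sq[OF a mult_char_leg nt(1) nontrivial_leg nt(3)])
  then have "Jac a leg \<noteq> 0" using gt2 by auto
  ultimately show ?thesis unfolding Jac_self[OF a nt(1)] by simp
qed

lemma value_half:
  assumes A: "mult_char A" and m3: "leg (- 3) = 1"
  shows "leg 27 * Jac leg (\<lambda>x. cnj (leg x * A x)) = Jac A leg"
proof -
  note L = mult_char_leg
  have K: "mult_char (\<lambda>x. cnj (leg x * A x))" by (rule mult_char_cnj[OF mult_char_times[OF L A]])
  have "Jac leg (\<lambda>x. cnj (leg x * A x)) = Jac (\<lambda>x. cnj (leg x * A x)) leg" by (rule Jac_commute[OF L K])
  also have "\<dots> = leg (- 1) * Jac (\<lambda>x. cnj (cnj (leg x * A x) * leg x)) leg" by (rule Jac_invert[OF K L])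
  also have "(\<lambda>x. cnj (cnj (leg x * A x) * leg x)) = A"
    using leg_times_leg[OF A] by (simp add: cnj_leg mult_ac fun_eq_iff)
  finally have e: "Jac leg (\<lambda>x. cnj (leg x * A x)) = leg (- 1) * Jac A leg" .
  have "leg 27 * leg (- 1) = leg (- 3) * leg (3 * 3)"
    by (simp flip: mult_char_mult[OF L])
  also have "leg (3 * 3) = 1"
    unfolding mult_char_mult[OF L] using leg_square[of 3] m3 mult_char_0_iff[OF L, of "- 3"] by auto
  finally show ?thesis unfolding e m3 by (simp add: mult.assoc[symmetric])
qed

lemma mult_char_cnj_eqI: "mult_char a \<Longrightarrow> \<not> int p dvd x \<Longrightarrow> a x * y = 1 \<Longrightarrow> cnj (a x) = y"
  using mult_char_cnj_mult(2)[of a x] by (metis mult.assoc mult.right_neutral mult_1)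

lemma value_sixth:
  assumes R: "mult_char R" and R2: "\<And>x. R x ^ 2 = A x" and R3: "\<And>x. R x ^ 3 = leg x" and m3: "leg (- 3) = 1"
  shows "R 27 * Jac R (\<lambda>x. cnj (R x * A x)) = Jac A leg"
proof -
  note L = mult_char_leg
  have A: "mult_char A" using mult_char_pow[OF R, of 2] by (simp add: R2)
  have "R x * A x = leg x" for x
    unfolding R2[symmetric] R3[symmetric] by (simp add: eval_nat_numeral)
  then have "Jac R (\<lambda>x. cnj (R x * A x)) = Jac R leg" by (simp add: cnj_leg)
  also have "\<dots> = leg (- 1) * Jac (\<lambda>x. cnj (R x * leg x)) leg" by (rule Jac_invert[OF R L])
  also have "(\<lambda>x. cnj (R x * leg x)) = A"
  proof (rule mult_char_eqI[OF mult_char_cnj[OF mult_char_times[OF R L]] A])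
    fix x assume x: "\<not> int p dvd x"
    have "R x * leg x * A x = leg x * leg x"
      unfolding R2[symmetric] R3[symmetric] by (simp add: eval_nat_numeral)
    then show "cnj (R x * leg x) = A x"
      using mult_char_cnj_eqI[OF mult_char_times[OF R L] x] leg_square[OF x] by simp
  qed
  finally have e: "Jac R (\<lambda>x. cnj (R x * A x)) = leg (- 1) * Jac A leg" .
  have "R 27 = R 3 ^ 3" using mult_char_power[OF R, of 3 3] by simp
  then have "R 27 * leg (- 1) = leg (- 3)"
    using mult_char_minus[OF L, of 3] by (simp add: R3)
  then show ?thesis unfolding e m3 by (simp add: mult.assoc[symmetric])
qed

lemma value_third:
  assumes A: "mult_char A" and A3: "\<forall>x. \<not> int p dvd x \<longrightarrow> A x ^ 3 = 1" and p3: "\<not> int p dvd 3"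
  shows "A 27 * Jac A (\<lambda>x. cnj (A x * A x)) = Jac A A"
proof -
  have "(\<lambda>x. cnj (A x * A x)) = A"
  proof (rule mult_char_eqI[OF mult_char_cnj[OF mult_char_times[OF A A]] A])
    fix x assume x: "\<not> int p dvd x"
    have "A x * A x * A x = 1" using A3 x by (simp add: eval_nat_numeral mult.assoc)
    then show "cnj (A x * A x) = A x"
      using mult_char_cnj_eqI[OF mult_char_times[OF A A] x] by simp
  qed
  moreover have "A 27 = 1" using mult_char_power[OF A, of 3 3] A3 p3 by simp
  ultimately show ?thesis by simp
qed

lemma value_twelfth:
  assumes R: "mult_char R" and R4: "\<And>x. R x ^ 4 = A x" and R6: "\<And>x. R x ^ 6 = leg x" and m1: "leg (- 1) = 1"
    and nt: "nontrivial R" "nontrivial (\<lambda>x. R x * R x)" "nontrivial (\<lambda>x. R x * leg x)" "nontrivial A"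
  shows "R 27 * Jac R (\<lambda>x. cnj (R x * A x)) = R 12 ^ 3 * Jac A A"
proof -
  note L = mult_char_leg
  have A: "mult_char A" using mult_char_pow[OF R, of 4] by (simp add: R4)
  have RR: "mult_char (\<lambda>x. R x * R x)" by (rule mult_char_times[OF R R])
  have "(\<lambda>x. cnj (R x * A x)) = (\<lambda>x. R x * leg x)"
  proof (rule mult_char_eqI[OF mult_char_cnj[OF mult_char_times[OF R A]] mult_char_times[OF R L]])
    fix x assume x: "\<not> int p dvd x"
    have "R x * A x * (R x * leg x) = leg x * leg x"
      unfolding R4[symmetric] R6[symmetric] by (simp add: eval_nat_numeral)
    then show "cnj (R x * A x) = R x * leg x"
      using mult_char_cnj_eqI[OF mult_char_times[OF R A] x] leg_square[OF x] by simp
  qed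
  then have "Jac R (\<lambda>x. cnj (R x * A x)) = Jac R (\<lambda>x. R x * leg x)" by simp
  also have "\<dots> = cnj (R 4) * Jac (\<lambda>x. R x * R x) leg" by (rule Jac_times_leg[OF R nt(1-3)])
  also have "Jac (\<lambda>x. R x * R x) leg = leg (- 1) * Jac (\<lambda>x. cnj (R x * R x * leg x)) leg"
    by (rule Jac_invert[OF RR L])
  also have "(\<lambda>x. cnj (R x * R x * leg x)) = A"
  proof (rule mult_char_eqI[OF mult_char_cnj[OF mult_char_times[OF RR L]] A])
    fix x assume x: "\<not> int p dvd x"
    have "R x * R x * leg x * A x = leg x * leg x"
      unfolding R4[symmetric] R6[symmetric] by (simp add: eval_nat_numeral)
    then show "cnj (R x * R x * leg x) = A x"
      using mult_char_cnj_eqI[OF mult_char_times[OF RR L] x] leg_square[OF x] by simp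
  qed
  also have "Jac A leg = A 4 * Jac A A"
  proof -
    have "\<not> int p dvd 2 * 2" using not_dvd_2 prime_int prime_dvd_mult_iff by blast
    then have "A 4 * cnj (A 4) = 1" using mult_char_cnj_mult(1)[OF A, of 4] by simp
    then show ?thesis unfolding Jac_self[OF A nt(4)] by (simp add: mult.assoc[symmetric])
  qed
  finally have e: "Jac R (\<lambda>x. cnj (R x * A x)) = cnj (R 4) * (leg (- 1) * (A 4 * Jac A A))" .
  have "\<not> int p dvd 2 * 2" using not_dvd_2 prime_int prime_dvd_mult_iff by blast
  then have R4c: "cnj (R 4) * R 4 = 1" using mult_char_cnj_mult(2)[OF R, of 4] by simp
  have "R 27 = R 3 ^ 3" using mult_char_power[OF R, of 3 3] by simp
  moreover have "R 12 = R 3 * R 4" using mult_char_mult[OF R, of 3 4] by simp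
  ultimately have "R 27 * cnj (R 4) * A 4 = R 12 ^ 3 * (cnj (R 4) * R 4)"
    unfolding R4[symmetric] by (simp add: eval_nat_numeral)
  then have "R 27 * cnj (R 4) * A 4 = R 12 ^ 3" unfolding R4c by simp
  then show ?thesis unfolding e m1 by (simp add: mult.assoc[symmetric])
qed

end


context odd_prime
begin

lemma minus_add_cnj: "- z - cnj z = - (2 * of_real (Re z))"
  by (simp add: complex_eq_iff)

lemma fourier_coeff_36_Jac:
  assumes A: "mult_char A" and cube: "\<forall>x. \<not> int p dvd x \<longrightarrow> A x ^ 3 = 1" and nt: "nontrivial A"
  shows "fourier_coeff f_36_2_a_a p = - Jac A leg - cnj (Jac A leg)"
proof -
  obtain x y :: int where xy: "int p = x ^ 2 + 3 * y ^ 2" "odd (x + y)" "(x + 1) mod 3 = 0" "Re (Jac A leg) = of_int x"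
    using Jac_cubic_leg[OF A cube nt] .
  show ?thesis
    unfolding minus_add_cnj xy(4) fourier_coeff_36_prime[OF prime xy(1-3)] by simp
qed

lemma cubic_leg_minus_3:
  assumes A: "mult_char A" and cube: "\<forall>x. \<not> int p dvd x \<longrightarrow> A x ^ 3 = 1" and nt: "nontrivial A"
    and p3: "p mod 3 = 1"
  shows "leg (- 3) = 1"
proof -
  obtain x y :: int where "int p = x ^ 2 + 3 * y ^ 2"
    using Jac_cubic_leg[OF A cube nt] .
  then show ?thesis using leg_minus_3 p3 by blast
qed

lemma fourier_coeff_27_Jac:
  assumes A: "mult_char A" and cube: "\<forall>x. \<not> int p dvd x \<longrightarrow> A x ^ 3 = 1" and nt: "nontrivial A"
    and p3: "p mod 3 = 1"
  shows "fourier_coeff f_27_2_a_a p = - Jac A A - cnj (Jac A A)"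
proof -
  obtain L N :: int where LN: "4 * int p = L ^ 2 + 3 * N ^ 2" "3 dvd N" "L mod 3 = 1" "2 * Re (Jac A A) = of_int L"
    using Jac_cubic_cubic[OF A cube nt p3] .
  have "2 * complex_of_real (Re (Jac A A)) = of_int L" using LN(4) by (metis of_real_mult of_real_numeral of_real_of_int_eq)
  then show ?thesis
    unfolding minus_add_cnj fourier_coeff_27_prime[OF prime LN(1-3)] by simp
qed

lemma fourier_coeff_432_Jac:
  assumes A: "mult_char A" and cube: "\<forall>x. \<not> int p dvd x \<longrightarrow> A x ^ 3 = 1" and nt: "nontrivial A"
    and p12: "p mod 12 = 1" and psi: "mult_char \<psi>" "\<And>x. \<psi> x ^ 2 = leg x"
  shows "fourier_coeff f_432_2_c_a p = - (\<psi> 12 * Jac A A) - cnj (\<psi> 12 * Jac A A)"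
proof -
  have p3: "p mod 3 = 1" using p12 mod_mod_cancel[of 3 12 p] by simp
  obtain L N :: int where LN: "4 * int p = L ^ 2 + 3 * N ^ 2" "3 dvd N" "L mod 3 = 1" "2 * Re (Jac A A) = of_int L"
    using Jac_cubic_cubic[OF A cube nt p3] .
  obtain x y :: int where xy: "int p = x ^ 2 + 3 * y ^ 2" "odd (x + y)" "(x + 1) mod 3 = 0"
    using Jac_cubic_leg[OF A cube nt] .
  have "p mod 4 = 1" using p12 mod_mod_cancel[of 4 12 p] by simp
  then have p4: "int p mod 4 = 1" using zmod_int[of p 4] by simp
  have "even y"
  proof (rule ccontr)
    assume "odd y"
    then obtain v where v: "y = 2 * v + 1" by (rule oddE)
    from \<open>odd y\<close> have "even x" using xy(2) by simp
    then obtain u where u: "x = 2 * u" by (rule evenE)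
    have "int p = 3 + (u ^ 2 + 3 * v ^ 2 + 3 * v) * 4"
      unfolding xy(1) u v by (simp add: power2_eq_square algebra_simps)
    then have "int p mod 4 = 3 mod 4" by (simp only: mod_mult_self1)
    then show False using p4 by simp
  qed
  then obtain w where w: "y = 2 * w" by (rule evenE)
  have "odd x" using xy(2) \<open>even y\<close> by simp
  then obtain v where v: "x = 2 * v + 1" by (rule oddE)
  have "(2 * v + 2) mod 3 = 0" using xy(3) unfolding v by (simp add: add.commute)
  then have "v mod 3 = 2" by presburger
  then obtain j where j: "v = 3 * j + 2" by (metis add.commute mult_div_mod_eq)
  define k where "k = - j - 1"
  have x: "x = - (6 * k + 1)" unfolding v j k_def by simp
  have psi12: "\<psi> 12 = (- 1) powi (k + w)"
    by (rule quartic_char_12[OF p12 xy(1)[unfolded w] x psi])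
  have cpsi: "cnj (\<psi> 12) = \<psi> 12" unfolding psi12 by (simp add: minus_one_powi)
  have J: "2 * complex_of_real (Re (Jac A A)) = of_int L" using LN(4) by (metis of_real_mult of_real_numeral of_real_of_int_eq)
  have "- (\<psi> 12 * Jac A A) - cnj (\<psi> 12 * Jac A A) = \<psi> 12 * (- Jac A A - cnj (Jac A A))"
    by (simp add: cpsi algebra_simps)
  also have "\<dots> = - ((- 1) powi (k + w) * of_int L)"
    unfolding minus_add_cnj J psi12 by simp
  also have "\<dots> = fourier_coeff f_432_2_c_a p"
    by (rule fourier_coeff_432_prime[OF prime p12 xy(1)[unfolded w] xy(3) x LN(1-3), symmetric])
  finally show ?thesis by simp
qed

end


lemma zeta_power: "zeta M ^ j = exp (2 * of_real pi * \<i> * of_nat j / of_nat M)"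
  by (simp add: zeta_def mult_ac flip: exp_of_nat_mult)

lemma zeta_power_eq_1_iff: "M > 0 \<Longrightarrow> zeta M ^ j = 1 \<longleftrightarrow> M dvd j"
  unfolding zeta_power using complex_root_unity_eq_1[of M j] by simp

lemma zeta_power_M: "M > 0 \<Longrightarrow> zeta M ^ M = 1"
  by (simp add: zeta_power_eq_1_iff)

lemma root_of_unity_zeta_power:
  assumes "M > 0" "z ^ M = 1"
  obtains j where "j < M" "z = zeta M ^ j"
  using complex_roots_unity[of M] assms unfolding zeta_power by auto

lemma sum_powers_root_of_unity:
  assumes "w ^ M = 1" "w \<noteq> 1"
  shows "(\<Sum>k<M. w ^ k) = (0 :: complex)"
  using geometric_sum[OF assms(2), of M] assms(1) by simp

locale prime_above = odd_prime +
  fixes M :: nat and P :: "complex set"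
  assumes M_pos: "M > 0" and p_cong: "[p = 1] (mod M)" and above: "prime_ideal_above M P p"
begin

abbreviation Z where "Z \<equiv> carrier (cyclotomic_ring M)"
abbreviation F where "F \<equiv> residue_field M P"
abbreviation res where "res \<equiv> residue M P"

lemma primeideal: "primeideal P (cyclotomic_ring M)"
  using above by (simp add: prime_ideal_above_def)

sublocale primeideal P "cyclotomic_ring M" by (rule primeideal)

lemma Z_iff: "x \<in> Z \<longleftrightarrow> (\<exists>f :: int poly. x = poly (map_poly of_int f) (zeta M))"
  by (auto simp: cyclotomic_ring_def)

lemma Z_of_int: "of_int k \<in> Z"
  unfolding Z_iff by (rule exI[of _ "[:k:]"]) (simp add: map_poly_pCons)

lemma Z_zeta: "zeta M \<in> Z"
  unfolding Z_iff by (rule exI[of _ "[:0, 1:]"]) (simp add: map_poly_pCons)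

lemma Z_add: "x \<in> Z \<Longrightarrow> y \<in> Z \<Longrightarrow> x + y \<in> Z"
  using a_closed[of x y] by (simp add: cyclotomic_ring_def)

lemma Z_mult: "x \<in> Z \<Longrightarrow> y \<in> Z \<Longrightarrow> x * y \<in> Z"
  using m_closed[of x y] by (simp add: cyclotomic_ring_def)

lemma Z_diff: "x \<in> Z \<Longrightarrow> y \<in> Z \<Longrightarrow> x - y \<in> Z"
  using Z_add[OF _ Z_mult[OF Z_of_int[of "- 1"]], of x y] by simp

lemma Z_1: "1 \<in> Z"
  using Z_of_int[of 1] by simp

lemma Z_power: "x \<in> Z \<Longrightarrow> x ^ n \<in> Z"
  by (induction n) (simp_all add: Z_1 Z_mult)

lemma Z_sum: "(\<And>i. i \<in> S \<Longrightarrow> f i \<in> Z) \<Longrightarrow> sum f S \<in> Z"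
  using Z_of_int[of 0] by (induction S rule: infinite_finite_induct) (simp_all add: Z_add)

lemma P_add: "x \<in> P \<Longrightarrow> y \<in> P \<Longrightarrow> x + y \<in> P"
  using additive_subgroup.a_closed[OF additive_subgroup_axioms, of x y] by (simp add: cyclotomic_ring_def)

lemma P_mult: "x \<in> Z \<Longrightarrow> y \<in> P \<Longrightarrow> x * y \<in> P"
  using I_l_closed[of y x] by (simp add: cyclotomic_ring_def)

lemma P_diff: "x \<in> P \<Longrightarrow> y \<in> P \<Longrightarrow> x - y \<in> P"
  using P_add[of x "- y"] P_mult[OF Z_of_int[of "- 1"], of y] by simp

lemma P_of_int: "of_int k \<in> P \<longleftrightarrow> int p dvd k"
proof -
  have "P \<inter> \<int> = {of_int k | k :: int. int p dvd k}"
    using above by (simp add: prime_ideal_above_def)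
  then have "of_int k \<in> P \<longleftrightarrow> of_int k \<in> {of_int k :: complex | k :: int. int p dvd k}"
    using Ints_of_int[of k] by blast
  then show ?thesis by auto
qed

lemma P_0: "0 \<in> P"
  using P_of_int[of 0] by simp

lemma P_sum: "(\<And>i. i \<in> S \<Longrightarrow> f i \<in> P) \<Longrightarrow> sum f S \<in> P"
  by (induction S rule: infinite_finite_induct) (simp_all add: P_0 P_add)

lemma P_prime: "x \<in> Z \<Longrightarrow> y \<in> Z \<Longrightarrow> x * y \<in> P \<Longrightarrow> x \<in> P \<or> y \<in> P"
  using I_prime[of x y] by (simp add: cyclotomic_ring_def)

lemma M_dvd: "M dvd p - 1"
  using p_cong gt2 by (simp add: cong_altdef_nat)

lemma M_not_in_P: "of_nat M \<notin> P"
proof -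
  have "M \<le> p - 1" using M_dvd gt2 by (intro dvd_imp_le) auto
  then have "\<not> int p dvd int M" using M_pos gt2 zdvd_imp_le[of "int p" "int M"] by auto
  then show ?thesis using P_of_int[of "int M"] by simp
qed

lemma zeta_power_residue:
  assumes "zeta M ^ j - 1 \<in> P"
  shows "M dvd j"
proof (rule ccontr)
  assume "\<not> M dvd j"
  then have "zeta M ^ j \<noteq> 1" using zeta_power_eq_1_iff[OF M_pos] by simp
  moreover have "(zeta M ^ j) ^ M = 1" using zeta_power_M[OF M_pos] by (metis mult.commute power_mult power_one)
  ultimately have "(\<Sum>k<M. (zeta M ^ j) ^ k) = 0" by (intro sum_powers_root_of_unity)
  then have e: "of_nat M = (\<Sum>k<M. 1 - (zeta M ^ j) ^ k)" by (simp add: sum_subtractf)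
  have "1 - (zeta M ^ j) ^ k \<in> P" for k
  proof -
    have "(zeta M ^ j) ^ k - 1 = (\<Sum>i<k. (zeta M ^ j) ^ i) * (zeta M ^ j - 1)"
      using power_diff_1_eq[of "zeta M ^ j" k] by (simp add: mult.commute)
    moreover have "(\<Sum>i<k. (zeta M ^ j) ^ i) * (zeta M ^ j - 1) \<in> P"
      by (intro P_mult Z_sum Z_power Z_zeta assms)
    ultimately have "(zeta M ^ j) ^ k - 1 \<in> P" by simp
    from P_diff[OF P_0 this] show ?thesis by simp
  qed
  then have "of_nat M \<in> P" unfolding e by (rule P_sum)
  then show False using M_not_in_P by simp
qed

lemma root_of_unity_residue:
  assumes a: "a \<in> Z" and aM: "a ^ M - 1 \<in> P"
  shows "\<exists>j. a - zeta M ^ j \<in> P"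
proof -
  define b where "b = zeta M ^ (M - 1)"
  define c where "c j = b ^ j * a" for j
  have b: "b \<in> Z" unfolding b_def by (intro Z_power Z_zeta)
  have zb: "zeta M * b = 1"
    using zeta_power_M[OF M_pos] M_pos by (cases M) (simp_all add: b_def)
  then have bM: "b ^ M = 1"
    using zeta_power_M[OF M_pos] by (metis mult_1 power_mult_distrib power_one)
  have c: "c j \<in> Z" for j unfolding c_def by (intro Z_mult Z_power a b)
  have "(\<Sum>j<M. (b ^ k) ^ j) = (if k = 0 then of_nat M else 0)" if "k < M" for k
  proof (cases "k = 0")
    case False
    have "b ^ k \<noteq> 1"
    proof
      assume "b ^ k = 1"
      then have "zeta M ^ k = 1" using zb by (metis mult.right_neutral power_mult_distrib power_one)
      then show False using that False zeta_power_eq_1_iff[OF M_pos] by (auto dest: dvd_imp_le)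
    qed
    moreover have "(b ^ k) ^ M = 1" using bM by (metis mult.commute power_mult power_one)
    ultimately show ?thesis using False by (simp add: sum_powers_root_of_unity)
  qed simp
  then have "(\<Sum>k<M. a ^ k * (\<Sum>j<M. (b ^ k) ^ j)) = (\<Sum>k<M. if k = 0 then of_nat M else 0)"
    by (intro sum.cong) auto
  also have "\<dots> = of_nat M" using M_pos by simp
  finally have "(\<Sum>j<M. \<Sum>k<M. c j ^ k) = of_nat M"
    by (subst sum.swap) (simp add: c_def sum_distrib_left power_mult_distrib mult_ac flip: power_mult)
  then obtain j where j: "(\<Sum>k<M. c j ^ k) \<notin> P" using M_not_in_P P_sum by metis
  have Sj: "(\<Sum>k<M. c j ^ k) \<in> Z" by (intro Z_sum Z_power c)
  have "c j ^ M - 1 = a ^ M - 1"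
    using bM by (simp add: c_def power_mult_distrib mult.commute[of j] flip: power_mult) (simp add: power_mult)
  then have "(c j - 1) * (\<Sum>k<M. c j ^ k) \<in> P"
    using aM power_diff_1_eq[of "c j" M] by simp
  then have "c j - 1 \<in> P" using P_prime[OF Z_diff[OF c Z_1] Sj] j by blast
  then have "zeta M ^ j * (c j - 1) \<in> P" by (intro P_mult Z_power Z_zeta)
  also have "zeta M ^ j * (c j - 1) = (zeta M * b) ^ j * a - zeta M ^ j"
    by (simp add: c_def power_mult_distrib algebra_simps)
  finally show ?thesis unfolding zb by auto
qed

definition generator :: int
  where "generator = int (SOME g. residue_primroot p g)"

lemma generator_ord:
  shows "[generator ^ n = 1] (mod int p) \<longleftrightarrow> p - 1 dvd n" and "\<not> int p dvd generator"
proof -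
  define g where "g = (SOME g. residue_primroot p g)"
  have "\<exists>g. residue_primroot p g"
    using prime_primitive_root_exists[OF _ prime] prime_gt_1_nat[OF prime] by blast
  then have "residue_primroot p g" unfolding g_def by (rule someI_ex)
  then have g: "coprime p g" "ord p g = p - 1"
    using totient_prime[OF prime] by (auto simp: residue_primroot_def)
  have "[generator ^ n = 1] (mod int p) \<longleftrightarrow> [g ^ n = 1] (mod p)"
    unfolding generator_def g_def[symmetric] using cong_int_iff[of "g ^ n" 1 p] by simp
  also have "\<dots> \<longleftrightarrow> p - 1 dvd n" using ord_divides[of g n p] g by simp
  finally show "[generator ^ n = 1] (mod int p) \<longleftrightarrow> p - 1 dvd n" .
  have "\<not> p dvd g" using g(1) prime by (metis coprime_absorb_left not_prime_unit)
  then show "\<not> int p dvd generator" by (simp add: generator_def g_def[symmetric])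
qed

definition exponent :: nat
  where "exponent = (p - 1) div M"

lemma exponent_mult: "exponent * M = p - 1"
  using M_dvd by (simp add: exponent_def)

lemma of_int_cong_P: "of_int x - of_int y \<in> P \<longleftrightarrow> [x = y] (mod int p)"
  using P_of_int[of "x - y"] by (simp add: cong_iff_dvd_diff)

lemma P_diff_trans: "x - y \<in> P \<Longrightarrow> y - z \<in> P \<Longrightarrow> x - z \<in> P"
  using P_add[of "x - y" "y - z"] by simp

lemma P_diff_sym: "x - y \<in> P \<Longrightarrow> y - x \<in> P"
  using P_diff[OF P_0, of "x - y"] by simp

lemma P_diff_mult:
  assumes "x - y \<in> P" "x' - y' \<in> P" "x' \<in> Z" "y \<in> Z"
  shows "x * x' - y * y' \<in> P"
proof -
  have "x * x' - y * y' = x' * (x - y) + y * (x' - y')" by (simp add: algebra_simps)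
  then show ?thesis using P_add[OF P_mult[OF assms(3,1)] P_mult[OF assms(4,2)]] by simp
qed

lemma P_diff_power: "x - y \<in> P \<Longrightarrow> x \<in> Z \<Longrightarrow> y \<in> Z \<Longrightarrow> x ^ n - y ^ n \<in> P"
  by (induction n) (simp_all add: P_0 P_diff_mult Z_power)

lemma zeta_power_cong:
  assumes "zeta M ^ i - zeta M ^ j \<in> P"
  shows "zeta M ^ i = zeta M ^ j"
proof -
  have z: "zeta M ^ n * zeta M ^ (M * n - n) = 1" for n
  proof -
    have "n + (M * n - n) = M * n" using M_pos by (cases M) auto
    then have "zeta M ^ n * zeta M ^ (M * n - n) = zeta M ^ (M * n)" by (metis power_add)
    then show ?thesis by (simp add: power_mult zeta_power_M[OF M_pos])
  qed
  have "zeta M ^ (M * j - j) * (zeta M ^ i - zeta M ^ j) \<in> P"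
    by (intro P_mult Z_power Z_zeta assms)
  moreover have "zeta M ^ (M * j - j) * (zeta M ^ i - zeta M ^ j) = zeta M ^ (i + (M * j - j)) - 1"
    using z[of j] by (simp add: algebra_simps power_add)
  ultimately have "M dvd i + (M * j - j)" using zeta_power_residue by simp
  then have "zeta M ^ (i + (M * j - j)) = 1" using zeta_power_eq_1_iff[OF M_pos] by blast
  then have "zeta M ^ i * zeta M ^ (M * j - j) * zeta M ^ j = zeta M ^ j" by (simp add: power_add)
  then show ?thesis using z[of j] by (simp add: mult.assoc mult.commute[of "zeta M ^ (M * j - j)"])
qed

text \<open>The character of which the others are powers.\<close>

definition power_char :: "int \<Rightarrow> complex"
  where "power_char x = (if int p dvd x then 0 else SOME z. z ^ M = 1 \<and> of_int x ^ exponent - z \<in> P)"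

lemma fermat_exponent:
  assumes "\<not> int p dvd x"
  shows "(of_int x ^ exponent) ^ M - 1 \<in> P"
proof -
  have "x * recip x = x ^ (p - 1)"
    using gt2 by (simp add: recip_def Suc_diff_Suc numeral_2_eq_2 flip: power_Suc)
  then have "[x ^ (p - 1) = 1] (mod int p)" using recip[OF assms] by simp
  then have "of_int (x ^ (p - 1)) - of_int 1 \<in> P" by (simp only: of_int_cong_P)
  then show ?thesis by (simp add: exponent_mult flip: power_mult)
qed

lemma power_char_cong:
  assumes "\<not> int p dvd x"
  shows "power_char x ^ M = 1" "of_int x ^ exponent - power_char x \<in> P"
proof -
  obtain j where "of_int x ^ exponent - zeta M ^ j \<in> P"
    using root_of_unity_residue[OF Z_power[OF Z_of_int] fermat_exponent[OF assms]] by blast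
  moreover have "(zeta M ^ j) ^ M = 1" using zeta_power_M[OF M_pos] by (metis mult.commute power_mult power_one)
  ultimately have "\<exists>z. z ^ M = 1 \<and> of_int x ^ exponent - z \<in> P" by blast
  from someI_ex[OF this] show "power_char x ^ M = 1" "of_int x ^ exponent - power_char x \<in> P"
    using assms by (simp_all add: power_char_def)
qed

lemma root_of_unity_unique:
  assumes "z ^ M = 1" "w ^ M = 1" "z - w \<in> P"
  shows "z = w"
  using root_of_unity_zeta_power[OF M_pos assms(1)] root_of_unity_zeta_power[OF M_pos assms(2)] zeta_power_cong assms(3)
  by metis

lemma root_of_unity_Z: "z ^ M = 1 \<Longrightarrow> z \<in> Z"
  using root_of_unity_zeta_power[OF M_pos] Z_power[OF Z_zeta] by metis

lemma power_char_eqI: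
  assumes "\<not> int p dvd x" "z ^ M = 1" "of_int x ^ exponent - z \<in> P"
  shows "power_char x = z"
  using root_of_unity_unique[OF power_char_cong(1)[OF assms(1)] assms(2)]
    P_diff_trans[OF P_diff_sym[OF power_char_cong(2)[OF assms(1)]] assms(3)] by simp

lemma power_char_0: "power_char x = 0 \<longleftrightarrow> int p dvd x"
proof (cases "int p dvd x")
  case False
  have "(0 :: complex) ^ M \<noteq> 1" using M_pos by (simp add: power_0_left)
  then have "power_char x \<noteq> 0" using power_char_cong(1)[OF False] by metis
  then show ?thesis using False by simp
qed (simp add: power_char_def)

lemma mult_char_power_char: "mult_char power_char"
  unfolding mult_char_def
proof (intro conjI allI)
  show "periodic power_char"
    unfolding periodic_def
  proof (intro allI impI)
    fix x y assume xy: "[x = y] (mod int p)"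
    show "power_char x = power_char y"
    proof (cases "int p dvd x")
      case True
      then have "int p dvd y" using xy by (simp add: cong_dvd_iff)
      then show ?thesis using True by (simp add: power_char_def)
    next
      case False
      have y: "\<not> int p dvd y" using False xy by (simp add: cong_dvd_iff)
      have "of_int x ^ exponent - of_int y ^ exponent \<in> P"
        using xy of_int_cong_P by (intro P_diff_power Z_of_int) simp
      from P_diff_trans[OF this power_char_cong(2)[OF y]]
      show ?thesis by (intro power_char_eqI False power_char_cong(1)[OF y])
    qed
  qed
  show "power_char (x * y) = power_char x * power_char y" for x y
  proof (cases "int p dvd x \<or> int p dvd y")
    case True
    then have "int p dvd x * y" by auto
    then show ?thesis using True power_char_0[of x] power_char_0[of y] power_char_0[of "x * y"] by auto
  next
    case False
    then have xy: "\<not> int p dvd x * y" using prime_int prime_dvd_mult_iff by blast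
    show ?thesis
    proof (rule power_char_eqI[OF xy])
      show "(power_char x * power_char y) ^ M = 1"
        using False by (simp add: power_mult_distrib power_char_cong(1))
      show "of_int (x * y) ^ exponent - power_char x * power_char y \<in> P"
        using False P_diff_mult[OF power_char_cong(2)[of x] power_char_cong(2)[of y] Z_power[OF Z_of_int]
            root_of_unity_Z[OF power_char_cong(1)[of x]]]
        by (simp add: power_mult_distrib)
    qed
  qed
  show "power_char x = 0 \<longleftrightarrow> int p dvd x" for x by (rule power_char_0)
qed

lemma power_char_generator:
  assumes "power_char generator ^ n = 1"
  shows "M dvd n"
proof -
  note c = power_char_cong[OF generator_ord(2)]
  have "(of_int generator ^ exponent) ^ n - power_char generator ^ n \<in> P"
    by (intro P_diff_power c Z_power Z_of_int root_of_unity_Z)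
  then have "of_int (generator ^ (exponent * n)) - of_int 1 \<in> P"
    using assms by (simp add: power_mult)
  then have "p - 1 dvd exponent * n" by (simp only: of_int_cong_P generator_ord(1))
  moreover have "exponent > 0" using exponent_mult gt2 by (cases exponent) auto
  ultimately show ?thesis unfolding exponent_mult[symmetric] by simp
qed

text \<open>Every residue class contains a rational integer.\<close>

lemma zeta_power_mod: "zeta M ^ (n mod M) = zeta M ^ n"
proof -
  have "zeta M ^ n = zeta M ^ (M * (n div M) + n mod M)" by simp
  also have "\<dots> = zeta M ^ (n mod M)" by (simp only: power_add power_mult zeta_power_M[OF M_pos] power_one mult_1)
  finally show ?thesis by simp
qed

lemma zeta_cong_int: "\<exists>t :: int. zeta M - of_int t \<in> P"
proof -
  define z where "z = power_char generator"
  have z: "z ^ M = 1" "of_int (generator ^ exponent) - z \<in> P"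
    using power_char_cong[OF generator_ord(2)] by (simp_all add: z_def)
  obtain j where j: "z = zeta M ^ j" using root_of_unity_zeta_power[OF M_pos z(1)] .
  have "coprime j M"
  proof -
    define d where "d = gcd j M"
    have d: "d dvd j" "d dvd M" by (simp_all add: d_def)
    from d(2) obtain e where e: "M = d * e" by (rule dvdE)
    have "z ^ e = zeta M ^ (j * e)" by (simp add: j power_mult)
    moreover have "M dvd j * e" unfolding e using d(1) by (rule mult_dvd_mono) simp
    ultimately have "z ^ e = 1" using zeta_power_eq_1_iff[OF M_pos] by simp
    then have "M dvd e" using power_char_generator by (simp add: z_def)
    moreover have "e > 0" "d > 0" using M_pos e by auto
    moreover have "d * e \<le> 1 * e" using dvd_imp_le[OF \<open>M dvd e\<close> \<open>e > 0\<close>] e by simp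
    ultimately have "d = 1" by (simp only: mult_le_cancel2) simp
    then show ?thesis unfolding coprime_iff_gcd_eq_1 d_def .
  qed
  then obtain i where "[j * i = Suc 0] (mod M)" using cong_solve_coprime_nat[of j M] by blast
  then have i: "[j * i = 1] (mod M)" by simp
  have "z ^ i = zeta M"
  proof -
    have "zeta M ^ (j * i) = zeta M ^ 1"
      using i zeta_power_mod[of "j * i"] zeta_power_mod[of 1] by (simp add: cong_def)
    then show ?thesis by (simp add: j power_mult)
  qed
  have "of_int (generator ^ exponent) ^ i - z ^ i \<in> P"
    by (rule P_diff_power[OF z(2) Z_of_int root_of_unity_Z[OF z(1)]])
  then have "zeta M - of_int ((generator ^ exponent) ^ i) \<in> P"
    unfolding \<open>z ^ i = zeta M\<close> of_int_power[symmetric] by (rule P_diff_sym)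
  then show ?thesis by blast
qed

lemma Z_cong_int:
  assumes "x \<in> Z"
  shows "\<exists>k :: int. x - of_int k \<in> P"
proof -
  obtain t :: int where t: "zeta M - of_int t \<in> P" using zeta_cong_int by blast
  obtain f :: "int poly" where f: "x = poly (map_poly of_int f) (zeta M)" using assms Z_iff by blast
  have "poly (map_poly of_int f) (zeta M) \<in> Z \<and> poly (map_poly of_int f) (zeta M) - of_int (poly f t) \<in> P"
  proof (induction f)
    case 0
    then show ?case using P_0 Z_of_int[of 0] by simp
  next
    case (pCons a f)
    let ?v = "poly (map_poly of_int f) (zeta M)"
    have e: "poly (map_poly of_int (pCons a f)) (zeta M) = of_int a + zeta M * ?v"
      by (simp add: map_poly_pCons)
    have "zeta M * ?v - of_int t * of_int (poly f t) \<in> P"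
      using P_diff_mult[OF t _ _ Z_of_int] pCons.IH by blast
    then show ?case unfolding e using pCons.IH by (simp add: Z_add Z_of_int Z_mult Z_zeta)
  qed
  then show ?thesis unfolding f by blast
qed

end


context prime_above
begin

definition int_res :: "int \<Rightarrow> complex set"
  where "int_res k = res (of_int k)"

lemma res_altdef: "res x = {h + x | h. h \<in> P}"
  by (auto simp: a_r_coset_def' cyclotomic_ring_def)

lemma res_eq_iff: "res x = res y \<longleftrightarrow> x - y \<in> P"
proof
  assume e: "res x = res y"
  have "0 + x \<in> res x" using P_0 unfolding res_altdef by blast
  then obtain h where "h \<in> P" "x = h + y" unfolding e unfolding res_altdef by auto
  then show "x - y \<in> P" by simp
next
  have sub: "res x \<subseteq> res y" if xy: "x - y \<in> P" for x y
  proof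
    fix z assume "z \<in> res x"
    then obtain h where h: "h \<in> P" "z = h + x" unfolding res_altdef by blast
    then have "z = (h + (x - y)) + y" by simp
    then show "z \<in> res y" using P_add[OF h(1) xy] unfolding res_altdef by blast
  qed
  show "x - y \<in> P \<Longrightarrow> res x = res y" using sub[of x y] sub[OF P_diff_sym, of x y] by blast
qed

lemma int_res_eq_iff: "int_res x = int_res y \<longleftrightarrow> [x = y] (mod int p)"
  by (simp add: int_res_def res_eq_iff of_int_cong_P)

lemma carrier_F: "carrier F = range int_res"
proof -
  have "carrier F = res ` Z" by (auto simp: FactRing_def A_RCOSETS_def')
  also have "\<dots> = range int_res"
  proof (intro equalityI subsetI)
    fix X assume "X \<in> res ` Z"
    then obtain x where x: "x \<in> Z" "X = res x" by blast
    then obtain k :: int where "x - of_int k \<in> P" using Z_cong_int by blast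
    then show "X \<in> range int_res" using x(2) res_eq_iff by (auto simp: int_res_def)
  next
    fix X assume "X \<in> range int_res"
    then show "X \<in> res ` Z" using Z_of_int by (auto simp: int_res_def)
  qed
  finally show ?thesis .
qed

lemma int_res_in_F: "int_res k \<in> carrier F"
  by (simp add: carrier_F)

lemma bij_betw_int_res: "bij_betw int_res {0..<int p} (carrier F)"
proof -
  have "inj_on int_res {0..<int p}"
    by (rule inj_onI) (simp add: int_res_eq_iff cong_def)
  moreover have "int_res k \<in> int_res ` {0..<int p}" for k
  proof (rule image_eqI)
    show "int_res k = int_res (k mod int p)" by (simp add: int_res_eq_iff cong_def)
    show "k mod int p \<in> {0..<int p}" using gt2 by simp
  qed
  then have "int_res ` {0..<int p} = carrier F" unfolding carrier_F by blast
  ultimately show ?thesis by (simp add: bij_betw_def)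
qed

lemma card_F: "card (carrier F) = p"
  using bij_betw_same_card[OF bij_betw_int_res] by simp

lemma sum_F: "(\<Sum>X\<in>carrier F. f X) = res_sum (\<lambda>k. f (int_res k))"
  unfolding res_sum_def by (rule sum.reindex_bij_betw[OF bij_betw_int_res, symmetric])

lemma ring_F: "ring F"
  by (rule quotient_is_ring)

lemma int_res_0: "int_res 0 = \<zero>\<^bsub>F\<^esub>"
  using P_0 by (simp add: int_res_def res_altdef FactRing_def)

lemma int_res_1: "int_res 1 = \<one>\<^bsub>F\<^esub>"
  by (simp add: int_res_def FactRing_def cyclotomic_ring_def)

lemma int_res_add: "int_res x \<oplus>\<^bsub>F\<^esub> int_res y = int_res (x + y)"
  using ring_hom_add[OF rcos_ring_hom Z_of_int[of x] Z_of_int[of y]]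
  by (simp add: int_res_def cyclotomic_ring_def)

lemma int_res_mult: "int_res x \<otimes>\<^bsub>F\<^esub> int_res y = int_res (x * y)"
  using ring_hom_mult[OF rcos_ring_hom Z_of_int[of x] Z_of_int[of y]]
  by (simp add: int_res_def cyclotomic_ring_def)

lemma int_res_minus: "\<ominus>\<^bsub>F\<^esub> int_res x = int_res (- x)"
proof -
  interpret F: ring F by (rule ring_F)
  show ?thesis
    by (rule F.minus_equality) (simp_all add: int_res_add int_res_0 int_res_in_F)
qed

lemma int_res_diff: "int_res x \<ominus>\<^bsub>F\<^esub> int_res y = int_res (x - y)"
  by (simp add: a_minus_def int_res_minus int_res_add)

lemma int_res_power: "int_res x [^]\<^bsub>F\<^esub> n = int_res (x ^ n)" for n :: nat
proof -
  interpret F: ring F by (rule ring_F)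
  show ?thesis
    by (induction n) (simp_all add: int_res_1 int_res_mult mult.commute)
qed

lemma int_res_zero_iff: "int_res x = \<zero>\<^bsub>F\<^esub> \<longleftrightarrow> int p dvd x"
  unfolding int_res_0[symmetric] int_res_eq_iff by (simp add: cong_0_iff)

lemma power_residue_symbol_int_res:
  assumes "\<not> int p dvd x"
  shows "power_residue_symbol M P (int_res x) = power_char x"
  unfolding power_residue_symbol_def card_F exponent_def[symmetric] int_res_power
proof (rule the_equality)
  note c = power_char_cong[OF assms]
  have "power_char x - of_int (x ^ exponent) \<in> P" using P_diff_sym[OF c(2)] by simp
  then have "res (power_char x) = int_res (x ^ exponent)"
    unfolding int_res_def res_eq_iff .
  then show "power_char x ^ M = 1 \<and> res (power_char x) = int_res (x ^ exponent)"
    using c(1) by simp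
next
  fix z assume z: "z ^ M = 1 \<and> res z = int_res (x ^ exponent)"
  then have "of_int x ^ exponent - z \<in> P" using P_diff_sym by (simp add: int_res_def res_eq_iff)
  then show "z = power_char x" using power_char_eqI[OF assms, of z] z by metis
qed

definition iota_char :: "rat \<Rightarrow> int \<Rightarrow> complex"
  where "iota_char a x = (if int p dvd x then 0 else power_char x powi \<lfloor>of_nat M * a\<rfloor>)"

lemma iota_int_res: "iota M P a (int_res x) = iota_char a x"
  by (simp add: iota_def iota_char_def int_res_zero_iff power_residue_symbol_int_res)

lemma Jacobi_iota_eq: "Jacobi_iota M P a b = Jac (iota_char a) (iota_char b)"
  unfolding Jacobi_iota_def Jacobi_sum_def sum_F Jac_def int_res_1[symmetric] int_res_diff iota_int_res ..

lemma iota_char_1: "iota_char 1 x = unit_char x"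
  using power_char_cong(1)[of x] by (simp add: iota_char_def unit_char_def)

lemma mult_char_iota: "mult_char (iota_char a)"
  unfolding mult_char_def periodic_def
proof (intro conjI allI impI)
  note c = mult_char_power_char
  show "iota_char a x = iota_char a y" if "[x = y] (mod int p)" for x y
    using that periodicD[OF mult_char_periodic[OF c] that] by (simp add: iota_char_def cong_dvd_iff)
  show "iota_char a (x * y) = iota_char a x * iota_char a y" for x y
    using prime_dvd_mult_iff[OF prime_int, of x y]
    by (simp add: iota_char_def mult_char_mult[OF c] power_int_mult_distrib)
  show "iota_char a x = 0 \<longleftrightarrow> int p dvd x" for x
    using power_char_0[of x] by (simp add: iota_char_def)
qed

abbreviation M_integral :: "rat \<Rightarrow> bool"
  where "M_integral a \<equiv> of_nat M * a \<in> \<int>"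

lemma iota_char_add:
  assumes "M_integral a" "M_integral b"
  shows "iota_char (a + b) = (\<lambda>x. iota_char a x * iota_char b x)"
proof
  fix x
  obtain m n where mn: "of_nat M * a = of_int m" "of_nat M * b = of_int n"
    using assms by (elim Ints_cases)
  then have "of_nat M * (a + b) = of_int (m + n)" by (simp add: distrib_left)
  then show "iota_char (a + b) x = iota_char a x * iota_char b x"
    unfolding iota_char_def mn using power_char_0[of x] by (simp only: floor_of_int) (simp add: power_int_add)
qed

lemma iota_char_minus:
  assumes "M_integral a"
  shows "iota_char (- a) = (\<lambda>x. cnj (iota_char a x))"
proof (rule mult_char_eqI[OF mult_char_iota mult_char_cnj[OF mult_char_iota]])
  fix x assume x: "\<not> int p dvd x"
  have "M_integral (- a)" using assms by simp
  from iota_char_add[OF assms this] have "iota_char 0 x = iota_char a x * iota_char (- a) x" by simp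
  moreover have "iota_char 0 x = 1" using x by (simp add: iota_char_def)
  ultimately show "iota_char (- a) x = cnj (iota_char a x)"
    using mult_char_cnj_eqI[OF mult_char_iota x] by metis
qed

lemma iota_char_one_plus:
  assumes "M_integral a"
  shows "iota_char (1 + a) = iota_char a"
proof -
  have "iota_char (1 + a) = (\<lambda>x. iota_char 1 x * iota_char a x)"
    by (rule iota_char_add[OF _ assms]) simp
  then show ?thesis using unit_char_mult(1)[OF mult_char_iota] by (simp add: iota_char_1 fun_eq_iff)
qed

lemma iota_char_power:
  assumes "M_integral a" "n > 0"
  shows "iota_char a x ^ n = iota_char (of_nat n * a) x"
  using assms(2)
proof (induction n rule: nat_induct_non_zero)
  case (Suc n)
  have "M_integral (of_nat n * a)"
    using assms(1) by (metis Ints_mult Ints_of_nat mult.left_commute)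
  from iota_char_add[OF assms(1) this] have "iota_char (a + of_nat n * a) x = iota_char a x * iota_char (of_nat n * a) x" by simp
  then show ?case using Suc.IH by (simp add: distrib_right)
qed simp

lemma nontrivial_iota:
  assumes M: "M = d * k" and n: "\<not> d dvd n" and a: "a = of_nat n / of_nat d"
  shows "nontrivial (iota_char a)"
proof -
  have d: "d > 0" "k > 0" using M M_pos by auto
  have "of_nat M * a = (of_nat (k * n) :: rat)" using d by (simp add: M a)
  then have "\<lfloor>of_nat M * a\<rfloor> = int (k * n)" by (metis floor_of_nat)
  then have e: "iota_char a generator = power_char generator ^ (k * n)"
    using generator_ord(2) by (simp only: iota_char_def if_False power_int_of_nat)
  have "iota_char a generator \<noteq> 1"
  proof
    assume "iota_char a generator = 1"
    then have "M dvd k * n" using power_char_generator e by simp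
    then show False using n d by (simp add: M mult.commute[of d])
  qed
  then show ?thesis using generator_ord(2) by (auto simp: nontrivial_def)
qed

lemma unit_char_minus_1: "unit_char (- 1) = 1"
  using not_dvd_1 by (simp add: unit_char_def)

lemma F2_iota_eq: "F2_iota M P a b 1 1 c (res 1) (res 1) =
  iota_char b (- 1) * iota_char c (- 1) * appell_char_sum (iota_char a) (iota_char b) (iota_char c)"
proof -
  have r1: "res 1 = int_res 1" by (simp add: int_res_def)
  show ?thesis
    unfolding F2_iota_def Appell_F2_def trivial_char_def sum_F int_res_1[symmetric] r1
      int_res_mult int_res_minus int_res_diff iota_int_res int_res_zero_iff mult_1_right iota_char_1 appell_char_sum_def
    using not_dvd_1 by (simp add: unit_char_minus_1)
qed

lemma appell_identity:
  fixes r c :: rat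
  assumes third: "M_integral (1/3)" and r: "M_integral r" and c: "M_integral c"
  defines "V \<equiv> iota_char r 27 * Jac (iota_char r) (\<lambda>x. cnj (iota_char r x * iota_char (1/3) x))"
  shows "iota M P r (res (- 27)) * iota M P c (res (- 1)) * F2_iota M P (1/3) r 1 1 c (res 1) (res 1)
      + (- iota M P r (res (- 27)) * Jacobi_iota M P c (1/3 - c) * Jacobi_iota M P (r + c - 1/3) (1/3 - c)
         - iota M P (1 - r) (res (- 27)) * Jacobi_iota M P c (2/3 - c) * Jacobi_iota M P (1/3 - r + c) (2/3 - c))
      + iota M P (1 - r) (res (- 27)) * iota M P c (res (- 1)) * F2_iota M P (2/3) (1 - r) 1 1 c (res 1) (res 1)
    = - V - cnj V"
proof -
  define A where "A = iota_char (1/3)"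
  define R where "R = iota_char r"
  define C where "C = iota_char c"
  note mc = mult_char_iota
  have A: "mult_char A" and R: "mult_char R" and C: "mult_char C" by (simp_all add: A_def R_def C_def mc)
  have A1: "A (- 1) = 1"
  proof -
    have "A (- 1) ^ 3 = unit_char (- 1)"
      unfolding A_def using iota_char_power[OF third, of 3 "- 1"] by (simp add: iota_char_1)
    then show ?thesis using mult_char_minus_1_sq[OF A] by (simp add: unit_char_minus_1 eval_nat_numeral)
  qed
  have m: "M_integral (- r)" "M_integral (- c)" "M_integral (- (1/3))" using r c third by simp_all
  have cR: "iota_char (1 - r) = (\<lambda>x. cnj (R x))"
    using iota_char_one_plus[OF m(1)] iota_char_minus[OF r] by (simp add: R_def)
  have cA: "iota_char (2/3) = (\<lambda>x. cnj (A x))"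
    using iota_char_one_plus[OF m(3)] iota_char_minus[OF third] by (simp add: A_def)
  have i23: "M_integral (2/3)" 
  proof -
    have "of_nat M * (2/3) = of_nat M * (1/3) + of_nat M * (1/3 :: rat)" by simp
    then show ?thesis using Ints_add[OF third third] by (simp only:)
  qed
  have AC: "iota_char (1/3 - c) = (\<lambda>x. A x * cnj (C x))"
    using iota_char_add[OF third m(2)] iota_char_minus[OF c] by (simp add: A_def C_def)
  have cAC: "iota_char (2/3 - c) = (\<lambda>x. cnj (A x) * cnj (C x))"
    using iota_char_add[OF i23 m(2)] iota_char_minus[OF c] cA by (simp add: C_def)
  have rc: "M_integral (r + c)" using r c by (simp add: distrib_left)
  have RCA: "iota_char (r + c - 1/3) = (\<lambda>x. R x * C x * cnj (A x))"
    using iota_char_add[OF rc m(3)] iota_char_add[OF r c] iota_char_minus[OF third] by (simp add: A_def C_def R_def)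
  have rc': "M_integral (- r + c)" using m(1) c by (simp only: distrib_left Ints_add)
  have RCA': "iota_char (1/3 - r + c) = (\<lambda>x. cnj (R x) * C x * A x)"
    using iota_char_add[OF rc' third] iota_char_add[OF m(1) c] iota_char_minus[OF r]
    by (simp add: A_def C_def R_def algebra_simps)
  have res: "res (- 27) = int_res (- 27)" "res (- 1) = int_res (- 1)" by (simp_all add: int_res_def)
  define S where "S A R = R (- 27) * C (- 1) * (R (- 1) * C (- 1) * appell_char_sum A R C)
     - R (- 27) * Jac C (\<lambda>x. A x * cnj (C x)) * Jac (\<lambda>x. R x * C x * cnj (A x)) (\<lambda>x. A x * cnj (C x))" for A R
  have 1: "S A R = - V"
    unfolding S_def V_def A_def[symmetric] R_def[symmetric] using appell_term_reduction[OF A R C A1] by simp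
  have "S (\<lambda>x. cnj (A x)) (\<lambda>x. cnj (R x)) = - cnj (R 27) * Jac (\<lambda>x. cnj (R x)) (\<lambda>x. cnj (cnj (R x) * cnj (A x)))"
    unfolding S_def by (rule appell_term_reduction[OF mult_char_cnj[OF A] mult_char_cnj[OF R] C]) (simp add: A1)
  also have "\<dots> = - cnj V"
    unfolding V_def A_def[symmetric] R_def[symmetric] by (simp add: Jac_def res_sum_def)
  finally have 2: "S (\<lambda>x. cnj (A x)) (\<lambda>x. cnj (R x)) = - cnj V" .
  have combine: "T - U = - v \<Longrightarrow> T' - U' = - v' \<Longrightarrow> T + (- U - U') + T' = - v - v'"
    for T T' U U' v v' :: complex
  proof -
    assume "T - U = - v" "T' - U' = - v'"
    then have "T = - v + U" "T' = - v' + U'" by (simp_all only: diff_eq_eq)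
    then show ?thesis by simp
  qed
  show ?thesis
    unfolding res iota_int_res Jacobi_iota_eq F2_iota_eq cR cA AC cAC RCA RCA'
    unfolding A_def[symmetric] R_def[symmetric] C_def[symmetric] mult_minus_left
    by (rule combine[OF 1[unfolded S_def] 2[unfolded S_def complex_cnj_cnj]])
qed

end


lemma lcd_props:
  assumes "finite S"
  shows "lcd S > 0 \<and> (\<forall>a\<in>S. of_nat (lcd S) * a \<in> \<int>)"
  unfolding lcd_def
proof (rule LeastI_ex)
  show "\<exists>m. m > 0 \<and> (\<forall>a\<in>S. of_nat m * a \<in> \<int>)"
    using assms
  proof (induction S)
    case (insert a S)
    then obtain m where m: "m > 0" "\<forall>a\<in>S. of_nat m * a \<in> \<int>" by blast
    obtain u v where uv: "quotient_of a = (u, v)" by (metis surj_pair)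
    then have v: "v > 0" "a = of_int u / of_int v"
      using quotient_of_denom_pos quotient_of_div by blast+
    have "of_nat (m * nat v) * a = of_int (int m * u)" using v by simp
    then have "of_nat (m * nat v) * a \<in> \<int>" by (metis Ints_of_int)
    moreover have "of_nat (m * nat v) * b \<in> \<int>" if "b \<in> S" for b
    proof -
      have "of_nat (m * nat v) * b = of_nat (nat v) * (of_nat m * b)" by simp
      then show ?thesis using m(2) that by (metis Ints_mult Ints_of_nat)
    qed
    ultimately show ?case using m(1) v(1) by (intro exI[of _ "m * nat v"]) auto
  qed auto
qed

lemma dvd_of_integral_fraction:
  assumes "of_nat M * (1 / of_nat d :: rat) \<in> \<int>" "d > 0"
  shows "d dvd M"
proof -
  obtain k where "of_nat M * (1 / of_nat d :: rat) = of_int k" using assms(1) by (rule Ints_cases)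
  then have "(of_int (int M) :: rat) = of_int (k * int d)" using assms(2) by (simp add: field_simps)
  then have "int M = k * int d" by (simp only: of_int_eq_iff)
  then have "int d dvd int M" by simp
  then show ?thesis by simp
qed

context prime_above
begin

lemma iota_half_eq_leg:
  assumes "2 dvd M"
  shows "iota_char (1/2) = leg"
proof (rule quadratic_char_unique[OF mult_char_iota])
  obtain k where k: "M = 2 * k" using assms by (rule dvdE)
  then have "M_integral (1/2)" by simp
  from iota_char_power[OF this, of 2] show "iota_char (1/2) x ^ 2 = 1" if "\<not> int p dvd x" for x
    using that by (simp add: iota_char_1 unit_char_def)
  show "nontrivial (iota_char (1/2))" by (rule nontrivial_iota[OF k, of 1]) simp_all
qed

lemma iota_third_cubic:
  assumes "3 dvd M"
  shows "\<forall>x. \<not> int p dvd x \<longrightarrow> iota_char (1/3) x ^ 3 = 1" "nontrivial (iota_char (1/3))"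
proof -
  obtain k where k: "M = 3 * k" using assms by (rule dvdE)
  then have "M_integral (1/3)" by simp
  from iota_char_power[OF this, of 3] show "\<forall>x. \<not> int p dvd x \<longrightarrow> iota_char (1/3) x ^ 3 = 1"
    by (simp add: iota_char_1 unit_char_def)
  show "nontrivial (iota_char (1/3))" by (rule nontrivial_iota[OF k, of 1]) simp_all
qed

lemma p_mod_divisor:
  assumes "d dvd M" "d > 1"
  shows "p mod d = 1"
proof -
  have "[p = 1] (mod d)" using p_cong assms(1) by (rule cong_dvd_modulus_nat)
  then show ?thesis using assms(2) by (simp add: cong_def)
qed

lemma fourier_coeff_f_sharp:
  assumes r: "r \<in> {1/2, 1/3, 1/6, 1/12}" and third: "M_integral (1/3)" and Mr: "M_integral r"
  defines "V \<equiv> iota_char r 27 * Jac (iota_char r) (\<lambda>x. cnj (iota_char r x * iota_char (1/3) x))"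
  shows "fourier_coeff (f_sharp r) p = - V - cnj V"
proof -
  define A where "A = iota_char (1/3)"
  have d3: "3 dvd M" using dvd_of_integral_fraction[of M 3] third by simp
  have A: "mult_char A" "\<forall>x. \<not> int p dvd x \<longrightarrow> A x ^ 3 = 1" "nontrivial A"
    unfolding A_def using mult_char_iota iota_third_cubic[OF d3] by auto
  have p3: "p mod 3 = 1" by (rule p_mod_divisor[OF d3]) simp
  note m3 = cubic_leg_minus_3[OF A p3]
  have V: "V = iota_char r 27 * Jac (iota_char r) (\<lambda>x. cnj (iota_char r x * A x))" by (simp add: V_def A_def)
  from r consider "r = 1/2" | "r = 1/3" | "r = 1/6" | "r = 1/12" by blast
  then show ?thesis
  proof cases
    case 1
    have d2: "2 dvd M" using dvd_of_integral_fraction[of M 2] Mr[unfolded 1] by simp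
    have "V = Jac A leg"
      unfolding V 1 iota_half_eq_leg[OF d2] by (rule value_half[OF A(1) m3])
    then show ?thesis using fourier_coeff_36_Jac[OF A] 1 by (simp add: f_sharp_def)
  next
    case 2
    have "\<not> p dvd 3" using primes_dvd_imp_eq[OF prime, of 3] p3 by auto
    then have "\<not> int p dvd 3" by (metis int_dvd_int_iff of_nat_numeral)
    then have "V = Jac A A"
      unfolding V 2 A_def[symmetric] by (rule value_third[OF A(1,2)])
    then show ?thesis using fourier_coeff_27_Jac[OF A p3] 2 by (simp add: f_sharp_def)
  next
    case 3
    have d6: "6 dvd M" using dvd_of_integral_fraction[of M 6] Mr[unfolded 3] by simp
    then have d2: "2 dvd M" by (rule dvd_trans[rotated]) simp
    have "V = Jac A leg"
      unfolding V
    proof (rule value_sixth[OF _ _ _ m3])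
      show "mult_char (iota_char r)" by (rule mult_char_iota)
      show "iota_char r x ^ 2 = A x" for x using iota_char_power[OF Mr, of 2 x] by (simp add: A_def 3)
      show "iota_char r x ^ 3 = leg x" for x
        using iota_char_power[OF Mr, of 3 x] by (simp add: iota_half_eq_leg[OF d2, symmetric] 3)
    qed
    then show ?thesis using fourier_coeff_36_Jac[OF A] 3 by (simp add: f_sharp_def)
  next
    case 4
    have d12: "12 dvd M" using dvd_of_integral_fraction[of M 12] Mr[unfolded 4] by simp
    then have d2: "2 dvd M" by (rule dvd_trans[rotated]) simp
    from d12 obtain k where k: "M = 12 * k" by (rule dvdE)
    have p12: "p mod 12 = 1" by (rule p_mod_divisor[OF d12]) simp
    have p4: "p mod 4 = 1" using p12 mod_mod_cancel[of 4 12 p] by simp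
    have R: "mult_char (iota_char r)" by (rule mult_char_iota)
    have R4: "iota_char r x ^ 4 = A x" for x using iota_char_power[OF Mr, of 4 x] by (simp add: A_def 4)
    have R6: "iota_char r x ^ 6 = leg x" for x
      using iota_char_power[OF Mr, of 6 x] by (simp add: iota_half_eq_leg[OF d2, symmetric] 4)
    have "V = iota_char r 12 ^ 3 * Jac A A"
      unfolding V
    proof (rule value_twelfth[OF R R4 R6 leg_minus_1[OF p4] _ _ _ A(3)])
      show "nontrivial (iota_char r)" by (rule nontrivial_iota[OF k, of 1]) (simp_all add: 4)
      have "nontrivial (iota_char (1/6))" by (rule nontrivial_iota[OF k, of 2]) simp_all
      moreover have "iota_char r x * iota_char r x = iota_char (1/6) x" for x
        using iota_char_power[OF Mr, of 2 x] by (simp add: 4 power2_eq_square)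
      ultimately show "nontrivial (\<lambda>x. iota_char r x * iota_char r x)" by simp
      have "nontrivial (iota_char (7/12))" by (rule nontrivial_iota[OF k, of 7]) simp_all
      moreover have "iota_char r x * leg x = iota_char (7/12) x" for x
        using iota_char_power[OF Mr, of 7 x] by (simp add: 4 R6[symmetric, unfolded 4] eval_nat_numeral)
      ultimately show "nontrivial (\<lambda>x. iota_char r x * leg x)" by simp
    qed
    moreover have "(iota_char r x ^ 3) ^ 2 = leg x" for x by (simp add: R6 flip: power_mult)
    then have "fourier_coeff f_432_2_c_a p = - (iota_char r 12 ^ 3 * Jac A A) - cnj (iota_char r 12 ^ 3 * Jac A A)"
      using fourier_coeff_432_Jac[OF A p12 mult_char_pow[OF R, of 3]] by simp
    ultimately show ?thesis using 4 by (simp add: f_sharp_def)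
  qed
qed

end

theorem theorem1p5:
  fixes c' r :: rat and M' p :: nat and P :: "complex set" and X :: complex
  assumes r: "r \<in> {1/2, 1/3, 1/6, 1/12}"
    and M': "M' = lcd {1/3, r, c'}"
    and p: "prime p" "[p = 1] (mod M')"
    and P: "prime_ideal_above M' P p"
    and X: "X =
      - iota M' P r (residue M' P (-27)) *
          Jacobi_iota M' P c' (1/3 - c') * Jacobi_iota M' P (r + c' - 1/3) (1/3 - c')
      - iota M' P (1 - r) (residue M' P (-27)) *
          Jacobi_iota M' P c' (2/3 - c') * Jacobi_iota M' P (1/3 - r + c') (2/3 - c')"
  shows "fourier_coeff (f_sharp r) p =
      iota M' P r (residue M' P (-27)) * iota M' P c' (residue M' P (-1)) *
        F2_iota M' P (1/3) r 1 1 c' (residue M' P 1) (residue M' P 1)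
      + X
      + iota M' P (1 - r) (residue M' P (-27)) * iota M' P c' (residue M' P (-1)) *
        F2_iota M' P (2/3) (1 - r) 1 1 c' (residue M' P 1) (residue M' P 1)"
proof -
  have M: "M' > 0" "of_nat M' * (1/3 :: rat) \<in> \<int>" "of_nat M' * r \<in> \<int>" "of_nat M' * c' \<in> \<int>"
    using lcd_props[of "{1/3, r, c'}"] unfolding M'[symmetric] by auto
  have "3 dvd M'" using dvd_of_integral_fraction[of M' 3] M(2) by simp
  then have "[p = 1] (mod 3)" using p(2) cong_dvd_modulus_nat by blast
  then have "p > 2" using prime_mod_3_gt2[OF p(1)] by (simp add: cong_def)
  interpret prime_above p M' P
    by unfold_locales (use p P M(1) \<open>p > 2\<close> in auto)
  show ?thesis
    unfolding X fourier_coeff_f_sharp[OF r M(2,3)] appell_identity[OF M(2,3,4)] ..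
qed

end
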